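(* Let $\rho$ be a Borel probability measure on $\mathbb{R}$ having an exponential moment and a positive drift $\lambda=\int_{\mathbb{R}} y\,d\rho(y)>0$. Then $G-T_\lambda$ is a tempered distribution of fast decrease if and only if $\rho$ is weakly-diophantine. Moreover, in this case, for real $\xi\neq 0$, $$\widehat{G-T_\lambda}(i\xi)=\frac{1}{1-\widehat\rho(-i\xi)}+\frac{1}{\lambda}\,\frac{1}{i\xi}.$$
   Context: $\rho$ has an exponential moment if $\int_{\mathbb{R}} e^{\eta|y|}\,d\rho(y)<+\infty$ for some $\eta>0$. For $|\Re(z)|<\eta$, $\widehat\rho(z)=\int_{\mathbb{R}} e^{-zy}\,d\rho(y)$. For real $l\ge 0$, $\rho$ is $l$-weakly-diophantine if $\liminf_{b\to\pm\infty}|b|^l|1-\widehat\rho(ib)|>0$ ($b$ real); $\rho$ is weakly-diophantine if it is $l$-weakly-diophantine for some $l\geq 0$. The Green kernel is the (locally finite) measure $G=\sum_{n=0}^{+\infty}\tilde\rho^{\star n}$, where $\tilde\rho(A)=\int_{\mathbb{R}}\mathbf{1}_A(-y)\,d\rho(y)$ for Borel $A\subset\mathbb{R}$, so that $G\star f(x)=\sum_{n\ge 0}\int_{\mathbb{R}} f(x+y)\,d\rho^{\star n}(y)$. The measure $T_\lambda$ has density $\frac1\lambda\mathbf{1}_{\mathbb{R}_-}$ with respect to Lebesgue measure, so that $T_\lambda\star f(x)=\frac1\lambda\int_x^{+\infty}f(t)\,dt$. A tempered distribution $T\in\mathcal{S}'(\mathbb{R})$ is of fast decrease if $T\star f\in\mathcal{S}(\mathbb{R})$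 for every $f\in\mathcal{S}(\mathbb{R})$. For $f\in\mathcal{S}(\mathbb{R})$, $\widehat f(i\xi)=\int_{\mathbb{R}} f(x)e^{-i\xi x}\,dx$, and for such a distribution $T$, $\widehat T(i\xi)$ is the function with $T\star f(x)=\frac1{2\pi}\int_{\mathbb{R}} e^{i\xi x}\,\widehat f(i\xi)\,\widehat T(i\xi)\,d\xi$ for all $f\in\mathcal{S}(\mathbb{R})$. *)

theory Defs
  imports "HOL-Probability.Probability"
begin

section \<open>Schwartz functions and tempered distributions on the real line\<close>

definition higher_vderiv :: "nat \<Rightarrow> (real \<Rightarrow> complex) \<Rightarrow> real \<Rightarrow> complex" where
  "higher_vderiv n f = ((\<lambda>g x. vector_derivative g (at x)) ^^ n) f"

definition schwartz :: "(real \<Rightarrow> complex) \<Rightarrow> bool" where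
  "schwartz f \<longleftrightarrow>
     (\<forall>n x. higher_vderiv n f differentiable (at x)) \<and>
     (\<forall>k n. bounded (range (\<lambda>x. x ^ k *\<^sub>R higher_vderiv n f x)))"

definition schwartz_seminorm :: "nat \<Rightarrow> nat \<Rightarrow> (real \<Rightarrow> complex) \<Rightarrow> real" where
  "schwartz_seminorm k n f = (SUP x. norm (x ^ k *\<^sub>R higher_vderiv n f x))"

text \<open>
  A tempered distribution is modelled by a functional on all functions of which only the values on
  Schwartz functions matter. The last clause is continuity at every Schwartz function for the
  topology generated by the seminorms.
\<close>

definition tempered_distribution :: "((real \<Rightarrow> complex) \<Rightarrow> complex) \<Rightarrow> bool" where
  "tempered_distribution T \<longleftrightarrow>
     (\<forall>f g. schwartz f \<longrightarrow> schwartz g \<longrightarrow> T (\<lambda>x. f x + g x) = T f + T g) \<and>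
     (\<forall>c f. schwartz f \<longrightarrow> T (\<lambda>x. c * f x) = c * T f) \<and>
     (\<forall>f. schwartz f \<longrightarrow>
       (\<forall>e>0. \<exists>N. \<exists>d>0. \<forall>g. schwartz g \<longrightarrow>
          (\<forall>k\<le>N. \<forall>n\<le>N. schwartz_seminorm k n (\<lambda>x. g x - f x) < d) \<longrightarrow>
          norm (T g - T f) < e))"

definition dist_convolution :: "((real \<Rightarrow> complex) \<Rightarrow> complex) \<Rightarrow> (real \<Rightarrow> complex) \<Rightarrow> real \<Rightarrow> complex"
  where "dist_convolution T f x = T (\<lambda>y. f (x - y))"

definition fast_decrease :: "((real \<Rightarrow> complex) \<Rightarrow> complex) \<Rightarrow> bool" where
  "fast_decrease T \<longleftrightarrow>
     tempered_distribution T \<and> (\<forall>f. schwartz f \<longrightarrow> schwartz (dist_convolution T f))"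

text \<open>The value of a Fourier transform at \<open>\<xi>\<close> is the one written with argument \<open>i\<xi>\<close> in the
  Laplace-type notation \<open>laplace\<close> below.\<close>

definition fourier :: "(real \<Rightarrow> complex) \<Rightarrow> real \<Rightarrow> complex" where
  "fourier f \<xi> = (\<integral>x. f x * exp (- \<i> * of_real \<xi> * of_real x) \<partial>lborel)"

text \<open>
  The inversion identity alone determines the Fourier transform of a distribution of fast decrease
  only almost everywhere; continuity selects the representative with well-defined point values.
\<close>

definition has_dist_fourier :: "((real \<Rightarrow> complex) \<Rightarrow> complex) \<Rightarrow> (real \<Rightarrow> complex) \<Rightarrow> bool" where
  "has_dist_fourier T h \<longleftrightarrow>
     continuous_on UNIV h \<and>
     (\<forall>f. schwartz f \<longrightarrow> (\<forall>x.
        integrable lborel (\<lambda>\<xi>. exp (\<i> * of_real \<xi> * of_real x) * fourier f \<xi> * h \<xi>) \<and>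
        dist_convolution T f x =
          1 / (2 * of_real pi) *
          (\<integral>\<xi>. exp (\<i> * of_real \<xi> * of_real x) * fourier f \<xi> * h \<xi> \<partial>lborel)))"

definition dist_fourier :: "((real \<Rightarrow> complex) \<Rightarrow> complex) \<Rightarrow> real \<Rightarrow> complex" where
  "dist_fourier T = (THE h. has_dist_fourier T h)"

text \<open>The difference of two (possibly infinite) measures, as a functional; it is meaningful on
  functions integrable with respect to both.\<close>

definition measure_diff :: "real measure \<Rightarrow> real measure \<Rightarrow> (real \<Rightarrow> complex) \<Rightarrow> complex" where
  "measure_diff M N f = (\<integral>y. f y \<partial>M) - (\<integral>y. f y \<partial>N)"

section \<open>The step distribution and its Green kernel\<close>

definition exponential_moment :: "real measure \<Rightarrow> bool" where
  "exponential_moment \<rho> \<longleftrightarrow> (\<exists>\<eta>>0. (\<integral>\<^sup>+y. ennreal (exp (\<eta> * \<bar>y\<bar>)) \<partial>\<rho>) < \<infinity>)"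

definition laplace :: "real measure \<Rightarrow> complex \<Rightarrow> complex" where
  "laplace \<rho> z = (\<integral>y. exp (- z * of_real y) \<partial>\<rho>)"

text \<open>For real \<open>b\<close>, the filter \<open>at_infinity\<close> is \<open>\<bar>b\<bar> \<rightarrow> \<infinity>\<close>, i.e. both signs of infinity
  together.\<close>

definition l_weakly_diophantine :: "real \<Rightarrow> real measure \<Rightarrow> bool" where
  "l_weakly_diophantine l \<rho> \<longleftrightarrow>
     Liminf at_infinity
       (\<lambda>b::real. ereal (\<bar>b\<bar> powr l * norm (1 - laplace \<rho> (\<i> * of_real b)))) > 0"

definition weakly_diophantine :: "real measure \<Rightarrow> bool" where
  "weakly_diophantine \<rho> \<longleftrightarrow> (\<exists>l\<ge>0. l_weakly_diophantine l \<rho>)"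

definition reflected :: "real measure \<Rightarrow> real measure" where
  "reflected \<rho> = distr \<rho> borel uminus"

definition conv_power :: "real measure \<Rightarrow> nat \<Rightarrow> real measure" where
  "conv_power \<mu> n = (convolution \<mu> ^^ n) (return borel 0)"

definition green_kernel :: "real measure \<Rightarrow> real measure" where
  "green_kernel \<rho> =
     measure_of UNIV (sets borel) (\<lambda>A. \<Sum>n. emeasure (conv_power (reflected \<rho>) n) A)"

definition T_kernel :: "real \<Rightarrow> real measure" where
  "T_kernel lam = density lborel (\<lambda>x. ennreal (1 / lam * indicator {..0} x))"

lemma sets_conv_power [simp]: "sets (conv_power \<mu> n) = sets borel"
  by (cases n) (simp_all add: conv_power_def)

lemma sets_green_kernel [simp]: "sets (green_kernel \<rho>) = sets borel"
  unfolding green_kernel_def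
  by (metis sets.sigma_sets_eq sets_measure_of space_borel subset_Pow_Union top_greatest
      sets.space_closed)

lemma emeasure_green_kernel:
  assumes "A \<in> sets borel"
  shows "emeasure (green_kernel \<rho>) A = (\<Sum>n. emeasure (conv_power (reflected \<rho>) n) A)"
proof (rule emeasure_measure_of[OF green_kernel_def])
  show "A \<in> sets (green_kernel \<rho>)" using assms by simp
  show "positive (sets (green_kernel \<rho>)) (\<lambda>A. \<Sum>n. emeasure (conv_power (reflected \<rho>) n) A)"
    by (simp add: positive_def)
  show "countably_additive (sets (green_kernel \<rho>))
      (\<lambda>A. \<Sum>n. emeasure (conv_power (reflected \<rho>) n) A)"
  proof (rule countably_additiveI)
    fix B :: "nat \<Rightarrow> real set"
    assume B: "range B \<subseteq> sets (green_kernel \<rho>)" "disjoint_family B"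
    let ?m = "\<lambda>n i. emeasure (conv_power (reflected \<rho>) n) (B i)"
    have "(\<Sum>i. \<Sum>n. ?m n i) = (\<integral>\<^sup>+n. (\<Sum>i. ?m n i) \<partial>count_space UNIV)"
      by (subst nn_integral_suminf) (simp_all add: nn_integral_count_space_nat)
    also have "\<dots> = (\<Sum>n. \<Sum>i. ?m n i)"
      by (simp add: nn_integral_count_space_nat)
    also have "\<dots> = (\<Sum>n. emeasure (conv_power (reflected \<rho>) n) (\<Union>i. B i))"
      using B by (intro suminf_cong suminf_emeasure) auto
    finally show "(\<Sum>i. \<Sum>n. ?m n i) =
        (\<Sum>n. emeasure (conv_power (reflected \<rho>) n) (\<Union>i. B i))" .
  qed
qed auto

end

theory Submission
  imports Defs
begin

text \<open>
  Write \<open>P f x = \<integral> f (x + y) d\<rho>(y)\<close> and \<open>a \<xi> = \<integral> e\<^sup>i\<^sup>\<xi>\<^sup>y d\<rho>(y)\<close>, so that \<open>P\<close> acts on Fourier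
  transforms as multiplication by \<open>a\<close>. The function \<open>h = 1 / (1 - a) + 1 / (i \<lambda> \<xi>)\<close> extends
  smoothly through the origin, and the diophantine condition says exactly that \<open>h\<close> has no other
  pole and grows polynomially, i.e. that it is a multiplier of the Schwartz space. Let \<open>F\<close> be the
  function with Fourier transform \<open>h\<close> times that of \<open>f\<close>. Then \<open>H = F + T\<^sub>\<lambda> \<star> f\<close> solves
  \<open>H - P H = f\<close>, so the partial sums of the Green potential of \<open>f\<close> are \<open>H - P\<^sup>N H\<close>. Since \<open>H\<close>
  is bounded and vanishes at \<open>+\<infinity>\<close>, where the walk drifts, \<open>P\<^sup>N H\<close> tends to 0 and
  \<open>(G - T\<^sub>\<lambda>) \<star> f = F\<close>. The same identity for \<open>f x = 1 / (1 + x\<^sup>2)\<close> bounds the Green kernel.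

  Conversely, if \<open>G - T\<^sub>\<lambda>\<close> has fast decrease, then \<open>G \<star> \<phi>'\<close> is a Schwartz function solving the
  renewal equation for \<open>\<phi>'\<close>, whence \<open>\<bar>\<xi>\<bar> \<bar>fourier \<phi> \<xi>\<bar> \<le> C \<bar>1 - a \<xi>\<bar>\<close> for each Schwartz function \<open>\<phi>\<close>
  of the form Gaussian times smooth. A superposition of frequencies along which \<open>1 - a\<close>
  decays faster than any power contradicts this.
\<close>

section \<open>Classes of smooth functions\<close>

text \<open>The obstacle is the simple pole of \<open>1 / (1 - a)\<close> at the origin, where
  \<open>1 - a\<close> vanishes with slope \<open>- i * lam\<close>; accordingly
  \<open>T_conv f\<close> need not decay at minus infinity. The singular part is therefore kept in
  physical space as a primitive, built from the kernel
  \<open>(cis (\<xi> * y) - 1) / (i * \<xi>)\<close>, whose singularity is removable and which is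
  bounded by \<open>|y|\<close> uniformly in frequency. Only increments of this primitive enter
  \<open>H - P H\<close>, so the constant of integration disappears.

  Integrability against the Green kernel has to be settled before the potential means anything. The
  function \<open>1 / (1 + x\<^sup>2)\<close> serves because its transform
  \<open>pi * exp (- |\<xi>|)\<close> and its primitive \<open>arctan\<close> are explicit, and
  because a multiple of it dominates any Schwartz function.

  In the converse, a nonnegative Schwartz majorant of the test function justifies exchanging
  \<open>P\<close> with the Green series. The Gaussian factor turns the transform of the
  superposition into a sum of positive bumps, so that no cancellation can hide a bad
  frequency.\<close>

text \<open>Finitely many derivatives with a common growth condition: closure properties of the Schwartz
  space and of its multipliers are inductions on the order \<open>n\<close>.\<close>

fun smooth_upto :: "((real \<Rightarrow> complex) \<Rightarrow> bool) \<Rightarrow> nat \<Rightarrow> (real \<Rightarrow> complex) \<Rightarrow> bool" where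
  "smooth_upto B 0 f \<longleftrightarrow> B f"
| "smooth_upto B (Suc n) f \<longleftrightarrow>
     B f \<and> (\<exists>f'. (\<forall>x. (f has_vector_derivative f' x) (at x)) \<and> smooth_upto B n f')"

definition smooth_in :: "((real \<Rightarrow> complex) \<Rightarrow> bool) \<Rightarrow> (real \<Rightarrow> complex) \<Rightarrow> bool" where
  "smooth_in B f \<longleftrightarrow> (\<forall>n. smooth_upto B n f)"

text \<open>Continuity is part of each of the three classes, so that membership alone gives Borel
  measurability.\<close>

definition bdd_fun :: "(real \<Rightarrow> complex) \<Rightarrow> bool" where
  "bdd_fun f \<longleftrightarrow> continuous_on UNIV f \<and> (\<exists>C. \<forall>x. norm (f x) \<le> C)"

definition polybdd_fun :: "(real \<Rightarrow> complex) \<Rightarrow> bool" where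
  "polybdd_fun f \<longleftrightarrow> continuous_on UNIV f \<and> (\<exists>C k. \<forall>x. norm (f x) \<le> C * (1 + \<bar>x\<bar>) ^ k)"

definition rapid_fun :: "(real \<Rightarrow> complex) \<Rightarrow> bool" where
  "rapid_fun f \<longleftrightarrow> continuous_on UNIV f \<and> (\<forall>k. \<exists>C. \<forall>x. (1 + \<bar>x\<bar>) ^ k * norm (f x) \<le> C)"

lemma smooth_upto_SucI:
  "B f \<Longrightarrow> (\<And>x. (f has_vector_derivative f' x) (at x)) \<Longrightarrow> smooth_upto B n f' \<Longrightarrow> smooth_upto B (Suc n) f"
  by auto

lemma smooth_upto_imp: "smooth_upto B n f \<Longrightarrow> B f"
  by (cases n) auto

lemma smooth_upto_Suc: "smooth_upto B (Suc n) f \<Longrightarrow> smooth_upto B n f"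
  by (induction n arbitrary: f) auto

lemma smooth_in_imp: "smooth_in B f \<Longrightarrow> B f"
  unfolding smooth_in_def using smooth_upto_imp by blast

text \<open>\<open>smooth_upto\<close> asks for a derivative separately at each order; by uniqueness
  of derivatives these witnesses coincide, which leaves one derivative that is again smooth in the
  class.\<close>

lemma smooth_in_deriv:
  assumes "smooth_in B f"
  obtains f' where "\<And>x. (f has_vector_derivative f' x) (at x)" "smooth_in B f'"
proof -
  have *: "smooth_upto B (Suc n) f" for n
    using assms unfolding smooth_in_def by blast
  obtain f' where f': "\<And>x. (f has_vector_derivative f' x) (at x)"
    using *[of 0] by auto
  have "smooth_upto B n f'" for n
  proof -
    obtain g where g: "\<And>x. (f has_vector_derivative g x) (at x)" "smooth_upto B n g"
      using *[of n] by auto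
    have "g = f'"
      using f' g(1) vector_derivative_unique_at by blast
    with g show ?thesis by simp
  qed
  then show thesis using that f' unfolding smooth_in_def by blast
qed

lemma smooth_in_deriv':
  assumes "smooth_in B f" "\<And>x. (f has_vector_derivative f' x) (at x)"
  shows "smooth_in B f'"
proof -
  obtain g where g: "\<And>x. (f has_vector_derivative g x) (at x)" "smooth_in B g"
    using smooth_in_deriv[OF assms(1)] by blast
  have "g = f'"
    using assms(2) g(1) vector_derivative_unique_at by blast
  with g show ?thesis by simp
qed

lemma smooth_upto_mono:
  "smooth_upto B n f \<Longrightarrow> (\<And>f. B f \<Longrightarrow> C f) \<Longrightarrow> smooth_upto C n f"
  by (induction n arbitrary: f) auto

lemma smooth_in_mono: "smooth_in B f \<Longrightarrow> (\<And>f. B f \<Longrightarrow> C f) \<Longrightarrow> smooth_in C f"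
  unfolding smooth_in_def using smooth_upto_mono by metis

lemma smooth_upto_add:
  assumes B: "\<And>f g. B f \<Longrightarrow> B g \<Longrightarrow> B (\<lambda>x. f x + g x)"
  shows "smooth_upto B n f \<Longrightarrow> smooth_upto B n g \<Longrightarrow> smooth_upto B n (\<lambda>x. f x + g x)"
proof (induction n arbitrary: f g)
  case (Suc n)
  obtain f' where f': "\<And>x. (f has_vector_derivative f' x) (at x)" "smooth_upto B n f'"
    using Suc.prems by auto
  obtain g' where g': "\<And>x. (g has_vector_derivative g' x) (at x)" "smooth_upto B n g'"
    using Suc.prems by auto
  have "((\<lambda>x. f x + g x) has_vector_derivative f' x + g' x) (at x)" for x
    by (intro has_vector_derivative_add f' g')
  moreover have "smooth_upto B n (\<lambda>x. f' x + g' x)"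
    by (rule Suc.IH[OF f'(2) g'(2)])
  ultimately show ?case
    using Suc.prems B by (intro smooth_upto_SucI) auto
qed (use B in simp)

text \<open>Leibniz rule with two classes: a rapidly decreasing factor absorbs a multiplier of
  polynomial growth. Both terms of the derivative land in \<open>B\<close>.\<close>

lemma smooth_upto_mult:
  assumes B: "\<And>f g. B f \<Longrightarrow> B g \<Longrightarrow> B (\<lambda>x. f x + g x)"
  and C: "\<And>f g. B f \<Longrightarrow> C g \<Longrightarrow> B (\<lambda>x. f x * g x)"
  shows "smooth_upto B n f \<Longrightarrow> smooth_upto C n g \<Longrightarrow> smooth_upto B n (\<lambda>x. f x * g x)"
proof (induction n arbitrary: f g)
  case (Suc n)
  obtain f' where f': "\<And>x. (f has_vector_derivative f' x) (at x)" "smooth_upto B n f'"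
    using Suc.prems by auto
  obtain g' where g': "\<And>x. (g has_vector_derivative g' x) (at x)" "smooth_upto C n g'"
    using Suc.prems by auto
  have "((\<lambda>x. f x * g x) has_vector_derivative f x * g' x + f' x * g x) (at x)" for x
    by (intro has_vector_derivative_mult f' g')
  moreover have "smooth_upto B n (\<lambda>x. f x * g' x + f' x * g x)"
    by (intro smooth_upto_add B Suc.IH f'(2) g'(2) smooth_upto_Suc[OF Suc.prems(1)]
        smooth_upto_Suc[OF Suc.prems(2)])
  ultimately show ?case
    using Suc.prems C by (intro smooth_upto_SucI) auto
qed (use C in simp)

text \<open>Each differentiation brings out a factor \<open>d\<close>; the coefficient
  \<open>k\<close> is carried in the statement so that the induction can absorb it.\<close>

lemma smooth_upto_affine:
  assumes B: "\<And>f. B f \<Longrightarrow> B (\<lambda>x. f (c + d * x))" "\<And>f k. B f \<Longrightarrow> B (\<lambda>x. k * f x)"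
  shows "smooth_upto B n f \<Longrightarrow> smooth_upto B n (\<lambda>x. k * f (c + d * x))"
proof (induction n arbitrary: f k)
  case (Suc n)
  obtain f' where f': "\<And>x. (f has_vector_derivative f' x) (at x)" "smooth_upto B n f'"
    using Suc.prems by auto
  have "((\<lambda>x. k * f (c + d * x)) has_vector_derivative (k * of_real d) * f' (c + d * x)) (at x)" for x
  proof -
    have "((\<lambda>x. c + d * x) has_vector_derivative d) (at x)"
      by (auto intro!: derivative_eq_intros)
    from vector_diff_chain_at[OF this f'(1)]
    have "((\<lambda>x. f (c + d * x)) has_vector_derivative d *\<^sub>R f' (c + d * x)) (at x)"
      by (simp add: o_def)
    then have "((\<lambda>x. k * f (c + d * x)) has_vector_derivative k * (d *\<^sub>R f' (c + d * x))) (at x)"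
      by (intro has_vector_derivative_mult_right)
    then show ?thesis by (simp add: scaleR_conv_of_real mult_ac)
  qed
  moreover have "smooth_upto B n (\<lambda>x. (k * of_real d) * f' (c + d * x))"
    by (rule Suc.IH[OF f'(2)])
  ultimately show ?case
    using Suc.prems B by (intro smooth_upto_SucI) auto
qed (use B in simp)

lemma smooth_upto_cmult:
  assumes B: "\<And>f k. B f \<Longrightarrow> B (\<lambda>x. k * f x)"
  shows "smooth_upto B n f \<Longrightarrow> smooth_upto B n (\<lambda>x. k * f x)"
proof (induction n arbitrary: f)
  case (Suc n)
  obtain f' where f': "\<And>x. (f has_vector_derivative f' x) (at x)" "smooth_upto B n f'"
    using Suc.prems by auto
  show ?case
  proof (rule smooth_upto_SucI)
    show "((\<lambda>x. k * f x) has_vector_derivative k * f' x) (at x)" for x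
      by (intro has_vector_derivative_mult_right f')
  qed (use Suc f' B in auto)
qed (use B in simp)

text \<open>The derivative \<open>- g' / g\<^sup>2\<close> is again a product of \<open>g'\<close>
  with reciprocals of \<open>g\<close>, so a bound on the reciprocal itself is the one quantitative
  input; for the symbol of the walk the diophantine condition supplies it.\<close>

lemma smooth_upto_inverse:
  assumes B: "\<And>f g. B f \<Longrightarrow> B g \<Longrightarrow> B (\<lambda>x. f x * g x)" "\<And>f g. B f \<Longrightarrow> B g \<Longrightarrow> B (\<lambda>x. f x + g x)"
    "\<And>f k. B f \<Longrightarrow> B (\<lambda>x. k * f x)"
  and g: "B (\<lambda>x. inverse (g x))" "\<And>x. g x \<noteq> 0"
  shows "smooth_upto B n g \<Longrightarrow> smooth_upto B n (\<lambda>x. inverse (g x))"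
proof (induction n)
  case (Suc n)
  obtain g' where g': "\<And>x. (g has_vector_derivative g' x) (at x)" "smooth_upto B n g'"
    using Suc.prems by auto
  have "((\<lambda>x. inverse (g x)) has_vector_derivative
      - 1 * g' x * (inverse (g x) * inverse (g x))) (at x)" for x
  proof -
    have "(inverse has_field_derivative - (inverse (g x) ^ Suc (Suc 0))) (at (g x))"
      using g(2) by (rule DERIV_inverse)
    from field_vector_diff_chain_at[OF g'(1) this]
    show ?thesis by (simp add: o_def mult_ac)
  qed
  moreover have "smooth_upto B n (\<lambda>x. - 1 * g' x * (inverse (g x) * inverse (g x)))"
    by (intro smooth_upto_mult[of B B] smooth_upto_cmult[of B] B Suc.IH g'(2) smooth_upto_Suc[OF Suc.prems]) auto
  ultimately show ?case
    using g(1) by (intro smooth_upto_SucI) auto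
qed (use g in simp)

section \<open>Closure properties of the growth classes\<close>

lemma bdd_funI: "continuous_on UNIV f \<Longrightarrow> (\<And>x. norm (f x) \<le> C) \<Longrightarrow> bdd_fun f"
  unfolding bdd_fun_def by blast

lemma bdd_fun_add: "bdd_fun f \<Longrightarrow> bdd_fun g \<Longrightarrow> bdd_fun (\<lambda>x. f x + g x)"
  unfolding bdd_fun_def by (auto intro!: continuous_intros) (meson add_mono norm_triangle_le)

lemma bdd_fun_cmult: "bdd_fun f \<Longrightarrow> bdd_fun (\<lambda>x. k * f x)"
  unfolding bdd_fun_def
  by (auto intro!: continuous_intros simp: norm_mult) (meson mult_left_mono norm_ge_zero)

lemma polybdd_funE:
  assumes "polybdd_fun f"
  obtains C k where "C \<ge> 0" "\<And>x. norm (f x) \<le> C * (1 + \<bar>x\<bar>) ^ k"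
proof -
  obtain C k where C: "\<And>x. norm (f x) \<le> C * (1 + \<bar>x\<bar>) ^ k"
    using assms unfolding polybdd_fun_def by blast
  have "C \<ge> 0"
    using C[of 0] norm_ge_zero[of "f 0"] by (simp del: norm_ge_zero)
  then show thesis using that C by blast
qed

lemma polybdd_funI:
  "continuous_on UNIV f \<Longrightarrow> (\<And>x. norm (f x) \<le> C * (1 + \<bar>x\<bar>) ^ k) \<Longrightarrow> polybdd_fun f"
  unfolding polybdd_fun_def by blast

lemma polybdd_fun_cont: "polybdd_fun f \<Longrightarrow> continuous_on UNIV f"
  unfolding polybdd_fun_def by blast

lemma polybdd_fun_mult:
  assumes "polybdd_fun f" "polybdd_fun g"
  shows "polybdd_fun (\<lambda>x. f x * g x)"
proof -
  obtain C k where C: "C \<ge> 0" "\<And>x. norm (f x) \<le> C * (1 + \<bar>x\<bar>) ^ k"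
    using assms polybdd_funE by blast
  obtain D m where D: "D \<ge> 0" "\<And>x. norm (g x) \<le> D * (1 + \<bar>x\<bar>) ^ m"
    using assms polybdd_funE by blast
  show ?thesis
  proof (rule polybdd_funI)
    show "norm (f x * g x) \<le> (C * D) * (1 + \<bar>x\<bar>) ^ (k + m)" for x
      using mult_mono[OF C(2)[of x] D(2)[of x]] C(1) by (simp add: norm_mult power_add mult_ac)
  qed (use assms in \<open>auto intro!: continuous_intros dest: polybdd_fun_cont\<close>)
qed

lemma polybdd_fun_add:
  assumes "polybdd_fun f" "polybdd_fun g"
  shows "polybdd_fun (\<lambda>x. f x + g x)"
proof -
  obtain C k where C: "C \<ge> 0" "\<And>x. norm (f x) \<le> C * (1 + \<bar>x\<bar>) ^ k"
    using assms polybdd_funE by blast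
  obtain D m where D: "D \<ge> 0" "\<And>x. norm (g x) \<le> D * (1 + \<bar>x\<bar>) ^ m"
    using assms polybdd_funE by blast
  show ?thesis
  proof (rule polybdd_funI)
    fix x :: real
    have "norm (f x + g x) \<le> C * (1 + \<bar>x\<bar>) ^ k + D * (1 + \<bar>x\<bar>) ^ m"
      using C(2)[of x] D(2)[of x] norm_triangle_ineq[of "f x" "g x"] by linarith
    also have "\<dots> \<le> C * (1 + \<bar>x\<bar>) ^ (k + m) + D * (1 + \<bar>x\<bar>) ^ (k + m)"
      using C(1) D(1) by (intro add_mono mult_left_mono power_increasing) auto
    finally show "norm (f x + g x) \<le> (C + D) * (1 + \<bar>x\<bar>) ^ (k + m)"
      by (simp add: algebra_simps)
  qed (use assms in \<open>auto intro!: continuous_intros dest: polybdd_fun_cont\<close>)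
qed

lemma polybdd_fun_cmult:
  assumes "polybdd_fun f"
  shows "polybdd_fun (\<lambda>x. k * f x)"
  by (rule polybdd_fun_mult[OF _ assms], rule polybdd_funI[of _ "norm k" 0]) auto

lemma rapid_funE:
  assumes "rapid_fun f"
  obtains C where "C \<ge> 0" "\<And>x. (1 + \<bar>x\<bar>) ^ k * norm (f x) \<le> C"
proof -
  obtain C where C: "\<And>x. (1 + \<bar>x\<bar>) ^ k * norm (f x) \<le> C"
    using assms unfolding rapid_fun_def by blast
  have "C \<ge> 0"
    using C[of 0] by (simp add: order_trans[OF norm_ge_zero])
  then show thesis using that C by blast
qed

lemma rapid_funI:
  "continuous_on UNIV f \<Longrightarrow> (\<And>k. \<exists>C. \<forall>x. (1 + \<bar>x\<bar>) ^ k * norm (f x) \<le> C) \<Longrightarrow> rapid_fun f"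
  unfolding rapid_fun_def by blast

lemma rapid_fun_cont: "rapid_fun f \<Longrightarrow> continuous_on UNIV f"
  unfolding rapid_fun_def by blast

lemma rapid_fun_add:
  assumes "rapid_fun f" "rapid_fun g"
  shows "rapid_fun (\<lambda>x. f x + g x)"
proof (rule rapid_funI)
  fix k :: nat
  obtain C where C: "\<And>x. (1 + \<bar>x\<bar>) ^ k * norm (f x) \<le> C"
    using assms(1) unfolding rapid_fun_def by blast
  obtain D where D: "\<And>x. (1 + \<bar>x\<bar>) ^ k * norm (g x) \<le> D"
    using assms(2) unfolding rapid_fun_def by blast
  have "(1 + \<bar>x\<bar>) ^ k * norm (f x + g x) \<le> C + D" for x
  proof -
    have "(1 + \<bar>x\<bar>) ^ k * norm (f x + g x) \<le> (1 + \<bar>x\<bar>) ^ k * (norm (f x) + norm (g x))"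
      by (intro mult_left_mono norm_triangle_ineq) auto
    also have "\<dots> \<le> C + D"
      using C[of x] D[of x] by (simp add: algebra_simps)
    finally show ?thesis .
  qed
  then show "\<exists>C. \<forall>x. (1 + \<bar>x\<bar>) ^ k * norm (f x + g x) \<le> C" by blast
qed (use assms in \<open>auto intro!: continuous_intros dest: rapid_fun_cont\<close>)

lemma rapid_fun_mult:
  assumes "rapid_fun f" "polybdd_fun g"
  shows "rapid_fun (\<lambda>x. f x * g x)"
proof (rule rapid_funI)
  fix k :: nat
  obtain D m where D: "D \<ge> 0" "\<And>x. norm (g x) \<le> D * (1 + \<bar>x\<bar>) ^ m"
    using assms polybdd_funE by blast
  obtain C where C: "\<And>x. (1 + \<bar>x\<bar>) ^ (k + m) * norm (f x) \<le> C"
    using assms(1) unfolding rapid_fun_def by blast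
  have "(1 + \<bar>x\<bar>) ^ k * norm (f x * g x) \<le> D * C" for x
  proof -
    have "(1 + \<bar>x\<bar>) ^ k * norm (f x * g x) \<le> ((1 + \<bar>x\<bar>) ^ k * norm (f x)) * (D * (1 + \<bar>x\<bar>) ^ m)"
      using mult_left_mono[OF D(2)[of x], of "(1 + \<bar>x\<bar>) ^ k * norm (f x)"] by (simp add: norm_mult mult_ac)
    also have "\<dots> = D * ((1 + \<bar>x\<bar>) ^ (k + m) * norm (f x))"
      by (simp add: power_add mult_ac)
    also have "\<dots> \<le> D * C"
      using C D(1) by (intro mult_left_mono)
    finally show ?thesis .
  qed
  then show "\<exists>C. \<forall>x. (1 + \<bar>x\<bar>) ^ k * norm (f x * g x) \<le> C" by blast
qed (use assms in \<open>auto intro!: continuous_intros dest: rapid_fun_cont polybdd_fun_cont\<close>)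

lemma bdd_fun_imp_polybdd: "bdd_fun f \<Longrightarrow> polybdd_fun f"
  unfolding bdd_fun_def polybdd_fun_def by (metis power_0 mult_1_right)

lemma rapid_fun_imp_bdd: "rapid_fun f \<Longrightarrow> bdd_fun f"
  unfolding bdd_fun_def rapid_fun_def by (metis power_0 mult_1)

lemma rapid_fun_cmult: "rapid_fun f \<Longrightarrow> rapid_fun (\<lambda>x. k * f x)"
  using rapid_fun_mult[of f "\<lambda>_. k"] bdd_fun_imp_polybdd[of "\<lambda>_. k"]
  by (auto simp: bdd_fun_def mult.commute)

text \<open>With \<open>d = 1\<close> these are translations, with \<open>d = -1\<close>
  reflections; both change the weight \<open>1 + |x|\<close> by at most the factor
  \<open>1 + |c|\<close>.\<close>

lemma rapid_fun_affine:
  assumes f: "rapid_fun f" and d: "d \<in> {1, -1}"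
  shows "rapid_fun (\<lambda>x. f (c + d * x))"
proof (rule rapid_funI)
  fix k :: nat
  obtain C where C: "\<And>x. (1 + \<bar>x\<bar>) ^ k * norm (f x) \<le> C"
    using f unfolding rapid_fun_def by blast
  have "(1 + \<bar>x\<bar>) ^ k * norm (f (c + d * x)) \<le> (1 + \<bar>c\<bar>) ^ k * C" for x
  proof -
    have "1 + \<bar>x\<bar> \<le> 1 + (\<bar>c\<bar> + \<bar>c + d * x\<bar>)"
      using d by auto
    also have "\<dots> \<le> (1 + \<bar>c\<bar>) * (1 + \<bar>c + d * x\<bar>)"
      by (simp add: algebra_simps)
    finally have "(1 + \<bar>x\<bar>) ^ k \<le> ((1 + \<bar>c\<bar>) * (1 + \<bar>c + d * x\<bar>)) ^ k"
      by (rule power_mono) auto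
    then have "(1 + \<bar>x\<bar>) ^ k * norm (f (c + d * x))
        \<le> ((1 + \<bar>c\<bar>) ^ k * (1 + \<bar>c + d * x\<bar>) ^ k) * norm (f (c + d * x))"
      by (intro mult_right_mono) (auto simp: power_mult_distrib)
    also have "\<dots> \<le> (1 + \<bar>c\<bar>) ^ k * C"
      using mult_left_mono[OF C[of "c + d * x"], of "(1 + \<bar>c\<bar>) ^ k"] by (simp add: mult_ac)
    finally show ?thesis .
  qed
  then show "\<exists>C. \<forall>x. (1 + \<bar>x\<bar>) ^ k * norm (f (c + d * x)) \<le> C" by blast
  show "continuous_on UNIV (\<lambda>x. f (c + d * x))"
    by (intro continuous_on_compose2[OF rapid_fun_cont[OF f]] continuous_intros) auto
qed

section \<open>Identification with the Schwartz space\<close>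

lemma higher_vderiv_Suc:
  "higher_vderiv (Suc n) f = higher_vderiv n (\<lambda>x. vector_derivative f (at x))"
  unfolding higher_vderiv_def funpow_Suc_right by simp

text \<open>Links the existential witnesses to the total function \<open>vector_derivative\<close>,
  through which \<open>schwartz\<close> is phrased.\<close>

lemma smooth_upto_iff_higher_vderiv:
  "smooth_upto B n f \<longleftrightarrow>
     (\<forall>m\<le>n. B (higher_vderiv m f)) \<and> (\<forall>m<n. \<forall>x. higher_vderiv m f differentiable (at x))"
proof (induction n arbitrary: f)
  case 0
  show ?case by (simp add: higher_vderiv_def)
next
  case (Suc n)
  let ?f' = "\<lambda>x. vector_derivative f (at x)"
  have "(\<exists>f'. (\<forall>x. (f has_vector_derivative f' x) (at x)) \<and> smooth_upto B n f') \<longleftrightarrow>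
      (\<forall>x. f differentiable (at x)) \<and> smooth_upto B n ?f'" (is "?L \<longleftrightarrow> ?R")
  proof
    assume ?L
    then obtain f' where f': "\<And>x. (f has_vector_derivative f' x) (at x)" "smooth_upto B n f'"
      by blast
    have "?f' = f'" using f'(1) vector_derivative_at by blast
    with f' show ?R using differentiableI_vector by metis
  next
    assume ?R
    then show ?L using vector_derivative_works by (intro exI[of _ ?f']) blast
  qed
  then have "smooth_upto B (Suc n) f \<longleftrightarrow> B f \<and> (\<forall>x. f differentiable (at x)) \<and> smooth_upto B n ?f'"
    by simp
  also have "\<dots> \<longleftrightarrow> (B f \<and> (\<forall>m\<le>n. B (higher_vderiv (Suc m) f))) \<and>
      ((\<forall>x. f differentiable (at x)) \<and> (\<forall>m<n. \<forall>x. higher_vderiv (Suc m) f differentiable (at x)))"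
    unfolding Suc.IH higher_vderiv_Suc by blast
  also have "\<dots> \<longleftrightarrow> (\<forall>m\<le>Suc n. B (higher_vderiv m f)) \<and>
      (\<forall>m<Suc n. \<forall>x. higher_vderiv m f differentiable (at x))"
  proof -
    have [simp]: "higher_vderiv 0 f = f" by (simp add: higher_vderiv_def)
    show ?thesis
      by (simp only: All_less_Suc2 less_Suc_eq_le[symmetric]) simp
  qed
  finally show ?case .
qed

lemma rapid_fun_iff:
  assumes "continuous_on UNIV f"
  shows "rapid_fun f \<longleftrightarrow> (\<forall>k. bounded (range (\<lambda>x. x ^ k *\<^sub>R f x)))"
proof
  assume R: "\<forall>k. bounded (range (\<lambda>x. x ^ k *\<^sub>R f x))"
  show "rapid_fun f"
  proof (rule rapid_funI[OF assms])
    fix k :: nat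
    obtain C where C: "\<And>x. norm (x ^ 0 *\<^sub>R f x) \<le> C"
      using R[rule_format, of 0] unfolding bounded_iff by auto
    obtain D where D: "\<And>x. norm (x ^ k *\<^sub>R f x) \<le> D"
      using R[rule_format, of k] unfolding bounded_iff by auto
    have "(1 + \<bar>x\<bar>) ^ k * norm (f x) \<le> 2 ^ k * (C + D)" for x
    proof -
      \<comment> \<open>The sup norm and one monomial control the whole weight:
        \<open>1 + |x|\<close> is at most 2 or at most \<open>2 * |x|\<close>, according to whether
        \<open>|x|\<close> exceeds 1.\<close>
      have "(1 + \<bar>x\<bar>) ^ k \<le> 2 ^ k * (1 + \<bar>x\<bar> ^ k)"
      proof (cases "\<bar>x\<bar> \<le> 1")
        case True
        then have "(1 + \<bar>x\<bar>) ^ k \<le> 2 ^ k" by (intro power_mono) auto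
        also have "\<dots> \<le> 2 ^ k * (1 + \<bar>x\<bar> ^ k)" by simp
        finally show ?thesis .
      next
        case False
        then have "(1 + \<bar>x\<bar>) ^ k \<le> (2 * \<bar>x\<bar>) ^ k" by (intro power_mono) auto
        also have "\<dots> \<le> 2 ^ k * (1 + \<bar>x\<bar> ^ k)" by (simp add: power_mult_distrib)
        finally show ?thesis .
      qed
      then have "(1 + \<bar>x\<bar>) ^ k * norm (f x) \<le> 2 ^ k * (1 + \<bar>x\<bar> ^ k) * norm (f x)"
        by (intro mult_right_mono) auto
      also have "\<dots> = 2 ^ k * (norm (x ^ 0 *\<^sub>R f x) + norm (x ^ k *\<^sub>R f x))"
        by (simp add: algebra_simps power_abs)
      also have "\<dots> \<le> 2 ^ k * (C + D)"
        by (intro mult_left_mono add_mono C D) auto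
      finally show ?thesis .
    qed
    then show "\<exists>C. \<forall>x. (1 + \<bar>x\<bar>) ^ k * norm (f x) \<le> C" by blast
  qed
next
  assume "rapid_fun f"
  then have *: "\<exists>C. \<forall>x. (1 + \<bar>x\<bar>) ^ k * norm (f x) \<le> C" for k
    unfolding rapid_fun_def by blast
  have "bounded (range (\<lambda>x. x ^ k *\<^sub>R f x))" for k
  proof -
    obtain C where C: "\<And>x. (1 + \<bar>x\<bar>) ^ k * norm (f x) \<le> C" using *[of k] by blast
    have "norm (x ^ k *\<^sub>R f x) \<le> C" for x
    proof -
      have "\<bar>x\<bar> ^ k * norm (f x) \<le> (1 + \<bar>x\<bar>) ^ k * norm (f x)"
        by (intro mult_right_mono power_mono) auto
      then show ?thesis using C[of x] by (simp add: power_abs)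
    qed
    then show ?thesis unfolding bounded_iff by blast
  qed
  then show "\<forall>k. bounded (range (\<lambda>x. x ^ k *\<^sub>R f x))" by blast
qed

lemma schwartz_iff: "schwartz f \<longleftrightarrow> smooth_in rapid_fun f"
proof
  assume f: "schwartz f"
  have "rapid_fun (higher_vderiv n f)" for n
  proof (subst rapid_fun_iff)
    show "continuous_on UNIV (higher_vderiv n f)"
      using f unfolding schwartz_def
      by (auto intro!: continuous_at_imp_continuous_on differentiable_imp_continuous_within)
  qed (use f in \<open>auto simp: schwartz_def\<close>)
  then show "smooth_in rapid_fun f"
    using f unfolding smooth_in_def smooth_upto_iff_higher_vderiv schwartz_def by blast
next
  assume f: "smooth_in rapid_fun f"
  have *: "rapid_fun (higher_vderiv n f)" "\<forall>x. higher_vderiv n f differentiable (at x)" for n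
    using f[unfolded smooth_in_def, rule_format, of "Suc n"]
    unfolding smooth_upto_iff_higher_vderiv by auto
  show "schwartz f"
    unfolding schwartz_def
    using *(2) rapid_fun_iff[OF rapid_fun_cont[OF *(1)]] *(1) by blast
qed

lemma schwartz_rapid: "schwartz f \<Longrightarrow> rapid_fun f"
  unfolding schwartz_iff by (rule smooth_in_imp)

lemma schwartz_continuous: "schwartz f \<Longrightarrow> continuous_on UNIV f"
  using schwartz_rapid rapid_fun_cont by blast

lemma schwartz_borel [measurable_dest]: "schwartz f \<Longrightarrow> f \<in> borel_measurable borel"
  using schwartz_continuous borel_measurable_continuous_onI by blast

lemma schwartz_deriv:
  assumes "schwartz f"
  obtains f' where "\<And>x. (f has_vector_derivative f' x) (at x)" "schwartz f'"
  using smooth_in_deriv assms unfolding schwartz_iff by blast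

lemma schwartz_add: "schwartz f \<Longrightarrow> schwartz g \<Longrightarrow> schwartz (\<lambda>x. f x + g x)"
  unfolding schwartz_iff smooth_in_def using smooth_upto_add[of rapid_fun] rapid_fun_add by blast

lemma schwartz_cmult: "schwartz f \<Longrightarrow> schwartz (\<lambda>x. k * f x)"
  unfolding schwartz_iff smooth_in_def using smooth_upto_cmult[of rapid_fun] rapid_fun_cmult by blast

lemma schwartz_diff: "schwartz f \<Longrightarrow> schwartz g \<Longrightarrow> schwartz (\<lambda>x. f x - g x)"
  using schwartz_add[of f "\<lambda>x. - 1 * g x"] schwartz_cmult[of g "-1"] by simp

lemma schwartz_mult:
  "schwartz f \<Longrightarrow> smooth_in polybdd_fun g \<Longrightarrow> schwartz (\<lambda>x. f x * g x)"
  unfolding schwartz_iff smooth_in_def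
  using smooth_upto_mult[of rapid_fun polybdd_fun] rapid_fun_mult rapid_fun_add by blast

lemma schwartz_affine:
  assumes "schwartz f" "d \<in> {1, -1}"
  shows "schwartz (\<lambda>x. f (c + d * x))"
  using assms smooth_upto_affine[of rapid_fun c d _ f 1] rapid_fun_affine[OF _ assms(2)] rapid_fun_cmult
  unfolding schwartz_iff smooth_in_def by (metis (no_types, lifting) ext mult_1)

lemma schwartz_reflect: "schwartz f \<Longrightarrow> schwartz (\<lambda>y. f (x - y))"
  using schwartz_affine[of f "-1" x] by simp

lemma schwartz_shift: "schwartz f \<Longrightarrow> schwartz (\<lambda>y. f (x + y))"
  using schwartz_affine[of f 1 x] by simp

lemma smooth_polybdd_mult:
  "smooth_in polybdd_fun f \<Longrightarrow> smooth_in polybdd_fun g \<Longrightarrow> smooth_in polybdd_fun (\<lambda>x. f x * g x)"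
  unfolding smooth_in_def
  using smooth_upto_mult[of polybdd_fun polybdd_fun] polybdd_fun_mult polybdd_fun_add by blast

lemma smooth_polybdd_inverse:
  "smooth_in polybdd_fun g \<Longrightarrow> polybdd_fun (\<lambda>x. inverse (g x)) \<Longrightarrow> (\<And>x. g x \<noteq> 0) \<Longrightarrow>
   smooth_in polybdd_fun (\<lambda>x. inverse (g x))"
  unfolding smooth_in_def
  using smooth_upto_inverse[of polybdd_fun g] polybdd_fun_mult polybdd_fun_add polybdd_fun_cmult by blast

lemma smooth_bdd_imp_polybdd: "smooth_in bdd_fun f \<Longrightarrow> smooth_in polybdd_fun f"
  by (erule smooth_in_mono) (rule bdd_fun_imp_polybdd)

lemma smooth_polybdd_const: "smooth_in polybdd_fun (\<lambda>x. c)"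
proof -
  have "smooth_upto polybdd_fun n (\<lambda>x. c)" for n
  proof (induction n arbitrary: c)
    case 0
    show ?case by (simp, rule polybdd_funI[of _ "norm c" 0]) auto
  next
    case (Suc n)
    have "polybdd_fun (\<lambda>x. c)" by (rule polybdd_funI[of _ "norm c" 0]) auto
    with Suc[of 0] show ?case by (auto intro!: exI[of _ "\<lambda>_. 0"])
  qed
  then show ?thesis by (simp add: smooth_in_def)
qed

lemma smooth_polybdd_ident: "smooth_in polybdd_fun (\<lambda>x. of_real x)"
proof -
  have *: "polybdd_fun (\<lambda>x. of_real x)"
    by (rule polybdd_funI[of _ 1 1]) (auto intro!: continuous_intros)
  have "smooth_upto polybdd_fun n (\<lambda>x. of_real x)" for n
  proof (cases n)
    case (Suc m)
    have "((\<lambda>x. complex_of_real x) has_vector_derivative 1) (at x)" for x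
      by (auto intro!: derivative_eq_intros)
    with * smooth_polybdd_const[of 1] show ?thesis
      unfolding Suc smooth_in_def by (auto intro!: exI[of _ "\<lambda>_. 1"])
  qed (use * in auto)
  then show ?thesis by (simp add: smooth_in_def)
qed

section \<open>Integrals depending on a parameter\<close>

lemma cis_borel [measurable]: "cis \<in> borel_measurable borel"
  by (intro borel_measurable_continuous_onI continuous_intros)

text \<open>This form of the derivative can be tested along sequences, as dominated convergence
  requires.\<close>

lemma has_vector_derivative_iff_quotient:
  fixes f :: "real \<Rightarrow> 'a::real_normed_vector"
  shows "(f has_vector_derivative d) (at x) \<longleftrightarrow> ((\<lambda>y. (f y - f x) /\<^sub>R (y - x)) \<longlongrightarrow> d) (at x)"
proof -
  have "(f has_vector_derivative d) (at x) \<longleftrightarrow>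
      ((\<lambda>y. norm (f y - f x - (y - x) *\<^sub>R d) / norm (y - x)) \<longlongrightarrow> 0) (at x)"
    unfolding has_vector_derivative_def has_derivative_iff_norm
    by (auto simp: bounded_linear_scaleR_left)
  also have "\<dots> \<longleftrightarrow> ((\<lambda>y. norm ((f y - f x) /\<^sub>R (y - x) - d)) \<longlongrightarrow> 0) (at x)"
  proof (rule filterlim_cong[OF refl refl], unfold eventually_at, intro exI[of _ 1] conjI ballI impI)
    fix y :: real assume y: "y \<noteq> x \<and> dist y x < 1"
    then have "(f y - f x) /\<^sub>R (y - x) - d = (f y - f x - (y - x) *\<^sub>R d) /\<^sub>R (y - x)"
      by (simp add: scaleR_diff_right)
    then show "norm (f y - f x - (y - x) *\<^sub>R d) / norm (y - x) = norm ((f y - f x) /\<^sub>R (y - x) - d)"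
      by (simp add: divide_inverse mult.commute)
  qed auto
  also have "\<dots> \<longleftrightarrow> ((\<lambda>y. (f y - f x) /\<^sub>R (y - x)) \<longlongrightarrow> d) (at x)"
    by (simp add: tendsto_norm_zero_iff LIM_zero_iff)
  finally show ?thesis .
qed

text \<open>Dominated convergence for difference quotients; the mean value inequality turns the
  bound \<open>B\<close> on the derivative into a bound on every quotient.\<close>

lemma has_vector_derivative_integral:
  fixes F F' :: "real \<Rightarrow> 'a \<Rightarrow> complex"
  assumes int: "\<And>x. integrable M (F x)"
    and deriv: "\<And>x y. y \<in> space M \<Longrightarrow> ((\<lambda>x. F x y) has_vector_derivative F' x y) (at x)"
    and bound: "\<And>x y. y \<in> space M \<Longrightarrow> norm (F' x y) \<le> B y"
    and meas [measurable]: "F' x \<in> borel_measurable M" and B: "integrable M B"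
  shows "((\<lambda>x. \<integral>y. F x y \<partial>M) has_vector_derivative (\<integral>y. F' x y \<partial>M)) (at x)"
proof -
  have "((\<lambda>h. ((\<integral>y. F h y \<partial>M) - (\<integral>y. F x y \<partial>M)) /\<^sub>R (h - x)) \<longlongrightarrow> (\<integral>y. F' x y \<partial>M)) (at x)"
    unfolding tendsto_at_iff_sequentially
  proof (intro allI impI)
    fix X :: "nat \<Rightarrow> real" assume X: "\<forall>i. X i \<in> UNIV - {x}" "X \<longlonglongrightarrow> x"
    have "(\<lambda>n. \<integral>y. (F (X n) y - F x y) /\<^sub>R (X n - x) \<partial>M) \<longlonglongrightarrow> (\<integral>y. F' x y \<partial>M)"
    proof (rule integral_dominated_convergence[OF _ _ B])
      show "F' x \<in> borel_measurable M" by measurable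
      show "(\<lambda>y. (F (X n) y - F x y) /\<^sub>R (X n - x)) \<in> borel_measurable M" for n
        using int by (intro borel_measurable_scaleR borel_measurable_diff) (auto simp: borel_measurable_integrable)
      show "AE y in M. (\<lambda>n. (F (X n) y - F x y) /\<^sub>R (X n - x)) \<longlonglongrightarrow> F' x y"
      proof (rule AE_I2)
        fix y assume "y \<in> space M"
        have "((\<lambda>h. (F h y - F x y) /\<^sub>R (h - x)) \<longlongrightarrow> F' x y) (at x)"
          using deriv[OF \<open>y \<in> space M\<close>, of x] by (simp add: has_vector_derivative_iff_quotient)
        then show "(\<lambda>n. (F (X n) y - F x y) /\<^sub>R (X n - x)) \<longlonglongrightarrow> F' x y"
          using X unfolding tendsto_at_iff_sequentially by (auto simp: o_def)
      qed
      show "AE y in M. norm ((F (X n) y - F x y) /\<^sub>R (X n - x)) \<le> B y" for n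
      proof (rule AE_I2)
        fix y assume y: "y \<in> space M"
        have "norm (F (X n) y - F x y) \<le> B y * norm (X n - x)"
          by (rule differentiable_bound[of UNIV "\<lambda>x. F x y" "\<lambda>x h. h *\<^sub>R F' x y"])
            (use deriv[OF y] bound[OF y] in \<open>auto simp: has_vector_derivative_def onorm_scaleR_left
              bounded_linear_ident onorm_id mult.commute intro!: onorm_bound order_trans[OF norm_ge_zero]\<close>)
        then show "norm ((F (X n) y - F x y) /\<^sub>R (X n - x)) \<le> B y"
          using X(1) by (auto simp: divide_simps)
      qed
    qed
    then show "((\<lambda>h. ((\<integral>y. F h y \<partial>M) - (\<integral>y. F x y \<partial>M)) /\<^sub>R (h - x)) \<circ> X) \<longlonglongrightarrow> (\<integral>y. F' x y \<partial>M)"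
      using int by (simp add: o_def)
  qed
  then show ?thesis by (simp add: has_vector_derivative_iff_quotient)
qed

text \<open>Truncation to symmetric intervals reduces integrals over the line to the fundamental
  theorem on compact intervals.\<close>

lemma LIMSEQ_integral_symmetric:
  fixes f :: "real \<Rightarrow> complex"
  assumes f: "integrable lborel f"
  shows "(\<lambda>n. \<integral>x. indicator {- real n..real n} x *\<^sub>R f x \<partial>lborel) \<longlonglongrightarrow> (\<integral>x. f x \<partial>lborel)"
proof (rule integral_dominated_convergence[where w = "\<lambda>x. norm (f x)"])
  show "AE x in lborel. (\<lambda>n. indicator {- real n..real n} x *\<^sub>R f x) \<longlonglongrightarrow> f x"
  proof (rule AE_I2, rule tendsto_eventually)
    fix x :: real
    obtain N where "\<bar>x\<bar> \<le> real N" using real_arch_simple by blast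
    then show "\<forall>\<^sub>F n in sequentially. indicator {- real n..real n} x *\<^sub>R f x = f x"
      unfolding eventually_sequentially by (intro exI[of _ N]) (auto simp: indicator_def)
  qed
qed (use f in \<open>auto simp: indicator_def intro!: integrable_norm\<close>)

lemma LIMSEQ_integral_derivative:
  fixes F f :: "real \<Rightarrow> complex"
  assumes F: "\<And>x. (F has_vector_derivative f x) (at x)"
    and f: "continuous_on UNIV f" "integrable lborel f"
  shows "(\<lambda>n. F (real n) - F (- real n)) \<longlonglongrightarrow> (\<integral>x. f x \<partial>lborel)"
proof -
  have "(\<integral>x. indicator {- real n..real n} x *\<^sub>R f x \<partial>lborel) = F (real n) - F (- real n)" for n
    by (rule integral_FTC_Icc)
      (auto intro: has_vector_derivative_at_within F continuous_on_subset[OF f(1)])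
  with LIMSEQ_integral_symmetric[OF f(2)] show ?thesis by simp
qed

text \<open>Characteristic functions and Fourier transforms are both of the form below.\<close>

lemma smooth_weighted_char:
  fixes w :: "'a \<Rightarrow> complex" and Z :: "'a \<Rightarrow> real"
  assumes [measurable]: "Z \<in> borel_measurable M" "w \<in> borel_measurable M"
    and int: "\<And>n. integrable M (\<lambda>\<omega>. norm (w \<omega>) * \<bar>Z \<omega>\<bar> ^ n)"
  shows "((\<lambda>\<xi>. \<integral>\<omega>. w \<omega> * cis (\<xi> * Z \<omega>) \<partial>M) has_vector_derivative
      (\<integral>\<omega>. (\<i> * of_real (Z \<omega>) * w \<omega>) * cis (\<xi> * Z \<omega>) \<partial>M)) (at \<xi>)"
    and "smooth_in bdd_fun (\<lambda>\<xi>. \<integral>\<omega>. w \<omega> * cis (\<xi> * Z \<omega>) \<partial>M)"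
proof -
  \<comment> \<open>Stated for an arbitrary weight \<open>v\<close>, because each derivative
    multiplies the weight by \<open>\<i> * Z\<close>, and the moment condition is stable under
    this.\<close>
  have deriv: "((\<lambda>\<xi>. \<integral>\<omega>. v \<omega> * cis (\<xi> * Z \<omega>) \<partial>M) has_vector_derivative
      (\<integral>\<omega>. (\<i> * of_real (Z \<omega>) * v \<omega>) * cis (\<xi> * Z \<omega>) \<partial>M)) (at \<xi>)"
    if [measurable]: "v \<in> borel_measurable M"
      and int: "\<And>n. integrable M (\<lambda>\<omega>. norm (v \<omega>) * \<bar>Z \<omega>\<bar> ^ n)" for v \<xi>
  proof (rule has_vector_derivative_integral[where B = "\<lambda>\<omega>. norm (v \<omega>) * \<bar>Z \<omega>\<bar> ^ 1"])
    show "integrable M (\<lambda>\<omega>. v \<omega> * cis (\<xi> * Z \<omega>))" for \<xi>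
      by (rule Bochner_Integration.integrable_bound[OF int[of 0]]) (auto simp: norm_mult)
    show "((\<lambda>\<xi>. v \<omega> * cis (\<xi> * Z \<omega>)) has_vector_derivative
       (\<i> * of_real (Z \<omega>) * v \<omega>) * cis (\<xi> * Z \<omega>)) (at \<xi>)" for \<xi> \<omega>
      unfolding has_vector_derivative_def
      by (auto intro!: derivative_eq_intros ext simp: scaleR_conv_of_real)
  qed (use int[of 1] in \<open>auto simp: norm_mult\<close>)
  have B: "bdd_fun (\<lambda>\<xi>. \<integral>\<omega>. v \<omega> * cis (\<xi> * Z \<omega>) \<partial>M)"
    if "v \<in> borel_measurable M" "\<And>n. integrable M (\<lambda>\<omega>. norm (v \<omega>) * \<bar>Z \<omega>\<bar> ^ n)" for v
  proof (rule bdd_funI)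
    show "continuous_on UNIV (\<lambda>\<xi>. \<integral>\<omega>. v \<omega> * cis (\<xi> * Z \<omega>) \<partial>M)"
      using deriv[OF that]
      by (meson continuous_at_imp_continuous_on has_vector_derivative_continuous)
    show "norm (\<integral>\<omega>. v \<omega> * cis (\<xi> * Z \<omega>) \<partial>M) \<le> (\<integral>\<omega>. norm (v \<omega>) \<partial>M)" for \<xi>
      by (rule order_trans[OF integral_norm_bound]) (simp add: norm_mult)
  qed
  have "smooth_upto bdd_fun n (\<lambda>\<xi>. \<integral>\<omega>. v \<omega> * cis (\<xi> * Z \<omega>) \<partial>M)"
    if "v \<in> borel_measurable M" "\<And>n. integrable M (\<lambda>\<omega>. norm (v \<omega>) * \<bar>Z \<omega>\<bar> ^ n)" for v n
    using that
  proof (induction n arbitrary: v)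
    case 0
    then show ?case using B by simp
  next
    case (Suc n)
    note [measurable] = Suc.prems(1)
    have "(\<lambda>\<omega>. norm (\<i> * of_real (Z \<omega>) * v \<omega>) * \<bar>Z \<omega>\<bar> ^ k) = (\<lambda>\<omega>. norm (v \<omega>) * \<bar>Z \<omega>\<bar> ^ Suc k)" for k
      by (simp add: norm_mult mult_ac)
    then have int': "integrable M (\<lambda>\<omega>. norm (\<i> * of_real (Z \<omega>) * v \<omega>) * \<bar>Z \<omega>\<bar> ^ k)" for k
      using Suc.prems(2)[of "Suc k"] by (simp only:)
    show ?case
    proof (rule smooth_upto_SucI)
      show "smooth_upto bdd_fun n (\<lambda>\<xi>. \<integral>\<omega>. (\<i> * of_real (Z \<omega>) * v \<omega>) * cis (\<xi> * Z \<omega>) \<partial>M)"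
        by (rule Suc.IH[OF _ int']) measurable
    qed (rule B[OF Suc.prems] deriv[OF Suc.prems])+
  qed
  then show "smooth_in bdd_fun (\<lambda>\<xi>. \<integral>\<omega>. w \<omega> * cis (\<xi> * Z \<omega>) \<partial>M)"
    using int unfolding smooth_in_def by auto
  show "((\<lambda>\<xi>. \<integral>\<omega>. w \<omega> * cis (\<xi> * Z \<omega>) \<partial>M) has_vector_derivative
      (\<integral>\<omega>. (\<i> * of_real (Z \<omega>) * w \<omega>) * cis (\<xi> * Z \<omega>) \<partial>M)) (at \<xi>)"
    using int by (intro deriv) auto
qed

definition divided_diff :: "(real \<Rightarrow> complex) \<Rightarrow> real \<Rightarrow> complex" where
  "divided_diff a \<xi> =
     (if \<xi> = 0 then vector_derivative a (at 0) else (a \<xi> - a 0) / of_real \<xi>)"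

lemma divided_diff_eq: "a \<xi> = a 0 + of_real \<xi> * divided_diff a \<xi>"
  by (simp add: divided_diff_def)

text \<open>Smoothness across the origin is read off from
  \<open>divided_diff a \<xi> = \<integral>\<^sub>0\<^sup>1 a'(t \<xi>) dt\<close>.\<close>

lemma smooth_divided_diff:
  assumes a: "smooth_in bdd_fun a"
  shows "smooth_in bdd_fun (divided_diff a)"
proof -
  obtain a' where a': "\<And>x. (a has_vector_derivative a' x) (at x)" "smooth_in bdd_fun a'"
    using smooth_in_deriv[OF a] by blast
  let ?M = "restrict_space lborel {0..1::real}"
  \<comment> \<open>The exponent \<open>j\<close> collects the factors \<open>t\<close> that
    differentiation in \<open>\<xi>\<close> releases; the divided difference of \<open>a\<close>
    will be \<open>D 0 a'\<close>.\<close>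
  define D where "D j g \<xi> = (\<integral>t. of_real (t ^ j) * g (t * \<xi>) \<partial>?M)" for j :: nat and g :: "real \<Rightarrow> complex" and \<xi>
  have fin: "finite_measure ?M"
    by (rule finite_measureI) (simp add: emeasure_restrict_space space_restrict_space)
  have bdd: "\<exists>C. \<forall>x. norm (g x) \<le> C" "continuous_on UNIV g" if "smooth_in bdd_fun g" for g
    using smooth_in_imp[OF that] unfolding bdd_fun_def by auto
  have bound: "norm (complex_of_real (t ^ j) * c) \<le> norm c" if "t \<in> space ?M" for t j c
    using that by (auto simp: norm_mult space_restrict_space norm_power intro!: mult_left_le_one_le power_le_one)
  have meas: "(\<lambda>t. complex_of_real (t ^ j) * g (t * \<xi>)) \<in> borel_measurable ?M"
    if "continuous_on UNIV g" for j g \<xi>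
  proof -
    have "(\<lambda>t. complex_of_real (t ^ j) * g (t * \<xi>)) \<in> borel_measurable borel"
      by (intro borel_measurable_continuous_onI continuous_intros continuous_on_compose2[OF that]) auto
    then show ?thesis by (intro measurable_restrict_space1) simp
  qed
  have int: "integrable ?M (\<lambda>t. complex_of_real (t ^ j) * g (t * \<xi>))" if g: "smooth_in bdd_fun g" for j g \<xi>
  proof -
    obtain C where C: "\<And>x. norm (g x) \<le> C" using bdd[OF g] by blast
    show ?thesis
      by (rule finite_measure.integrable_const_bound[OF fin, of _ C], rule AE_I2)
        (use bound C order_trans meas bdd(2)[OF g] in blast)+
  qed
  have deriv: "(D j g has_vector_derivative D (Suc j) g' \<xi>) (at \<xi>)"
    if g: "smooth_in bdd_fun g" and g': "\<And>x. (g has_vector_derivative g' x) (at x)" for j g g' \<xi>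
  proof -
    have sg': "smooth_in bdd_fun g'" by (rule smooth_in_deriv'[OF g g'])
    obtain C where C: "\<And>x. norm (g' x) \<le> C" using bdd[OF sg'] by blast
    show ?thesis unfolding D_def
    proof (rule has_vector_derivative_integral[where B = "\<lambda>_. C"])
      show "((\<lambda>\<xi>. complex_of_real (t ^ j) * g (t * \<xi>)) has_vector_derivative
          complex_of_real (t ^ Suc j) * g' (t * \<xi>)) (at \<xi>)" for t \<xi>
      proof -
        have "((\<lambda>x. t * x) has_vector_derivative t) (at \<xi>)"
          by (auto intro!: derivative_eq_intros)
        from vector_diff_chain_at[OF this g']
        have "((\<lambda>x. complex_of_real (t ^ j) * g (t * x)) has_vector_derivative
            complex_of_real (t ^ j) * (t *\<^sub>R g' (t * \<xi>))) (at \<xi>)"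
          by (intro has_vector_derivative_mult_right) (simp add: o_def)
        then show ?thesis by (simp add: scaleR_conv_of_real mult_ac)
      qed
      show "norm (complex_of_real (t ^ Suc j) * g' (t * \<xi>)) \<le> C" if "t \<in> space ?M" for t \<xi>
        using bound[OF that] C order_trans by blast
      show "integrable ?M (\<lambda>_. C)" using fin by (rule finite_measure.integrable_const)
      show "integrable ?M (\<lambda>t. complex_of_real (t ^ j) * g (t * \<xi>))" for \<xi>
        by (rule int[OF g])
      show "(\<lambda>t. complex_of_real (t ^ Suc j) * g' (t * \<xi>)) \<in> borel_measurable ?M" for \<xi>
        by (rule meas[OF bdd(2)[OF sg']])
    qed
  qed
  have D_bdd: "bdd_fun (D j g)" if g: "smooth_in bdd_fun g" for j g
  proof -
    obtain C where C: "\<And>x. norm (g x) \<le> C" using bdd[OF g] by blast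
    obtain g' where g': "\<And>x. (g has_vector_derivative g' x) (at x)" using smooth_in_deriv[OF g] by blast
    show ?thesis
    proof (rule bdd_funI)
      show "continuous_on UNIV (D j g)"
        using deriv[OF g g'] by (meson continuous_at_imp_continuous_on has_vector_derivative_continuous)
      show "norm (D j g \<xi>) \<le> (\<integral>t. C \<partial>?M)" for \<xi>
        unfolding D_def
        by (rule order_trans[OF integral_norm_bound])
          (intro integral_mono integrable_norm int g finite_measure.integrable_const[OF fin] order_trans[OF bound C])
    qed
  qed
  have D_smooth: "smooth_upto bdd_fun n (D j g)" if "smooth_in bdd_fun g" for n j g
    using that
  proof (induction n arbitrary: j g)
    case (Suc n)
    obtain g' where g': "\<And>x. (g has_vector_derivative g' x) (at x)" "smooth_in bdd_fun g'"
      using smooth_in_deriv[OF Suc.prems] by blast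
    show ?case
      by (rule smooth_upto_SucI[OF D_bdd[OF Suc.prems] deriv[OF Suc.prems g'(1)] Suc.IH[OF g'(2)]])
  qed (simp add: D_bdd)
  have D_eq: "D 0 g \<xi> = (\<integral>t. indicator {0..1} t *\<^sub>R g (t * \<xi>) \<partial>lborel)" for g \<xi>
    unfolding D_def by (subst integral_restrict_space) auto
  have "of_real \<xi> * D 0 a' \<xi> = a \<xi> - a 0" for \<xi>
  proof -
    have "of_real \<xi> * D 0 a' \<xi> = (\<integral>t. indicator {0..1} t *\<^sub>R (of_real \<xi> * a' (t * \<xi>)) \<partial>lborel)"
      unfolding D_eq by (simp flip: integral_mult_right_zero add: scaleR_conv_of_real mult_ac)
    also have "\<dots> = a (1 * \<xi>) - a (0 * \<xi>)"
    proof (rule integral_FTC_Icc)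
      fix t :: real
      have *: "((\<lambda>t. t * \<xi>) has_vector_derivative \<xi>) (at t)"
        by (auto intro!: derivative_eq_intros)
      have "((\<lambda>t. a (t * \<xi>)) has_vector_derivative of_real \<xi> * a' (t * \<xi>)) (at t)"
        using vector_diff_chain_at[OF * a'(1)] by (simp add: o_def scaleR_conv_of_real)
      then show "((\<lambda>t. a (t * \<xi>)) has_vector_derivative of_real \<xi> * a' (t * \<xi>)) (at t within {0..1})"
        by (rule has_vector_derivative_at_within)
    qed (auto intro!: continuous_intros continuous_on_compose2[OF bdd(2)[OF a'(2)]])
    finally show ?thesis by simp
  qed
  moreover have "D 0 a' 0 = vector_derivative a (at 0)"
    unfolding D_eq using vector_derivative_at[OF a'(1)[of 0]] by simp
  ultimately have "divided_diff a = D 0 a'"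
    unfolding divided_diff_def by (intro ext) (auto simp: divide_eq_eq mult.commute simp flip: diff_eq_eq)
  with D_smooth[OF a'(2)] show ?thesis by (simp add: smooth_in_def)
qed

section \<open>The Fourier transform on Schwartz functions\<close>

lemma integrable_inverse_1_plus_square: "integrable lborel (\<lambda>x::real. 1 / (1 + x\<^sup>2))"
proof -
  have "set_integrable lborel (einterval (- \<infinity>) \<infinity>) (\<lambda>x. 1 / (1 + x\<^sup>2))"
  proof (rule interval_integral_FTC_nonneg[where F = arctan and A = "- (pi / 2)" and B = "pi / 2"])
    show "DERIV arctan x :> 1 / (1 + x\<^sup>2)" for x :: real
      using DERIV_arctan[of x] by (simp add: inverse_eq_divide)
    show "isCont (\<lambda>x. 1 / (1 + x\<^sup>2)) x" for x :: real
      by (intro continuous_intros) (simp add: add_nonneg_eq_0_iff)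
    show "((arctan \<circ> real_of_ereal) \<longlongrightarrow> - (pi / 2)) (at_right (- \<infinity>))"
      unfolding ereal_tendsto_simps using tendsto_arctan_at_bot by simp
    show "((arctan \<circ> real_of_ereal) \<longlongrightarrow> pi / 2) (at_left \<infinity>)"
      unfolding ereal_tendsto_simps by (rule tendsto_arctan_at_top)
  qed auto
  then show ?thesis by (simp add: set_integrable_def)
qed

lemma rapid_fun_bound:
  assumes "rapid_fun f"
  obtains C where "C \<ge> 0" "\<And>x. norm (f x) \<le> C * (1 / (1 + x\<^sup>2))"
proof -
  obtain C where C: "C \<ge> 0" "\<And>x. (1 + \<bar>x\<bar>) ^ 2 * norm (f x) \<le> C"
    using rapid_funE[OF assms, of 2] by blast
  have "norm (f x) \<le> C * (1 / (1 + x\<^sup>2))" for x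
  proof -
    have "(1 + x\<^sup>2) * norm (f x) \<le> (1 + \<bar>x\<bar>) ^ 2 * norm (f x)"
      by (intro mult_right_mono) (auto simp: power2_eq_square algebra_simps)
    then have "(1 + x\<^sup>2) * norm (f x) \<le> C" using C(2)[of x] by linarith
    moreover have "1 + x\<^sup>2 > 0" by (simp add: add_pos_nonneg)
    ultimately show ?thesis by (simp add: field_simps)
  qed
  with C(1) show thesis using that by blast
qed

lemma rapid_fun_integrable: "rapid_fun f \<Longrightarrow> integrable lborel f"
proof -
  assume f: "rapid_fun f"
  obtain C where C: "C \<ge> 0" "\<And>x. norm (f x) \<le> C * (1 / (1 + x\<^sup>2))"
    using rapid_fun_bound[OF f] by blast
  show ?thesis
    by (rule Bochner_Integration.integrable_bound[OF integrable_mult_right[OF integrable_inverse_1_plus_square, of C]])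
      (use C borel_measurable_continuous_onI[OF rapid_fun_cont[OF f]] in \<open>auto simp: add_nonneg_nonneg\<close>)
qed

lemma schwartz_integrable: "schwartz f \<Longrightarrow> integrable lborel f"
  by (intro rapid_fun_integrable schwartz_rapid)

lemma rapid_fun_tendsto_0:
  assumes "rapid_fun f"
  shows "(f \<longlongrightarrow> 0) at_top" "(f \<longlongrightarrow> 0) at_bot"
proof -
  obtain C where C: "\<And>x. norm (f x) \<le> C * (1 / (1 + x\<^sup>2))"
    using rapid_fun_bound[OF assms] by blast
  have *: "((\<lambda>x::real. C * (1 / (1 + x\<^sup>2))) \<longlongrightarrow> 0) at_top" "((\<lambda>x::real. C * (1 / (1 + x\<^sup>2))) \<longlongrightarrow> 0) at_bot"
    by real_asymp+
  show "(f \<longlongrightarrow> 0) at_top" "(f \<longlongrightarrow> 0) at_bot"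
    by (rule Lim_null_comparison[OF always_eventually[OF allI[OF C]] *(1)]
        Lim_null_comparison[OF always_eventually[OF allI[OF C]] *(2)])+
qed

lemma integral_schwartz_deriv:
  assumes "\<And>x. (f has_vector_derivative f' x) (at x)" "schwartz f" "schwartz f'"
  shows "(\<integral>x. f' x \<partial>lborel) = 0"
proof -
  have "(\<lambda>n. f (real n) - f (- real n)) \<longlonglongrightarrow> (\<integral>x. f' x \<partial>lborel)"
    by (intro LIMSEQ_integral_derivative assms schwartz_continuous schwartz_integrable)
  moreover have "(\<lambda>n. f (real n) - f (- real n)) \<longlonglongrightarrow> 0 - 0"
    by (intro tendsto_diff filterlim_compose[OF rapid_fun_tendsto_0(1)[OF schwartz_rapid[OF assms(2)]]]
        filterlim_compose[OF rapid_fun_tendsto_0(2)[OF schwartz_rapid[OF assms(2)]]]) real_asymp+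
  ultimately show ?thesis using LIMSEQ_unique by force
qed

lemma fourier_eq: "fourier f \<xi> = (\<integral>x. f x * cis (\<xi> * - x) \<partial>lborel)"
  unfolding fourier_def cis_conv_exp by (simp add: mult_ac)

lemma schwartz_power_mult: "schwartz f \<Longrightarrow> schwartz (\<lambda>x. of_real x ^ n * f x)"
proof (induction n)
  case (Suc n)
  then have "schwartz (\<lambda>x. (of_real x ^ n * f x) * of_real x)"
    using schwartz_mult[OF _ smooth_polybdd_ident] by blast
  then show ?case by (simp add: mult_ac)
qed simp

lemma integrable_schwartz_moment:
  assumes "schwartz f"
  shows "integrable lborel (\<lambda>x. norm (f x) * \<bar>- x\<bar> ^ n)"
  using integrable_norm[OF schwartz_integrable[OF schwartz_power_mult[OF assms, of n]]]
  by (simp add: norm_mult norm_power mult.commute)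

lemma has_vector_derivative_fourier:
  assumes f: "schwartz f"
  shows "(fourier f has_vector_derivative fourier (\<lambda>x. - \<i> * (of_real x * f x)) \<xi>) (at \<xi>)"
proof -
  have [measurable]: "f \<in> borel_measurable borel" by (rule schwartz_borel[OF f])
  have "((\<lambda>\<xi>. \<integral>x. f x * cis (\<xi> * - x) \<partial>lborel) has_vector_derivative
      (\<integral>x. (\<i> * of_real (- x) * f x) * cis (\<xi> * - x) \<partial>lborel)) (at \<xi>)"
    by (rule smooth_weighted_char(1)) (use integrable_schwartz_moment[OF f] in auto)
  then show ?thesis by (simp add: fourier_eq[abs_def] mult.assoc)
qed

text \<open>A plane wave is the characteristic function of a point mass: weight 1 and constant
  \<open>Z = a\<close> over a Dirac measure, so smoothness of weighted characteristic functions
  applies.\<close>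

lemma smooth_cis: "smooth_in bdd_fun (\<lambda>x. cis (x * a))"
proof -
  have "smooth_in bdd_fun (\<lambda>x. \<integral>\<omega>. 1 * cis (x * a) \<partial>return borel (0::real))"
    by (rule smooth_weighted_char(2))
      (auto intro!: finite_measure.integrable_const prob_space.finite_measure prob_space_return)
  moreover have "(\<integral>\<omega>. 1 * cis (x * a) \<partial>return borel (0::real)) = cis (x * a)" for x
    by (subst integral_return) auto
  ultimately show ?thesis by simp
qed

text \<open>Integration by parts: the derivative of the Schwartz function
  \<open>f x * cis (\<xi> * - x)\<close> has integral 0.\<close>

lemma fourier_deriv:
  assumes f: "schwartz f" and f': "\<And>x. (f has_vector_derivative f' x) (at x)"
  shows "fourier f' \<xi> = \<i> * of_real \<xi> * fourier f \<xi>"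
proof -
  have sf': "schwartz f'" using smooth_in_deriv' f f' unfolding schwartz_iff by blast
  have c: "smooth_in polybdd_fun (\<lambda>x. cis (\<xi> * - x))"
    using smooth_bdd_imp_polybdd[OF smooth_cis[of "- \<xi>"]] by (simp add: mult_ac)
  have dc: "((\<lambda>x. cis (\<xi> * - x)) has_vector_derivative - \<i> * of_real \<xi> * cis (\<xi> * - x)) (at x)" for x
    unfolding has_vector_derivative_def by (auto intro!: derivative_eq_intros ext simp: scaleR_conv_of_real)
  have s: "schwartz (\<lambda>x. f x * cis (\<xi> * - x))" "schwartz (\<lambda>x. f' x * cis (\<xi> * - x))"
    "schwartz (\<lambda>x. - \<i> * of_real \<xi> * (f x * cis (\<xi> * - x)))"
    by (intro schwartz_cmult schwartz_mult f sf' c)+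
  have "((\<lambda>x. f x * cis (\<xi> * - x)) has_vector_derivative
     - \<i> * of_real \<xi> * (f x * cis (\<xi> * - x)) + f' x * cis (\<xi> * - x)) (at x)" for x
    using has_vector_derivative_mult[OF f' dc, of x] by (simp add: mult_ac)
  from integral_schwartz_deriv[OF this s(1) schwartz_add[OF s(3,2)]]
  have "(\<integral>x. - \<i> * of_real \<xi> * (f x * cis (\<xi> * - x)) + f' x * cis (\<xi> * - x) \<partial>lborel) = 0" .
  then have "(\<integral>x. - \<i> * of_real \<xi> * (f x * cis (\<xi> * - x)) \<partial>lborel) + fourier f' \<xi> = 0"
    unfolding fourier_eq by (subst (asm) Bochner_Integration.integral_add) (use s schwartz_integrable in auto)
  then show ?thesis unfolding fourier_eq by (simp add: add_eq_0_iff)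
qed

lemma norm_fourier_le: "norm (fourier f \<xi>) \<le> (\<integral>x. norm (f x) \<partial>lborel)"
  unfolding fourier_eq by (rule order_trans[OF integral_norm_bound]) (simp add: norm_mult)

text \<open>Each power of \<open>\<xi>\<close> is traded for a derivative of \<open>f\<close>, and
  every transform is bounded by an L1 norm.\<close>

lemma rapid_fun_fourier:
  assumes "schwartz f"
  shows "rapid_fun (fourier f)"
proof (subst rapid_fun_iff)
  show "continuous_on UNIV (fourier f)"
    using has_vector_derivative_fourier[OF assms]
    by (meson continuous_at_imp_continuous_on has_vector_derivative_continuous)
  have "\<exists>C. \<forall>\<xi>. norm (\<xi> ^ k *\<^sub>R fourier f \<xi>) \<le> C" for k
    using assms
  proof (induction k arbitrary: f)
    case 0
    show ?case using norm_fourier_le[of f] by auto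
  next
    case (Suc k)
    obtain f' where f': "\<And>x. (f has_vector_derivative f' x) (at x)" "schwartz f'"
      using schwartz_deriv[OF Suc.prems] by blast
    have "norm (\<xi> ^ Suc k *\<^sub>R fourier f \<xi>) = norm (\<xi> ^ k *\<^sub>R fourier f' \<xi>)" for \<xi>
      by (simp add: fourier_deriv[OF Suc.prems f'(1)] norm_mult abs_mult mult_ac)
    then show ?case using Suc.IH[OF f'(2)] by simp
  qed
  then show "\<forall>k. bounded (range (\<lambda>x. x ^ k *\<^sub>R fourier f x))"
    unfolding bounded_iff by blast
qed

lemma schwartz_fourier:
  assumes "schwartz f"
  shows "schwartz (fourier f)"
proof -
  have "smooth_upto rapid_fun n (fourier f)" for n
    using assms
  proof (induction n arbitrary: f)
    case (Suc n)
    have "schwartz (\<lambda>x. - \<i> * (of_real x * f x))"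
      using schwartz_cmult[OF schwartz_power_mult[OF Suc.prems, of 1], of "- \<i>"] by simp
    from Suc.IH[OF this] show ?case
      by (rule smooth_upto_SucI[rotated 2])
        (rule rapid_fun_fourier[OF Suc.prems] has_vector_derivative_fourier[OF Suc.prems])+
  qed (simp add: rapid_fun_fourier)
  then show ?thesis by (simp add: schwartz_iff smooth_in_def)
qed

definition inv_fourier :: "(real \<Rightarrow> complex) \<Rightarrow> real \<Rightarrow> complex" where
  "inv_fourier g x = 1 / (2 * of_real pi) * (\<integral>\<xi>. cis (\<xi> * x) * g \<xi> \<partial>lborel)"

lemma inv_fourier_eq: "inv_fourier g x = 1 / (2 * of_real pi) * fourier g (- x)"
  unfolding inv_fourier_def fourier_eq by (simp add: mult_ac)

lemma schwartz_inv_fourier: "schwartz g \<Longrightarrow> schwartz (inv_fourier g)"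
  using schwartz_cmult[OF schwartz_reflect[OF schwartz_fourier, of g 0], of "1 / (2 * of_real pi)"]
  by (simp add: inv_fourier_eq[abs_def])

section \<open>Fourier inversion\<close>

lemma Fubini_iterated:
  fixes F :: "'a \<Rightarrow> 'b \<Rightarrow> complex"
  assumes M: "sigma_finite_measure M" and N: "sigma_finite_measure N"
    and meas: "case_prod F \<in> borel_measurable (M \<Otimes>\<^sub>M N)"
    and int: "\<And>x. x \<in> space M \<Longrightarrow> integrable N (F x)" "integrable M (\<lambda>x. \<integral>y. norm (F x y) \<partial>N)"
  shows "(\<integral>x. \<integral>y. F x y \<partial>N \<partial>M) = (\<integral>y. \<integral>x. F x y \<partial>M \<partial>N)"
    and "integrable M (\<lambda>x. \<integral>y. F x y \<partial>N)" and "integrable N (\<lambda>y. \<integral>x. F x y \<partial>M)"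
proof -
  interpret pair_sigma_finite M N
    using M N by (rule pair_sigma_finite.intro)
  have I: "integrable (M \<Otimes>\<^sub>M N) (case_prod F)"
    by (rule Fubini_integrable[OF meas]) (use int in auto)
  show "(\<integral>x. \<integral>y. F x y \<partial>N \<partial>M) = (\<integral>y. \<integral>x. F x y \<partial>M \<partial>N)"
    using Fubini_integral[OF I] by simp
  show "integrable M (\<lambda>x. \<integral>y. F x y \<partial>N)" "integrable N (\<lambda>y. \<integral>x. F x y \<partial>M)"
    using integrable_fst[OF I] integrable_snd[OF I] by auto
qed

text \<open>Oscillating factors have modulus 1, so a bound by a product \<open>p x * q y\<close> is
  usually at hand; it gives absolute integrability on the product space.\<close>

lemma Fubini_dominated:
  fixes F :: "'a \<Rightarrow> 'b \<Rightarrow> complex"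
  assumes M: "sigma_finite_measure M" and N: "sigma_finite_measure N"
    and meas: "case_prod F \<in> borel_measurable (M \<Otimes>\<^sub>M N)"
    and p: "integrable M p" and q: "integrable N q"
    and le: "\<And>x y. x \<in> space M \<Longrightarrow> y \<in> space N \<Longrightarrow> norm (F x y) \<le> p x * q y"
  shows "(\<integral>x. \<integral>y. F x y \<partial>N \<partial>M) = (\<integral>y. \<integral>x. F x y \<partial>M \<partial>N)"
    and "integrable M (\<lambda>x. \<integral>y. F x y \<partial>N)" and "integrable N (\<lambda>y. \<integral>x. F x y \<partial>M)"
proof -
  interpret N: sigma_finite_measure N by (rule N)
  note [measurable] = meas
  have [measurable]: "F x \<in> borel_measurable N" if "x \<in> space M" for x
    using measurable_compose[OF measurable_Pair1'[OF that] meas] by simp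
  have 1: "integrable N (F x)" if "x \<in> space M" for x
    by (rule Bochner_Integration.integrable_bound[OF integrable_mult_right[OF q, of "p x"]])
      (use that le order_trans[OF le abs_ge_self] in \<open>auto intro!: AE_I2\<close>)
  have 2: "integrable M (\<lambda>x. \<integral>y. norm (F x y) \<partial>N)"
  proof (rule Bochner_Integration.integrable_bound[OF integrable_mult_left[OF p, of "\<integral>y. q y \<partial>N"]])
    show "AE x in M. norm (\<integral>y. norm (F x y) \<partial>N) \<le> norm (p x * (\<integral>y. q y \<partial>N))"
    proof (rule AE_I2)
      fix x assume x: "x \<in> space M"
      have "(\<integral>y. norm (F x y) \<partial>N) \<le> (\<integral>y. p x * q y \<partial>N)"
        by (intro integral_mono integrable_norm 1[OF x] integrable_mult_right q le x)
      moreover have "(\<integral>y. norm (F x y) \<partial>N) \<ge> 0" by simp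
      ultimately show "norm (\<integral>y. norm (F x y) \<partial>N) \<le> norm (p x * (\<integral>y. q y \<partial>N))"
        by simp
    qed
  qed measurable
  show "(\<integral>x. \<integral>y. F x y \<partial>N \<partial>M) = (\<integral>y. \<integral>x. F x y \<partial>M \<partial>N)"
    "integrable M (\<lambda>x. \<integral>y. F x y \<partial>N)" "integrable N (\<lambda>y. \<integral>x. F x y \<partial>M)"
    using Fubini_iterated[OF M N meas 1 2] by auto
qed

section \<open>The Gaussian and its Fourier transform\<close>

definition gauss :: "real \<Rightarrow> complex" where
  "gauss x = of_real (exp (- (x\<^sup>2 / 2)))"

lemma norm_gauss: "norm (gauss x) = exp (- (x\<^sup>2 / 2))"
  by (simp add: gauss_def)

lemma gauss_std_normal: "gauss x = of_real (sqrt (2 * pi) * std_normal_density x)"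
  by (simp add: gauss_def std_normal_density_def)

text \<open>One term of the exponential series is at most its sum; this converts exponential moments
  and exponential decay into polynomial ones.\<close>

lemma power_le_fact_exp:
  assumes "(x::real) \<ge> 0"
  shows "x ^ n \<le> fact n * exp x"
proof -
  have "(\<Sum>i\<in>{n}. x ^ i /\<^sub>R fact i) \<le> (\<Sum>i. x ^ i /\<^sub>R fact i)"
    using assms by (intro sum_le_suminf summable_exp_generic) (auto simp: divide_inverse)
  then show ?thesis by (simp add: exp_def field_simps)
qed

lemma has_vector_derivative_gauss: "(gauss has_vector_derivative gauss x * (- 1 * of_real x)) (at x)"
proof -
  have "((\<lambda>x. exp (- (x\<^sup>2 / 2))) has_real_derivative - x * exp (- (x\<^sup>2 / 2))) (at x)"
    by (auto intro!: derivative_eq_intros)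
  then have "((\<lambda>x. complex_of_real (exp (- (x\<^sup>2 / 2)))) has_vector_derivative of_real (- x * exp (- (x\<^sup>2 / 2)))) (at x)"
    by (intro has_vector_derivative_of_real) (simp add: has_real_derivative_iff_has_vector_derivative)
  then show ?thesis by (simp add: gauss_def[abs_def] mult_ac)
qed

lemma rapid_fun_gauss: "rapid_fun gauss"
proof (rule rapid_funI)
  show "continuous_on UNIV gauss"
    using has_vector_derivative_gauss by (meson continuous_at_imp_continuous_on has_vector_derivative_continuous)
  fix k
  have "(1 + \<bar>x\<bar>) ^ k * norm (gauss x) \<le> fact k * exp 2" for x
  proof -
    \<comment> \<open>Expanding the square bounds \<open>|x|\<close> by
      \<open>x\<^sup>2 / 2 + 1\<close>, so that the exponent \<open>1 + |x| - x\<^sup>2 / 2\<close>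
      stays at most 2.\<close>
    have "0 \<le> (\<bar>x\<bar> - 1)\<^sup>2" by simp
    then have *: "\<bar>x\<bar> \<le> x\<^sup>2 / 2 + 1" by (simp add: power2_eq_square algebra_simps)
    have "(1 + \<bar>x\<bar>) ^ k * norm (gauss x) \<le> (fact k * exp (1 + \<bar>x\<bar>)) * exp (- (x\<^sup>2 / 2))"
      unfolding norm_gauss by (intro mult_right_mono power_le_fact_exp) auto
    also have "\<dots> = fact k * exp (1 + \<bar>x\<bar> - x\<^sup>2 / 2)"
      by (simp add: mult.assoc mult_exp_exp)
    also have "\<dots> \<le> fact k * exp 2"
      using * by (intro mult_left_mono iffD2[OF exp_le_cancel_iff]) auto
    finally show ?thesis .
  qed
  then show "\<exists>C. \<forall>x. (1 + \<bar>x\<bar>) ^ k * norm (gauss x) \<le> C" by blast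
qed

lemma schwartz_gauss: "schwartz gauss"
proof -
  have "smooth_upto rapid_fun n gauss" for n
  proof (induction n)
    case (Suc n)
    have p: "smooth_upto polybdd_fun n (\<lambda>x. - 1 * of_real x)"
      using smooth_polybdd_mult[OF smooth_polybdd_const smooth_polybdd_ident] unfolding smooth_in_def by blast
    have *: "smooth_upto rapid_fun n (\<lambda>x. gauss x * (- 1 * of_real x))"
      by (rule smooth_upto_mult[OF _ _ Suc.IH p]) (rule rapid_fun_add rapid_fun_mult; assumption)+
    show ?case
      by (rule smooth_upto_SucI[OF _ _ *]) (rule rapid_fun_gauss has_vector_derivative_gauss)+
  qed (simp add: rapid_fun_gauss)
  then show ?thesis by (simp add: schwartz_iff smooth_in_def)
qed

text \<open>Read off from the characteristic function of the standard normal law, whose density is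
  \<open>gauss\<close> divided by \<open>sqrt (2 * pi)\<close>.\<close>

lemma integral_gauss_cis: "(\<integral>x. gauss x * cis (\<xi> * x) \<partial>lborel) = of_real (sqrt (2 * pi)) * gauss \<xi>"
proof -
  have "of_real (exp (- \<xi>\<^sup>2 / 2)) = (CLINT x|std_normal_distribution. iexp (\<xi> * x))"
    using char_std_normal_distribution by (metis (no_types, lifting) char_def)
  also have "\<dots> = (\<integral>x. std_normal_density x *\<^sub>R iexp (\<xi> * x) \<partial>lborel)"
    by (rule integral_density) auto
  finally have "gauss \<xi> = (\<integral>x. std_normal_density x *\<^sub>R iexp (\<xi> * x) \<partial>lborel)"
    by (simp add: gauss_def)
  then have "of_real (sqrt (2 * pi)) * gauss \<xi> =
      (\<integral>x. of_real (sqrt (2 * pi)) * (std_normal_density x *\<^sub>R iexp (\<xi> * x)) \<partial>lborel)"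
    by (simp only: integral_mult_right_zero)
  also have "\<dots> = (\<integral>x. gauss x * cis (\<xi> * x) \<partial>lborel)"
    by (simp add: gauss_std_normal cis_conv_exp scaleR_conv_of_real mult_ac)
  finally show ?thesis by simp
qed

lemma fourier_gauss: "fourier gauss \<xi> = of_real (sqrt (2 * pi)) * gauss \<xi>"
  using integral_gauss_cis[of "- \<xi>"] by (simp add: fourier_eq gauss_def)

lemma integral_gauss: "(\<integral>x. gauss x \<partial>lborel) = of_real (sqrt (2 * pi))"
  using integral_gauss_cis[of 0] by (simp add: gauss_def)

lemma integrable_norm_gauss:
  assumes "c \<noteq> 0"
  shows "integrable lborel (\<lambda>x. norm (gauss (c * x)))"
  using lborel_integrable_real_affine[OF integrable_norm[OF schwartz_integrable[OF schwartz_gauss]] assms, of 0]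
  by simp

text \<open>An integrable \<open>g\<close> may be unbounded far out, so the line is split at
  \<open>|x| = 1\<close>. Inside, \<open>g\<close> is bounded by compactness and rescaling allows
  dominated convergence. Outside, with \<open>m = Suc n\<close>, the Gaussian is at most
  \<open>exp (- m\<^sup>2 / 2)\<close>, which beats the factor \<open>m\<close> against the L1 norm
  of \<open>g\<close>.\<close>

lemma gauss_approximate_identity:
  fixes g :: "real \<Rightarrow> complex"
  assumes g: "integrable lborel g" "continuous_on UNIV g"
  shows "(\<lambda>n. \<integral>x. of_real (real (Suc n)) * (g x * gauss (real (Suc n) * x)) \<partial>lborel)
    \<longlonglongrightarrow> of_real (sqrt (2 * pi)) * g 0"
proof -
  have [measurable]: "gauss \<in> borel_measurable borel" "g \<in> borel_measurable borel"
    using schwartz_borel[OF schwartz_gauss] borel_measurable_continuous_onI[OF g(2)] by auto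
  let ?g1 = "\<lambda>x. indicator {-1..1} x *\<^sub>R g x" and ?g2 = "\<lambda>x. indicator (- {-1..1}) x *\<^sub>R g x"
  let ?m = "\<lambda>n. real (Suc n)"
  let ?G1 = "\<lambda>n x. of_real (?m n) * (?g1 x * gauss (?m n * x))"
    and ?G2 = "\<lambda>n x. of_real (?m n) * (?g2 x * gauss (?m n * x))"
  obtain C where C: "\<And>x. x \<in> {-1..1} \<Longrightarrow> norm (g x) \<le> C"
  proof -
    have "bounded (g ` {-1..1})"
      by (intro compact_imp_bounded compact_continuous_image continuous_on_subset[OF g(2)]) auto
    then show thesis using that unfolding bounded_iff by blast
  qed
  have C0: "C \<ge> 0" using C[of 0] order_trans[OF norm_ge_zero] by auto
  have int1: "integrable lborel (\<lambda>x. ?G1 n x)" for n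
    by (rule Bochner_Integration.integrable_bound[OF integrable_mult_right[OF integrable_norm_gauss[of "?m n"], of "?m n * C"]])
      (use C C0 in \<open>auto simp: norm_mult indicator_def mult_ac simp del: of_nat_Suc
        intro!: AE_I2 mult_left_mono mult_right_mono\<close>)
  have le2: "norm (?G2 n x) \<le> (?m n * exp (- ((?m n)\<^sup>2 / 2))) * norm (g x)" for n x
  proof (cases "x \<in> {-1..1}")
    case False
    then have "1 \<le> \<bar>x\<bar>" by auto
    then have "1 \<le> x\<^sup>2" using power_mono[of 1 "\<bar>x\<bar>" 2] by simp
    then have "(?m n)\<^sup>2 * 1 \<le> (?m n)\<^sup>2 * x\<^sup>2"
      by (rule mult_left_mono) simp
    then have "exp (- ((?m n * x)\<^sup>2 / 2)) \<le> exp (- ((?m n)\<^sup>2 / 2))"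
      by (simp add: power_mult_distrib)
    then have "?m n * norm (g x) * exp (- ((?m n * x)\<^sup>2 / 2)) \<le> ?m n * norm (g x) * exp (- ((?m n)\<^sup>2 / 2))"
      by (intro mult_left_mono) auto
    then show ?thesis using False by (simp add: norm_mult norm_gauss mult_ac del: of_nat_Suc)
  qed auto
  have int2: "integrable lborel (\<lambda>x. ?G2 n x)" for n
  proof (rule Bochner_Integration.integrable_bound)
    show "integrable lborel (\<lambda>x. (?m n * exp (- ((?m n)\<^sup>2 / 2))) * norm (g x))"
      by (intro integrable_mult_right integrable_norm g)
    show "AE x in lborel. norm (?G2 n x)
        \<le> norm ((?m n * exp (- ((?m n)\<^sup>2 / 2))) * norm (g x))"
      by (intro AE_I2 order_trans[OF le2]) (simp only: real_norm_def abs_ge_self)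
  qed measurable
  have "(\<lambda>n. \<integral>x. ?G1 n x \<partial>lborel) \<longlonglongrightarrow> of_real (sqrt (2 * pi)) * g 0"
  proof -
    have eq: "(\<integral>x. ?G1 n x \<partial>lborel) = (\<integral>s. ?g1 (s / ?m n) * gauss s \<partial>lborel)" for n
      using lborel_integral_real_affine[of "?m n" "\<lambda>s. ?g1 (s / ?m n) * gauss s" 0]
      by (simp add: scaleR_conv_of_real del: of_nat_Suc)
    have lim: "(\<lambda>n. \<integral>s. ?g1 (s / ?m n) * gauss s \<partial>lborel) \<longlonglongrightarrow> (\<integral>s. g 0 * gauss s \<partial>lborel)"
    proof (rule integral_dominated_convergence[where w = "\<lambda>s. C * norm (gauss s)"])
      show "integrable lborel (\<lambda>s. C * norm (gauss s))"
        using schwartz_integrable[OF schwartz_gauss] by (intro integrable_mult_right integrable_norm)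
      show "AE s in lborel. (\<lambda>n. ?g1 (s / ?m n) * gauss s) \<longlonglongrightarrow> g 0 * gauss s"
      proof (rule AE_I2)
        fix s :: real
        have s: "(\<lambda>n. s / ?m n) \<longlonglongrightarrow> 0" by real_asymp
        have "eventually (\<lambda>n. s / ?m n \<in> {-1<..<1}) sequentially"
          by (rule topological_tendstoD[OF s]) auto
        then have "eventually (\<lambda>n. g (s / ?m n) * gauss s = ?g1 (s / ?m n) * gauss s) sequentially"
          by eventually_elim auto
        moreover have "(\<lambda>n. g (s / ?m n) * gauss s) \<longlonglongrightarrow> g 0 * gauss s"
          using continuous_on_tendsto_compose[OF g(2) s] by (intro tendsto_mult tendsto_const) auto
        ultimately show "(\<lambda>n. ?g1 (s / ?m n) * gauss s) \<longlonglongrightarrow> g 0 * gauss s"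
          by (rule Lim_transform_eventually[rotated])
      qed
      show "AE s in lborel. norm (?g1 (s / ?m n) * gauss s) \<le> C * norm (gauss s)" for n
        using C C0 by (intro AE_I2) (auto simp: norm_mult indicator_def intro!: mult_right_mono)
    qed measurable
    have "(\<integral>s. g 0 * gauss s \<partial>lborel) = of_real (sqrt (2 * pi)) * g 0"
      unfolding integral_mult_right_zero integral_gauss by (rule mult.commute)
    from lim[unfolded this] show ?thesis
      by (rule Lim_transform_eventually) (intro always_eventually allI, rule eq[symmetric])
  qed
  moreover have "(\<lambda>n. \<integral>x. ?G2 n x \<partial>lborel) \<longlonglongrightarrow> 0"
  proof (rule Lim_null_comparison)
    have "norm (\<integral>x. ?G2 n x \<partial>lborel)
        \<le> (?m n * exp (- ((?m n)\<^sup>2 / 2))) * (\<integral>x. norm (g x) \<partial>lborel)" for n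
    proof -
      have "norm (\<integral>x. ?G2 n x \<partial>lborel)
          \<le> (\<integral>x. (?m n * exp (- ((?m n)\<^sup>2 / 2))) * norm (g x) \<partial>lborel)"
        by (rule Bochner_Integration.integral_norm_bound_integral[OF int2])
          (intro integrable_mult_right integrable_norm g le2)+
      then show ?thesis by simp
    qed
    then show "\<forall>\<^sub>F n in sequentially. norm (\<integral>x. ?G2 n x \<partial>lborel)
        \<le> (?m n * exp (- ((?m n)\<^sup>2 / 2))) * (\<integral>x. norm (g x) \<partial>lborel)"
      by (intro always_eventually allI)
    have "(\<lambda>n. ?m n * exp (- ((?m n)\<^sup>2 / 2))) \<longlonglongrightarrow> 0" by real_asymp
    then show "(\<lambda>n. (?m n * exp (- ((?m n)\<^sup>2 / 2))) * (\<integral>x. norm (g x) \<partial>lborel)) \<longlonglongrightarrow> 0"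
      by (rule tendsto_mult_left_zero)
  qed
  ultimately have lim: "(\<lambda>n. (\<integral>x. ?G1 n x \<partial>lborel) +
      (\<integral>x. ?G2 n x \<partial>lborel)) \<longlonglongrightarrow> of_real (sqrt (2 * pi)) * g 0 + 0"
    by (rule tendsto_add)
  have eq: "(\<integral>x. ?G1 n x \<partial>lborel) +
      (\<integral>x. ?G2 n x \<partial>lborel) =
      (\<integral>x. of_real (?m n) * (g x * gauss (?m n * x)) \<partial>lborel)" for n
  proof -
    have "?G1 n x + ?G2 n x =
        of_real (?m n) * (g x * gauss (?m n * x))" for x
      by (cases "x \<in> {-1..1}") (simp_all del: of_nat_Suc)
    then show ?thesis
      by (simp only: Bochner_Integration.integral_add[OF int1 int2, symmetric])
  qed
  from lim[unfolded add_0_right] show ?thesis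
    by (rule Lim_transform_eventually) (intro always_eventually allI, rule eq)
qed

text \<open>Inversion at the origin. A Gaussian cutoff in frequency makes the double integral
  absolutely convergent, and exchanging the order turns the cutoff into an approximate identity. The
  constant \<open>2 * pi\<close> is a product of two factors \<open>sqrt (2 * pi)\<close>: one from
  the transform of \<open>gauss\<close>, one from its mass. Other points are reached by
  translation.\<close>

lemma integral_fourier:
  fixes g :: "real \<Rightarrow> complex"
  assumes g: "integrable lborel g" "continuous_on UNIV g" and F: "integrable lborel (fourier g)"
  shows "(\<integral>\<xi>. fourier g \<xi> \<partial>lborel) = 2 * of_real pi * g 0"
proof -
  let ?m = "\<lambda>n. real (Suc n)"
  have [measurable]: "gauss \<in> borel_measurable borel" "g \<in> borel_measurable borel"
    using schwartz_borel[OF schwartz_gauss] borel_measurable_continuous_onI[OF g(2)] by auto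
  have eq: "(\<integral>\<xi>. fourier g \<xi> * gauss (\<xi> / ?m n) \<partial>lborel) =
      of_real (sqrt (2 * pi)) * (\<integral>x. of_real (?m n) * (g x * gauss (?m n * x)) \<partial>lborel)" for n
  proof -
    have "(\<integral>\<xi>. fourier g \<xi> * gauss (\<xi> / ?m n) \<partial>lborel) =
        (\<integral>\<xi>. (\<integral>x. g x * cis (\<xi> * - x) * gauss (\<xi> / ?m n) \<partial>lborel) \<partial>lborel)"
      unfolding fourier_eq by simp
    also have "\<dots> = (\<integral>x. (\<integral>\<xi>. g x * cis (\<xi> * - x) * gauss (\<xi> / ?m n) \<partial>lborel) \<partial>lborel)"
    proof (rule Fubini_dominated(1)[OF _ _ _ integrable_norm_gauss[of "inverse (?m n)"] integrable_norm[OF g(1)]])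
      show "(\<lambda>(\<xi>, x). g x * cis (\<xi> * - x) * gauss (\<xi> / ?m n)) \<in> borel_measurable (lborel \<Otimes>\<^sub>M lborel)"
        by measurable
    qed (auto simp: norm_mult divide_inverse mult_ac lborel.sigma_finite_measure_axioms)
    also have "\<dots> = (\<integral>x. of_real (sqrt (2 * pi)) * (of_real (?m n) * (g x * gauss (?m n * x))) \<partial>lborel)"
    proof (rule Bochner_Integration.integral_cong[OF refl])
      fix x
      have "(\<integral>\<xi>. cis (\<xi> * - x) * gauss (\<xi> / ?m n) \<partial>lborel) =
          of_real (?m n) * (\<integral>s. gauss s * cis (- (?m n * x) * s) \<partial>lborel)"
        by (subst lborel_integral_real_affine[where c = "?m n" and t = 0])
          (auto simp: mult_ac scaleR_conv_of_real simp del: of_nat_Suc)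
      also have "\<dots> = of_real (?m n) * (of_real (sqrt (2 * pi)) * gauss (?m n * x))"
        by (subst integral_gauss_cis) (simp add: gauss_def)
      finally show "(\<integral>\<xi>. g x * cis (\<xi> * - x) * gauss (\<xi> / ?m n) \<partial>lborel) =
          of_real (sqrt (2 * pi)) * (of_real (?m n) * (g x * gauss (?m n * x)))"
        by (simp add: mult.assoc)
    qed
    finally show ?thesis by simp
  qed
  have "(\<lambda>n. \<integral>\<xi>. fourier g \<xi> * gauss (\<xi> / ?m n) \<partial>lborel) \<longlonglongrightarrow> (\<integral>\<xi>. fourier g \<xi> \<partial>lborel)"
  proof (rule integral_dominated_convergence[where w = "\<lambda>\<xi>. norm (fourier g \<xi>)"])
    have [measurable]: "fourier g \<in> borel_measurable borel" using borel_measurable_integrable[OF F] by simp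
    show "fourier g \<in> borel_measurable lborel" by simp
    show "(\<lambda>\<xi>. fourier g \<xi> * gauss (\<xi> / ?m n)) \<in> borel_measurable lborel" for n by measurable
    show "integrable lborel (\<lambda>\<xi>. norm (fourier g \<xi>))" by (rule integrable_norm[OF F])
    show "AE \<xi> in lborel. (\<lambda>n. fourier g \<xi> * gauss (\<xi> / ?m n)) \<longlonglongrightarrow> fourier g \<xi>"
    proof (rule AE_I2)
      fix \<xi> :: real
      have s: "(\<lambda>n. \<xi> / ?m n) \<longlonglongrightarrow> 0" by real_asymp
      have "(\<lambda>n. exp (- ((\<xi> / ?m n)\<^sup>2 / 2))) \<longlonglongrightarrow> exp (- (0\<^sup>2 / 2))"
        by (intro tendsto_intros s) auto
      then have "(\<lambda>n. exp (- ((\<xi> / ?m n)\<^sup>2 / 2))) \<longlonglongrightarrow> 1" by simp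
      then have "(\<lambda>n. fourier g \<xi> * gauss (\<xi> / ?m n)) \<longlonglongrightarrow> fourier g \<xi> * of_real 1"
        unfolding gauss_def by (intro tendsto_intros)
      then show "(\<lambda>n. fourier g \<xi> * gauss (\<xi> / ?m n)) \<longlonglongrightarrow> fourier g \<xi>" by simp
    qed
    show "AE \<xi> in lborel. norm (fourier g \<xi> * gauss (\<xi> / ?m n)) \<le> norm (fourier g \<xi>)" for n
      by (rule AE_I2) (auto simp: norm_mult norm_gauss intro!: mult_left_le)
  qed
  moreover have "(\<lambda>n. \<integral>\<xi>. fourier g \<xi> * gauss (\<xi> / ?m n) \<partial>lborel) \<longlonglongrightarrow>
      of_real (sqrt (2 * pi)) * (of_real (sqrt (2 * pi)) * g 0)"
    unfolding eq by (intro tendsto_mult tendsto_const gauss_approximate_identity g)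
  ultimately have "(\<integral>\<xi>. fourier g \<xi> \<partial>lborel) = of_real (sqrt (2 * pi)) * (of_real (sqrt (2 * pi)) * g 0)"
    by (rule LIMSEQ_unique)
  also have "\<dots> = of_real (sqrt (2 * pi) * sqrt (2 * pi)) * g 0"
    by (simp only: of_real_mult mult.assoc)
  also have "sqrt (2 * pi) * sqrt (2 * pi) = 2 * pi"
    by (subst real_sqrt_mult_self) (simp add: abs_of_pos)
  finally show ?thesis by (simp only: of_real_mult of_real_numeral)
qed

lemma fourier_shift: "fourier (\<lambda>y. f (x + y)) \<xi> = cis (\<xi> * x) * fourier f \<xi>"
proof -
  have "fourier f \<xi> = (\<integral>y. f (x + y) * cis (\<xi> * - (x + y)) \<partial>lborel)"
    unfolding fourier_eq by (subst lborel_integral_real_affine[where c = 1 and t = x]) auto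
  also have "\<dots> = (\<integral>y. cis (\<xi> * - x) * (f (x + y) * cis (\<xi> * - y)) \<partial>lborel)"
  proof (rule Bochner_Integration.integral_cong[OF refl])
    fix y
    have "cis (\<xi> * - (x + y)) = cis (\<xi> * - x) * cis (\<xi> * - y)"
      unfolding cis_mult by (simp add: algebra_simps)
    then show "f (x + y) * cis (\<xi> * - (x + y)) = cis (\<xi> * - x) * (f (x + y) * cis (\<xi> * - y))"
      by simp
  qed
  also have "\<dots> = cis (\<xi> * - x) * fourier (\<lambda>y. f (x + y)) \<xi>"
    unfolding fourier_eq by simp
  finally show ?thesis by (simp add: cis_mult flip: mult.assoc)
qed

lemma inv_fourier_fourier:
  assumes f: "schwartz f"
  shows "inv_fourier (fourier f) x = f x"
proof -
  have s: "schwartz (\<lambda>y. f (x + y))" by (rule schwartz_shift[OF f])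
  have "(\<integral>\<xi>. cis (\<xi> * x) * fourier f \<xi> \<partial>lborel) = 2 * of_real pi * f x"
    using integral_fourier[OF schwartz_integrable[OF s] schwartz_continuous[OF s]
        schwartz_integrable[OF schwartz_fourier[OF s]]]
    by (simp add: fourier_shift)
  then show ?thesis by (simp add: inv_fourier_def)
qed

text \<open>The zero transform is integrable, so inversion applies to every translate of
  \<open>g\<close>.\<close>

lemma fourier_eq_0_imp:
  assumes g: "integrable lborel g" "continuous_on UNIV g" and F: "\<And>\<xi>. fourier g \<xi> = 0"
  shows "g x = 0"
proof -
  have c: "continuous_on UNIV (\<lambda>y. g (x + y))"
    by (intro continuous_on_compose2[OF g(2)] continuous_intros) auto
  have i: "integrable lborel (\<lambda>y. g (x + y))"
    using lborel_integrable_real_affine[OF g(1), of 1 x] by simp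
  show ?thesis
    using integral_fourier[OF i c] by (simp add: fourier_shift[abs_def] F)
qed

section \<open>The random walk and its Green kernel\<close>

lemma prob_space_conv_power:
  assumes "prob_space \<mu>" "sets \<mu> = sets borel"
  shows "prob_space (conv_power \<mu> n)"
proof (induction n)
  case 0
  show ?case by (simp add: conv_power_def prob_space_return)
next
  case (Suc n)
  interpret M: prob_space \<mu> by fact
  interpret N: prob_space "conv_power \<mu> n" by fact
  have "prob_space (\<mu> \<Otimes>\<^sub>M conv_power \<mu> n)"
    by (intro prob_space_pair) (unfold_locales)
  then show ?case
    by (simp add: conv_power_def convolution_def, intro prob_space.prob_space_distr)
      (auto simp: conv_power_def[symmetric] assms(2) cong: measurable_cong_sets)
qed

lemma conv_power_Suc: "conv_power \<mu> (Suc n) = convolution \<mu> (conv_power \<mu> n)"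
  by (simp add: conv_power_def)

text \<open>Both orders of integration are recorded, since a step of the walk is split off on the
  outside or on the inside.\<close>

lemma integral_convolution:
  fixes f :: "real \<Rightarrow> complex"
  assumes M: "finite_measure M" "sets M = sets borel" and N: "finite_measure N" "sets N = sets borel"
    and f [measurable]: "f \<in> borel_measurable borel" and C: "\<And>x. norm (f x) \<le> C"
  shows "(\<integral>z. f z \<partial>convolution M N) = (\<integral>x. \<integral>y. f (x + y) \<partial>N \<partial>M)"
    and "(\<integral>z. f z \<partial>convolution M N) = (\<integral>y. \<integral>x. f (x + y) \<partial>M \<partial>N)"
proof -
  note [measurable_cong] = M(2) N(2)
  interpret M: finite_measure M by fact
  interpret N: finite_measure N by fact
  interpret pair_sigma_finite M N by unfold_locales
  have "finite_measure (M \<Otimes>\<^sub>M N)" by (intro finite_measure_pair_measure M N)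
  then have I: "integrable (M \<Otimes>\<^sub>M N) (\<lambda>(x, y). f (x + y))"
    by (rule finite_measure.integrable_const_bound[of _ _ C]) (use C in \<open>auto intro!: AE_I2\<close>)
  have "(\<integral>z. f z \<partial>convolution M N) = (\<integral>p. (\<lambda>(x, y). f (x + y)) p \<partial>(M \<Otimes>\<^sub>M N))"
    unfolding convolution_def by (subst integral_distr) (auto simp: case_prod_unfold)
  with integral_fst[OF I] integral_snd[OF I]
  show "(\<integral>z. f z \<partial>convolution M N) = (\<integral>x. \<integral>y. f (x + y) \<partial>N \<partial>M)"
    "(\<integral>z. f z \<partial>convolution M N) = (\<integral>y. \<integral>x. f (x + y) \<partial>M \<partial>N)" by simp_all
qed

text \<open>Induction on measurable functions. In the supremum case the sum over \<open>n\<close> is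
  read as an integral against counting measure, so that monotone convergence exchanges it with the
  supremum.\<close>

lemma nn_integral_green_kernel:
  assumes "f \<in> borel_measurable borel"
  shows "(\<integral>\<^sup>+x. f x \<partial>green_kernel \<rho>) = (\<Sum>n. \<integral>\<^sup>+x. f x \<partial>conv_power (reflected \<rho>) n)"
  using assms
proof (induction rule: borel_measurable_induct)
  case (cong f g)
  then show ?case by (simp cong: nn_integral_cong)
next
  case (set A)
  then show ?case by (simp add: emeasure_green_kernel)
next
  case (mult u c)
  then show ?case by (simp add: nn_integral_cmult cong: measurable_cong_sets)
next
  case (add u v)
  then show ?case by (simp add: nn_integral_add suminf_add cong: measurable_cong_sets)
next
  case (seq U)
  have [measurable]: "U i \<in> borel_measurable borel" for i by (rule seq)
  have meas: "U i \<in> borel_measurable M" if "sets M = sets borel" for i M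
    using that by (simp cong: measurable_cong_sets)
  have SUP_U: "(SUP i. U i) = (\<lambda>x. SUP i. U i x)" by (rule ext) (simp add: SUP_apply image_comp)
  have "(\<integral>\<^sup>+x. (SUP i. U i) x \<partial>green_kernel \<rho>) = (SUP i. \<integral>\<^sup>+x. U i x \<partial>green_kernel \<rho>)"
    unfolding SUP_U by (rule nn_integral_monotone_convergence_SUP[OF seq(3)]) (simp add: meas)
  also have "\<dots> = (SUP i. \<Sum>n. \<integral>\<^sup>+x. U i x \<partial>conv_power (reflected \<rho>) n)"
    by (simp add: seq.IH)
  also have "\<dots> = (SUP i. \<integral>\<^sup>+n. (\<integral>\<^sup>+x. U i x \<partial>conv_power (reflected \<rho>) n) \<partial>count_space UNIV)"
    by (simp add: nn_integral_count_space_nat)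
  also have "\<dots> = (\<integral>\<^sup>+n. (SUP i. \<integral>\<^sup>+x. U i x \<partial>conv_power (reflected \<rho>) n) \<partial>count_space UNIV)"
    by (rule nn_integral_monotone_convergence_SUP[symmetric])
      (use seq(3) in \<open>auto simp: incseq_def le_fun_def intro!: nn_integral_mono\<close>)
  also have "\<dots> = (\<integral>\<^sup>+n. (\<integral>\<^sup>+x. (SUP i. U i) x \<partial>conv_power (reflected \<rho>) n) \<partial>count_space UNIV)"
    unfolding SUP_U
    by (intro nn_integral_cong nn_integral_monotone_convergence_SUP[symmetric, OF seq(3)]) (simp add: meas)
  finally show ?case by (simp add: nn_integral_count_space_nat)
qed

text \<open>For nonnegative functions this is the identity of extended integrals, and each single
  law is dominated by the sum; the general case subtracts positive and negative parts.\<close>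

lemma green_kernel_sums_real:
  fixes f :: "real \<Rightarrow> real"
  assumes f: "integrable (green_kernel \<rho>) f"
  shows "(\<lambda>n. \<integral>x. f x \<partial>conv_power (reflected \<rho>) n) sums (\<integral>x. f x \<partial>green_kernel \<rho>)"
    and "integrable (conv_power (reflected \<rho>) n) f"
proof -
  let ?\<mu> = "conv_power (reflected \<rho>)"
  have [measurable]: "f \<in> borel_measurable borel"
    using borel_measurable_integrable[OF f] by (simp cong: measurable_cong_sets)
  have meas: "g \<in> borel_measurable (?\<mu> n)" "g \<in> borel_measurable (green_kernel \<rho>)"
    if "g \<in> borel_measurable borel" for g :: "real \<Rightarrow> real" and n
    using that by (simp_all cong: measurable_cong_sets)
  have *: "(\<lambda>n. \<integral>x. g x \<partial>?\<mu> n) sums (\<integral>x. g x \<partial>green_kernel \<rho>)" "integrable (?\<mu> n) g"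
    if g: "integrable (green_kernel \<rho>) g" "\<And>x. g x \<ge> 0" and [measurable]: "g \<in> borel_measurable borel"
    for g :: "real \<Rightarrow> real" and n
  proof -
    have eq: "(\<Sum>n. \<integral>\<^sup>+x. ennreal (g x) \<partial>?\<mu> n) = ennreal (\<integral>x. g x \<partial>green_kernel \<rho>)"
      using nn_integral_green_kernel[of "\<lambda>x. ennreal (g x)" \<rho>] nn_integral_eq_integral[OF g(1)] g(2) by simp
    have fin: "(\<integral>\<^sup>+x. ennreal (g x) \<partial>?\<mu> n) < \<infinity>" for n
    proof -
      have "(\<integral>\<^sup>+x. ennreal (g x) \<partial>?\<mu> n) = (\<Sum>i\<in>{n}. \<integral>\<^sup>+x. ennreal (g x) \<partial>?\<mu> i)" by simp
      also have "\<dots> \<le> (\<Sum>n. \<integral>\<^sup>+x. ennreal (g x) \<partial>?\<mu> n)" by (rule sum_le_suminf) auto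
      also have "\<dots> < \<infinity>" unfolding eq by simp
      finally show ?thesis .
    qed
    show int: "integrable (?\<mu> n) g" for n
      using fin[of n] g(2) by (intro integrableI_nonneg meas) auto
    have "(\<lambda>n. ennreal (\<integral>x. g x \<partial>?\<mu> n)) sums ennreal (\<integral>x. g x \<partial>green_kernel \<rho>)"
      unfolding eq[symmetric] using nn_integral_eq_integral[OF int] g(2)
      by (simp add: summable_sums)
    then show "(\<lambda>n. \<integral>x. g x \<partial>?\<mu> n) sums (\<integral>x. g x \<partial>green_kernel \<rho>)"
      using g(2) by (subst (asm) sums_ennreal) auto
  qed
  have pos: "integrable (green_kernel \<rho>) (\<lambda>x. max 0 (f x))" and neg: "integrable (green_kernel \<rho>) (\<lambda>x. max 0 (- f x))"
    using f by (auto intro: integrable_max)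
  have fx: "(\<lambda>x. max 0 (f x) - max 0 (- f x)) = f" by (rule ext) auto
  have m: "(\<lambda>x. max 0 (f x)) \<in> borel_measurable borel" "(\<lambda>x. max 0 (- f x)) \<in> borel_measurable borel"
    by measurable
  note p = *[OF pos max.cobounded1 m(1)] and n = *[OF neg max.cobounded1 m(2)]
  show "integrable (?\<mu> n) f" for n
    using Bochner_Integration.integrable_diff[OF p(2) n(2)] unfolding fx .
  have "(\<integral>x. max 0 (f x) \<partial>?\<mu> k) - (\<integral>x. max 0 (- f x) \<partial>?\<mu> k) = (\<integral>x. f x \<partial>?\<mu> k)" for k
    using Bochner_Integration.integral_diff[OF p(2) n(2), symmetric] unfolding fx .
  moreover have "(\<integral>x. max 0 (f x) \<partial>green_kernel \<rho>) - (\<integral>x. max 0 (- f x) \<partial>green_kernel \<rho>) = (\<integral>x. f x \<partial>green_kernel \<rho>)"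
    using Bochner_Integration.integral_diff[OF pos neg, symmetric] unfolding fx .
  ultimately show "(\<lambda>n. \<integral>x. f x \<partial>?\<mu> n) sums (\<integral>x. f x \<partial>green_kernel \<rho>)"
    using sums_diff[OF p(1) n(1)] by simp
qed

lemma green_kernel_sums:
  fixes f :: "real \<Rightarrow> complex"
  assumes f: "integrable (green_kernel \<rho>) f"
  shows "(\<lambda>n. \<integral>x. f x \<partial>conv_power (reflected \<rho>) n) sums (\<integral>x. f x \<partial>green_kernel \<rho>)"
proof -
  let ?\<mu> = "conv_power (reflected \<rho>)"
  have re: "integrable (green_kernel \<rho>) (\<lambda>x. Re (f x))" and im: "integrable (green_kernel \<rho>) (\<lambda>x. Im (f x))"
    using f by auto
  have int: "integrable (?\<mu> n) f" for n
  proof (rule Bochner_Integration.integrable_bound)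
    show "integrable (?\<mu> n) (\<lambda>x. \<bar>Re (f x)\<bar> + \<bar>Im (f x)\<bar>)"
      by (intro Bochner_Integration.integrable_add integrable_abs green_kernel_sums_real(2) re im)
    show "f \<in> borel_measurable (?\<mu> n)"
      using borel_measurable_integrable[OF f] by (simp cong: measurable_cong_sets)
    show "AE x in ?\<mu> n. norm (f x) \<le> norm (\<bar>Re (f x)\<bar> + \<bar>Im (f x)\<bar>)"
      using cmod_le by (intro AE_I2) simp
  qed
  show ?thesis
    using green_kernel_sums_real(1)[OF re] green_kernel_sums_real(1)[OF im] int f
    by (simp add: sums_complex_iff)
qed

section \<open>Transition operators of the drifted walk\<close>

locale drifted_walk = real_distribution \<rho> for \<rho> :: "real measure" +
  fixes lam :: real
  assumes exp_moment: "exponential_moment \<rho>"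
    and lam_eq: "lam = (\<integral>y. y \<partial>\<rho>)"
    and lam_pos: "lam > 0"
begin

abbreviation "step_power n \<equiv> conv_power (reflected \<rho>) n"

definition P :: "(real \<Rightarrow> complex) \<Rightarrow> real \<Rightarrow> complex" where
  "P f x = (\<integral>y. f (x + y) \<partial>\<rho>)"

text \<open>\<open>step_power n\<close> is the law of minus the sum of \<open>n\<close> steps, so
  the sign in \<open>x - y\<close> makes this the mean of \<open>f\<close> at the position of the
  walk started from \<open>x\<close>.\<close>

definition Pn :: "nat \<Rightarrow> (real \<Rightarrow> complex) \<Rightarrow> real \<Rightarrow> complex" where
  "Pn n f x = (\<integral>y. f (x - y) \<partial>step_power n)"

lemma sets_reflected [simp]: "sets (reflected \<rho>) = sets borel"
  by (simp add: reflected_def)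

lemma prob_space_reflected: "prob_space (reflected \<rho>)"
  unfolding reflected_def by (rule prob_space_distr) simp

lemma prob_space_step_power: "prob_space (step_power n)"
  by (rule prob_space_conv_power[OF prob_space_reflected]) simp

lemma integral_reflected:
  fixes f :: "real \<Rightarrow> complex"
  shows "f \<in> borel_measurable borel \<Longrightarrow> (\<integral>y. f y \<partial>reflected \<rho>) = (\<integral>y. f (- y) \<partial>\<rho>)"
  unfolding reflected_def by (rule integral_distr) auto

lemma P_measurable:
  assumes [measurable]: "f \<in> borel_measurable borel"
  shows "P f \<in> borel_measurable borel"
  unfolding P_def[abs_def] by measurable

lemma P_norm_le:
  assumes [measurable]: "f \<in> borel_measurable borel" and C: "\<And>x. norm (f x) \<le> C"
  shows "norm (P f x) \<le> C"
proof -
  have "norm (P f x) \<le> (\<integral>y. norm (f (x + y)) \<partial>\<rho>)"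
    unfolding P_def by (rule integral_norm_bound)
  also have "\<dots> \<le> (\<integral>y. C \<partial>\<rho>)"
    by (intro integral_mono integrable_norm integrable_const_bound[of _ C])
      (use C order_trans[OF norm_ge_zero C] in auto)
  finally show ?thesis using prob_space by simp
qed

lemma Pn_0: "f \<in> borel_measurable borel \<Longrightarrow> Pn 0 f x = f x"
  unfolding Pn_def by (simp add: conv_power_def, subst integral_return) auto

text \<open>A step can be split off at either end: the form \<open>P (Pn n f)\<close> serves to
  apply \<open>P\<close> to partial sums of the Green series, the form \<open>Pn n (P f)\<close> to
  telescope.\<close>

lemma Pn_Suc:
  assumes f [measurable]: "f \<in> borel_measurable borel" and C: "\<And>x. norm (f x) \<le> C"
  shows "Pn (Suc n) f x = P (Pn n f) x" and "Pn (Suc n) f x = Pn n (P f) x"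
proof -
  interpret N: prob_space "step_power n" by (rule prob_space_step_power)
  interpret R: prob_space "reflected \<rho>" by (rule prob_space_reflected)
  note [measurable_cong] = sets_reflected sets_conv_power
  note * = integral_convolution[OF R.finite_measure_axioms sets_reflected N.finite_measure_axioms
    sets_conv_power, of "\<lambda>z. f (x - z)" C]
  have "Pn (Suc n) f x = (\<integral>y. \<integral>z. f (x - (y + z)) \<partial>step_power n \<partial>reflected \<rho>)"
    unfolding Pn_def conv_power_Suc using * C by simp
  also have "\<dots> = (\<integral>y. \<integral>z. f (x - (- y + z)) \<partial>step_power n \<partial>\<rho>)"
    by (rule integral_reflected) measurable
  finally show "Pn (Suc n) f x = P (Pn n f) x"
    unfolding P_def Pn_def by (simp add: algebra_simps)
  have "Pn (Suc n) f x = (\<integral>z. \<integral>y. f (x - (y + z)) \<partial>reflected \<rho> \<partial>step_power n)"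
    unfolding Pn_def conv_power_Suc using * C by simp
  also have "\<dots> = (\<integral>z. \<integral>y. f (x - (- y + z)) \<partial>\<rho> \<partial>step_power n)"
    by (intro Bochner_Integration.integral_cong refl integral_reflected) measurable
  finally show "Pn (Suc n) f x = Pn n (P f) x"
    unfolding P_def Pn_def by (simp add: algebra_simps)
qed

lemma Pn_measurable:
  assumes [measurable]: "f \<in> borel_measurable borel"
  shows "Pn n f \<in> borel_measurable borel"
proof -
  interpret N: prob_space "step_power n" by (rule prob_space_step_power)
  note [measurable_cong] = sets_conv_power
  show ?thesis unfolding Pn_def[abs_def] by measurable
qed

lemma integrable_step_power:
  fixes f :: "real \<Rightarrow> 'b::{banach,second_countable_topology}"
  assumes f [measurable]: "f \<in> borel_measurable borel" and C: "\<And>x. norm (f x) \<le> C"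
  shows "integrable (step_power n) f"
proof -
  interpret N: prob_space "step_power n" by (rule prob_space_step_power)
  note [measurable_cong] = sets_conv_power
  show ?thesis by (rule N.integrable_const_bound[of _ C]) (use C in auto)
qed

lemma Pn_norm_le:
  assumes f [measurable]: "f \<in> borel_measurable borel" and C: "\<And>x. norm (f x) \<le> C"
  shows "norm (Pn n f x) \<le> C"
proof -
  interpret N: prob_space "step_power n" by (rule prob_space_step_power)
  have "norm (Pn n f x) \<le> (\<integral>y. norm (f (x - y)) \<partial>step_power n)"
    unfolding Pn_def by (rule integral_norm_bound)
  also have "\<dots> \<le> (\<integral>y. C \<partial>step_power n)"
    by (intro integral_mono integrable_norm integrable_step_power[of _ C])
      (use C order_trans[OF norm_ge_zero C] in auto)
  finally show ?thesis by (simp add: N.prob_space)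
qed

text \<open>Telescoping: a bounded solution of \<open>H - P H = f\<close> controls the partial sums of the Green
  potential of \<open>f\<close>.\<close>

lemma sum_Pn_telescope:
  assumes H [measurable]: "H \<in> borel_measurable borel" and C: "\<And>x. norm (H x) \<le> C"
    and f: "\<And>x. f x = H x - P H x"
  shows "(\<Sum>n<N. Pn n f x) = H x - Pn N H x"
proof (induction N)
  case 0
  show ?case by (simp add: Pn_0)
next
  case (Suc N)
  note [measurable] = P_measurable[OF H]
  have "Pn N f x = Pn N H x - Pn N (P H) x"
    unfolding Pn_def f
    by (intro Bochner_Integration.integral_diff integrable_step_power[of _ C]) (use C P_norm_le[OF H C] in auto)
  then show ?case using Suc Pn_Suc(2)[OF H C, of N x] by simp
qed

lemma exp_moment_obtain:
  obtains \<eta> where "\<eta> > 0" "integrable \<rho> (\<lambda>y. exp (\<eta> * \<bar>y\<bar>))"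
proof -
  obtain \<eta> where \<eta>: "\<eta> > 0" "(\<integral>\<^sup>+y. ennreal (exp (\<eta> * \<bar>y\<bar>)) \<partial>\<rho>) < \<infinity>"
    using exp_moment unfolding exponential_moment_def by blast
  have "integrable \<rho> (\<lambda>y. exp (\<eta> * \<bar>y\<bar>))"
    by (rule integrableI_nonneg) (use \<eta> in auto)
  with \<eta>(1) show thesis by (rule that)
qed

text \<open>Since \<open>(\<eta> * |y|) ^ n \<le> fact n * exp (\<eta> * |y|)\<close>, the
  exponential moment dominates every power.\<close>

lemma integrable_moment: "integrable \<rho> (\<lambda>y. \<bar>y\<bar> ^ n)"
proof -
  obtain \<eta> where \<eta>: "\<eta> > 0" "integrable \<rho> (\<lambda>y. exp (\<eta> * \<bar>y\<bar>))"
    by (rule exp_moment_obtain)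
  show ?thesis
  proof (rule Bochner_Integration.integrable_bound[OF integrable_mult_right[OF \<eta>(2), of "fact n / \<eta> ^ n"]])
    show "AE y in \<rho>. norm (\<bar>y\<bar> ^ n) \<le> norm (fact n / \<eta> ^ n * exp (\<eta> * \<bar>y\<bar>))"
    proof (rule AE_I2)
      fix y :: real
      have "(\<eta> * \<bar>y\<bar>) ^ n \<le> fact n * exp (\<eta> * \<bar>y\<bar>)"
        using \<eta>(1) by (intro power_le_fact_exp) simp
      then show "norm (\<bar>y\<bar> ^ n) \<le> norm (fact n / \<eta> ^ n * exp (\<eta> * \<bar>y\<bar>))"
        using \<eta>(1) by (simp add: power_mult_distrib field_simps abs_mult)
    qed
  qed simp
qed

lemma integrable_ident: "integrable \<rho> (\<lambda>y. y)"
  using integrable_moment[of 1] by (simp add: integrable_abs_iff)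

text \<open>Positive drift gives \<open>exp (- \<theta> * y)\<close> the mean
  \<open>1 - \<theta> * lam\<close> up to a term of order \<open>\<theta>\<^sup>2\<close>, which is
  below 1 for small positive \<open>\<theta>\<close>; independence raises this mean \<open>q\<close>
  to the power \<open>n\<close>. The positive sign in the conclusion comes from the reflection of
  the steps in \<open>step_power\<close>.\<close>

lemma Chernoff:
  obtains \<theta> q where "\<theta> > 0" "0 \<le> q" "q < 1"
    "\<And>n. (\<integral>\<^sup>+y. ennreal (exp (\<theta> * y)) \<partial>step_power n) = ennreal (q ^ n)"
proof -
  obtain \<eta> where \<eta>: "\<eta> > 0" "integrable \<rho> (\<lambda>y. exp (\<eta> * \<bar>y\<bar>))"
    by (rule exp_moment_obtain)
  let ?E = "(\<integral>y. exp (\<eta> * \<bar>y\<bar>) \<partial>\<rho>)"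
  \<comment> \<open>Majorant of the second-order remainder. By
    \<open>(\<eta> * |y| / 2)\<^sup>2 \<le> 2 * exp (\<eta> * |y| / 2)\<close>, the factor
    \<open>y\<^sup>2\<close> costs \<open>8 / \<eta>\<^sup>2\<close> and one half of the exponential
    weight; the other half absorbs \<open>exp (\<theta> * |y|)\<close>.\<close>
  define M where "M = 8 / \<eta>\<^sup>2 * ?E"
  have E0: "?E \<ge> 0" by simp
  have M0: "M \<ge> 0" unfolding M_def using E0 by simp
  \<comment> \<open>The first bound keeps the remainder inside the exponential moment, the second
    makes \<open>\<theta>\<^sup>2 * M\<close> smaller than \<open>\<theta> * lam\<close>; the added
    1 keeps the quotient defined and the inequality strict.\<close>
  define \<theta> where "\<theta> = min (\<eta> / 2) (lam / (M + 1))"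
  have \<theta>: "\<theta> > 0" "\<theta> \<le> \<eta> / 2" "\<theta> * M < lam"
  proof -
    show "\<theta> > 0" using \<eta>(1) lam_pos M0 by (simp add: \<theta>_def)
    show "\<theta> \<le> \<eta> / 2" unfolding \<theta>_def by (rule min.cobounded1)
    have "\<theta> \<le> lam / (M + 1)" unfolding \<theta>_def by (rule min.cobounded2)
    then have "\<theta> * (M + 1) \<le> lam" using M0 by (simp add: pos_le_divide_eq)
    with \<open>\<theta> > 0\<close> show "\<theta> * M < lam" by (simp add: algebra_simps)
  qed
  have int: "integrable \<rho> (\<lambda>y. exp (- \<theta> * y))"
  proof (rule Bochner_Integration.integrable_bound[OF \<eta>(2)])
    have "- \<theta> * y \<le> \<eta> * \<bar>y\<bar>" for y
    proof -
      have "- \<theta> * y \<le> \<theta> * \<bar>y\<bar>" using \<theta>(1) by (simp add: abs_if mult_less_0_iff)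
      also have "\<dots> \<le> \<eta> * \<bar>y\<bar>" using \<theta>(2) \<eta>(1) by (intro mult_right_mono) auto
      finally show ?thesis .
    qed
    then show "AE y in \<rho>. norm (exp (- \<theta> * y)) \<le> norm (exp (\<eta> * \<bar>y\<bar>))" by auto
  qed simp
  define q where "q = (\<integral>y. exp (- \<theta> * y) \<partial>\<rho>)"
  have le: "exp (- \<theta> * y) \<le> 1 - \<theta> * y + \<theta>\<^sup>2 * (8 / \<eta>\<^sup>2 * exp (\<eta> * \<bar>y\<bar>))" for y
  proof -
    have "norm (exp (complex_of_real (- \<theta> * y)) - (\<Sum>k\<le>1. complex_of_real (- \<theta> * y) ^ k / fact k))
        \<le> exp \<bar>\<theta> * y\<bar> * \<bar>\<theta> * y\<bar> ^ 2"
      using Taylor_exp[of "complex_of_real (- \<theta> * y)" 1] by (simp add: norm_mult numeral_2_eq_2)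
    also have "exp (complex_of_real (- \<theta> * y)) - (\<Sum>k\<le>1. complex_of_real (- \<theta> * y) ^ k / fact k) =
        complex_of_real (exp (- \<theta> * y) - (1 - \<theta> * y))"
      by (simp flip: exp_of_real)
    finally have "\<bar>exp (- \<theta> * y) - (1 - \<theta> * y)\<bar> \<le> exp \<bar>\<theta> * y\<bar> * \<bar>\<theta> * y\<bar> ^ 2"
      by (simp only: norm_of_real)
    then have "exp (- \<theta> * y) \<le> 1 - \<theta> * y + \<theta>\<^sup>2 * (exp (\<theta> * \<bar>y\<bar>) * y\<^sup>2)"
      using \<theta>(1) by (simp add: abs_mult power_mult_distrib mult_ac abs_le_iff)
    also have "exp (\<theta> * \<bar>y\<bar>) * y\<^sup>2 \<le> exp (\<eta> / 2 * \<bar>y\<bar>) * (8 / \<eta>\<^sup>2 * exp (\<eta> / 2 * \<bar>y\<bar>))"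
    proof (rule mult_mono)
      show "exp (\<theta> * \<bar>y\<bar>) \<le> exp (\<eta> / 2 * \<bar>y\<bar>)"
        using mult_right_mono[OF \<theta>(2), of "\<bar>y\<bar>"] by simp
      have "(\<eta> / 2 * \<bar>y\<bar>) ^ 2 \<le> fact 2 * exp (\<eta> / 2 * \<bar>y\<bar>)"
        using \<eta>(1) by (intro power_le_fact_exp) simp
      then show "y\<^sup>2 \<le> 8 / \<eta>\<^sup>2 * exp (\<eta> / 2 * \<bar>y\<bar>)"
        using \<eta>(1) by (simp add: power_mult_distrib power_divide field_simps fact_2)
    qed auto
    also have "exp (\<eta> / 2 * \<bar>y\<bar>) * (8 / \<eta>\<^sup>2 * exp (\<eta> / 2 * \<bar>y\<bar>)) = 8 / \<eta>\<^sup>2 * exp (\<eta> * \<bar>y\<bar>)"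
      by (simp add: mult_exp_exp mult.left_commute[of "exp _"])
    finally show ?thesis by (simp add: mult_left_mono)
  qed
  have "q \<le> (\<integral>y. 1 - \<theta> * y + \<theta>\<^sup>2 * (8 / \<eta>\<^sup>2 * exp (\<eta> * \<bar>y\<bar>)) \<partial>\<rho>)"
    unfolding q_def
    by (intro integral_mono int le Bochner_Integration.integrable_add Bochner_Integration.integrable_diff
        integrable_mult_right integrable_ident \<eta>(2) integrable_const)
  also have "\<dots> = 1 - \<theta> * lam + \<theta>\<^sup>2 * M"
    using integrable_ident \<eta>(2) prob_space by (simp add: lam_eq M_def)
  also have "\<dots> < 1"
    using mult_strict_left_mono[OF \<theta>(3,1)] by (simp add: power2_eq_square mult_ac)
  finally have q1: "q < 1" .
  have q0: "q \<ge> 0" unfolding q_def by simp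
  have qe: "(\<integral>\<^sup>+y. ennreal (exp (- \<theta> * y)) \<partial>\<rho>) = ennreal q"
    unfolding q_def by (rule nn_integral_eq_integral[OF int]) simp
  have "(\<integral>\<^sup>+y. ennreal (exp (\<theta> * y)) \<partial>step_power n) = ennreal (q ^ n)" for n
  proof (induction n)
    case 0
    show ?case by (simp add: conv_power_def nn_integral_return)
  next
    case (Suc n)
    interpret N: prob_space "step_power n" by (rule prob_space_step_power)
    interpret R: prob_space "reflected \<rho>" by (rule prob_space_reflected)
    note [measurable_cong] = sets_reflected sets_conv_power
    have "(\<integral>\<^sup>+y. ennreal (exp (\<theta> * y)) \<partial>step_power (Suc n)) =
        (\<integral>\<^sup>+y. \<integral>\<^sup>+z. ennreal (exp (\<theta> * (y + z))) \<partial>step_power n \<partial>reflected \<rho>)"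
      unfolding conv_power_Suc
      by (rule nn_integral_convolution) (auto simp: R.finite_measure_axioms N.finite_measure_axioms)
    also have "\<dots> = (\<integral>\<^sup>+y. ennreal (exp (\<theta> * y)) * ennreal (q ^ n) \<partial>reflected \<rho>)"
    proof (intro nn_integral_cong)
      fix y
      have "(\<integral>\<^sup>+z. ennreal (exp (\<theta> * (y + z))) \<partial>step_power n) =
          (\<integral>\<^sup>+z. ennreal (exp (\<theta> * y)) * ennreal (exp (\<theta> * z)) \<partial>step_power n)"
        by (simp add: distrib_left exp_add ennreal_mult')
      then show "(\<integral>\<^sup>+z. ennreal (exp (\<theta> * (y + z))) \<partial>step_power n) = ennreal (exp (\<theta> * y)) * ennreal (q ^ n)"
        by (simp add: nn_integral_cmult Suc)
    qed
    also have "\<dots> = (\<integral>\<^sup>+y. ennreal (exp (\<theta> * y)) \<partial>reflected \<rho>) * ennreal (q ^ n)"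
      by (rule nn_integral_multc) measurable
    also have "(\<integral>\<^sup>+y. ennreal (exp (\<theta> * y)) \<partial>reflected \<rho>) = ennreal q"
      unfolding reflected_def by (subst nn_integral_distr) (use qe in auto)
    finally show ?case using q0 by (simp add: ennreal_mult')
  qed
  with \<theta>(1) q0 q1 show thesis by (rule that)
qed

text \<open>Where \<open>x - y\<close> exceeds a level \<open>K\<close>, the function
  \<open>H\<close> is small. On the rest, the bound \<open>C\<close> may be multiplied by
  \<open>exp (\<theta> * (K - x + y)) \<ge> 1\<close>, whose mean under \<open>step_power n\<close>
  is a constant times \<open>q ^ n\<close>.\<close>

lemma Pn_tendsto_0:
  assumes H [measurable]: "H \<in> borel_measurable borel" and C: "\<And>x. norm (H x) \<le> C"
    and lim: "(H \<longlongrightarrow> 0) at_top"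
  shows "(\<lambda>n. Pn n H x) \<longlonglongrightarrow> 0"
proof (rule LIMSEQ_I)
  fix e :: real assume e: "e > 0"
  obtain \<theta> q where q: "\<theta> > 0" "0 \<le> q" "q < 1"
    "\<And>n. (\<integral>\<^sup>+y. ennreal (exp (\<theta> * y)) \<partial>step_power n) = ennreal (q ^ n)"
    using Chernoff by metis
  have C0: "C \<ge> 0" using C[of 0] order_trans[OF norm_ge_zero] by blast
  obtain K where K: "\<And>t. t \<ge> K \<Longrightarrow> norm (H t) < e / 2"
    using tendstoD[OF lim, of "e / 2"] e by (auto simp: eventually_at_top_linorder)
  have bound: "norm (Pn n H x) \<le> e / 2 + C * exp (\<theta> * (K - x)) * q ^ n" for n
  proof -
    interpret N: prob_space "step_power n" by (rule prob_space_step_power)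
    note [measurable_cong] = sets_conv_power
    have iexp: "integrable (step_power n) (\<lambda>y. exp (\<theta> * y))"
      by (rule integrableI_nonneg) (use q(4) in auto)
    have "ennreal (\<integral>y. exp (\<theta> * y) \<partial>step_power n) = ennreal (q ^ n)"
      using nn_integral_eq_integral[OF iexp] q(4) by simp
    then have eq: "(\<integral>y. exp (\<theta> * y) \<partial>step_power n) = q ^ n"
      using q(2) by simp
    have "norm (Pn n H x) \<le> (\<integral>y. e / 2 + C * exp (\<theta> * (K - x)) * exp (\<theta> * y) \<partial>step_power n)"
      unfolding Pn_def
    proof (rule Bochner_Integration.integral_norm_bound_integral)
      show "integrable (step_power n) (\<lambda>y. H (x - y))"
        by (rule integrable_step_power[of _ C]) (use C in auto)
      show "integrable (step_power n) (\<lambda>y. e / 2 + C * exp (\<theta> * (K - x)) * exp (\<theta> * y))"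
        using iexp by (intro Bochner_Integration.integrable_add integrable_mult_right) auto
      show "norm (H (x - y)) \<le> e / 2 + C * exp (\<theta> * (K - x)) * exp (\<theta> * y)" for y
      proof (cases "x - y \<ge> K")
        case True
        then have "norm (H (x - y)) \<le> e / 2" using K[of "x - y"] by simp
        also have "\<dots> \<le> e / 2 + C * exp (\<theta> * (K - x)) * exp (\<theta> * y)" using C0 by simp
        finally show ?thesis .
      next
        case False
        then have "0 \<le> \<theta> * (K - x + y)" using q(1) by simp
        then have "C * 1 \<le> C * exp (\<theta> * (K - x + y))" using C0 by (intro mult_left_mono) auto
        also have "\<dots> = C * exp (\<theta> * (K - x)) * exp (\<theta> * y)" by (simp add: distrib_left exp_add)
        finally show ?thesis using C[of "x - y"] e by linarith
      qed
    qed
    also have "\<dots> = e / 2 + C * exp (\<theta> * (K - x)) * q ^ n"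
      using iexp eq by (simp add: N.prob_space)
    finally show ?thesis .
  qed
  have "(\<lambda>n. C * exp (\<theta> * (K - x)) * q ^ n) \<longlonglongrightarrow> C * exp (\<theta> * (K - x)) * 0"
    using q by (intro tendsto_mult tendsto_const LIMSEQ_realpow_zero) auto
  then have "eventually (\<lambda>n. C * exp (\<theta> * (K - x)) * q ^ n < e / 2) sequentially"
    using e by (intro order_tendstoD) auto
  then obtain N where N: "\<And>n. n \<ge> N \<Longrightarrow> C * exp (\<theta> * (K - x)) * q ^ n < e / 2"
    by (auto simp: eventually_sequentially)
  show "\<exists>N. \<forall>n\<ge>N. norm (Pn n H x - 0) < e"
  proof (intro exI[of _ N] allI impI)
    fix n assume "n \<ge> N"
    from N[OF this] bound[of n] show "norm (Pn n H x - 0) < e" by simp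
  qed
qed

section \<open>The multiplier\<close>

definition a :: "real \<Rightarrow> complex" where
  "a \<xi> = (\<integral>y. cis (\<xi> * y) \<partial>\<rho>)"

lemma laplace_eq_a: "laplace \<rho> (- \<i> * of_real \<xi>) = a \<xi>"
  unfolding laplace_def a_def cis_conv_exp by (simp add: mult_ac)

lemma a_0: "a 0 = 1"
  unfolding a_def using prob_space by simp

lemma integrable_cis: "integrable \<rho> (\<lambda>y. cis (\<xi> * y))"
  by (rule integrable_const_bound[of _ 1]) auto

lemma smooth_a: "smooth_in bdd_fun a" and
  deriv_a_0: "(a has_vector_derivative \<i> * of_real lam) (at 0)"
proof -
  have m: "(\<lambda>y. y) \<in> borel_measurable \<rho>" by simp
  have i: "integrable \<rho> (\<lambda>y. norm (1 :: complex) * \<bar>y\<bar> ^ n)" for n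
    using integrable_moment[of n] by simp
  note * = smooth_weighted_char[where M = \<rho> and w = "\<lambda>_. 1" and Z = "\<lambda>y. y", OF m _ i]
  have "a = (\<lambda>\<xi>. \<integral>y. 1 * cis (\<xi> * y) \<partial>\<rho>)"
    by (rule ext) (simp add: a_def)
  moreover have "(\<integral>y. (\<i> * of_real y * 1) * cis (0 * y) \<partial>\<rho>) = \<i> * of_real lam"
    using integrable_ident by (simp add: lam_eq)
  ultimately show "smooth_in bdd_fun a" "(a has_vector_derivative \<i> * of_real lam) (at 0)"
    using *(2) *(1)[of 0] by simp_all
qed

text \<open>\<open>a \<xi> - 1 = \<xi> b \<xi>\<close> and \<open>b \<xi> - b 0 = \<xi> c \<xi>\<close>, so that away from the origin
  \<open>c / (i \<lambda> b)\<close> is \<open>1 / (1 - a) + 1 / (i \<lambda> \<xi>)\<close>.\<close>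

definition b where "b = divided_diff a"
definition c where "c = divided_diff b"
definition h :: "real \<Rightarrow> complex" where
  "h \<xi> = c \<xi> * (1 / (\<i> * of_real lam) * inverse (b \<xi>))"

lemma smooth_b: "smooth_in bdd_fun b" and smooth_c: "smooth_in bdd_fun c"
  unfolding b_def c_def by (intro smooth_divided_diff smooth_a)+

lemma a_eq: "a \<xi> = 1 + of_real \<xi> * b \<xi>"
  using divided_diff_eq[of a \<xi>] by (simp only: b_def a_0)

lemma b_eq: "b \<xi> = \<i> * of_real lam + of_real \<xi> * c \<xi>"
proof -
  have "b 0 = \<i> * of_real lam"
    using vector_derivative_at[OF deriv_a_0] by (simp add: b_def divided_diff_def)
  then show ?thesis using divided_diff_eq[of b \<xi>] by (simp only: c_def)
qed

text \<open>\<open>a \<xi>\<close> is the Laplace transform at frequency \<open>- \<xi>\<close>; the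
  lower limit runs over both signs, so the sign change is harmless. Taking \<open>max R 1\<close> as
  threshold makes it positive.\<close>

lemma l_weakly_diophantineE:
  assumes "l_weakly_diophantine l \<rho>"
  obtains \<epsilon> R where "\<epsilon> > 0" "R > 0" "\<And>\<xi>. \<bar>\<xi>\<bar> \<ge> R \<Longrightarrow> \<epsilon> < \<bar>\<xi>\<bar> powr l * norm (1 - a \<xi>)"
proof -
  let ?f = "\<lambda>b::real. \<bar>b\<bar> powr l * norm (1 - laplace \<rho> (\<i> * of_real b))"
  obtain y where y: "0 < y" "y < Liminf at_infinity (\<lambda>b. ereal (?f b))"
    using dense assms unfolding l_weakly_diophantine_def by blast
  then obtain \<epsilon> where \<epsilon>: "\<epsilon> > 0" "ereal \<epsilon> < Liminf at_infinity (\<lambda>b. ereal (?f b))"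
    by (cases y) auto
  have "\<forall>\<^sub>F b in at_infinity. ereal \<epsilon> < ereal (?f b)"
    by (rule less_LiminfD[OF \<epsilon>(2)])
  then obtain R where R: "\<And>b. norm b \<ge> R \<Longrightarrow> \<epsilon> < ?f b"
    by (auto simp: eventually_at_infinity)
  have "\<epsilon> < \<bar>\<xi>\<bar> powr l * norm (1 - a \<xi>)" if "\<bar>\<xi>\<bar> \<ge> max R 1" for \<xi>
    using R[of "- \<xi>"] that laplace_eq_a[of \<xi>] by simp
  then show thesis using that[of \<epsilon> "max R 1"] \<epsilon>(1) by auto
qed

text \<open>The hypothesis forces \<open>cis (\<xi> y) = 1\<close> almost surely.\<close>

lemma a_periodic:
  assumes "a \<xi> = 1"
  shows "a (real n * \<xi>) = 1"
proof -
  have "Re (a \<xi>) = (\<integral>y. cos (\<xi> * y) \<partial>\<rho>)"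
    unfolding a_def using integral_Re[OF integrable_cis, of \<xi>] by simp
  moreover have i: "integrable \<rho> (\<lambda>y. cos (\<xi> * y))"
    by (rule integrable_const_bound[of _ 1]) auto
  ultimately have "(\<integral>y. 1 - cos (\<xi> * y) \<partial>\<rho>) = 0"
    using assms prob_space by simp
  then have "AE y in \<rho>. 1 - cos (\<xi> * y) = 0"
    by (subst (asm) integral_nonneg_eq_0_iff_AE) (use i in auto)
  then have "AE y in \<rho>. cis (real n * \<xi> * y) = 1"
  proof eventually_elim
    case (elim y)
    then have "cos (\<xi> * y) = 1" by simp
    moreover then have "sin (\<xi> * y) = 0" using sin_cos_squared_add[of "\<xi> * y"] by simp
    ultimately have "cis (\<xi> * y) = 1" by (simp add: complex_eq_iff)
    then show ?case using Complex.DeMoivre[of "\<xi> * y" n] by (simp add: mult.assoc)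
  qed
  then have "a (real n * \<xi>) = (\<integral>y. 1 \<partial>\<rho>)"
    unfolding a_def by (intro integral_cong_AE) auto
  then show ?thesis using prob_space by simp
qed

text \<open>A zero of \<open>b\<close> lies off the origin, since \<open>b 0 = i * lam\<close>, and
  there \<open>a \<xi> = 1\<close>. The same then holds at all natural multiples of
  \<open>\<xi>\<close>, which the diophantine lower bound forbids far out.\<close>

lemma b_nonzero:
  assumes "weakly_diophantine \<rho>"
  shows "b \<xi> \<noteq> 0"
proof
  assume b: "b \<xi> = 0"
  then have "\<xi> \<noteq> 0" using b_eq[of 0] lam_pos by auto
  have a1: "a \<xi> = 1" using a_eq[of \<xi>] b by simp
  obtain l where "l_weakly_diophantine l \<rho>"
    using assms unfolding weakly_diophantine_def by blast
  then obtain \<epsilon> R where R: "\<epsilon> > 0" "\<And>\<xi>. \<bar>\<xi>\<bar> \<ge> R \<Longrightarrow> \<epsilon> < \<bar>\<xi>\<bar> powr l * norm (1 - a \<xi>)"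
    using l_weakly_diophantineE by metis
  obtain n where "R / \<bar>\<xi>\<bar> \<le> real n" using real_arch_simple by blast
  then have "R \<le> \<bar>real n * \<xi>\<bar>" using \<open>\<xi> \<noteq> 0\<close> by (simp add: abs_mult pos_divide_le_eq)
  from R(2)[OF this] R(1) a_periodic[OF a1, of n] show False by simp
qed

text \<open>On a compact interval continuity gives the bound. Outside,
  \<open>|1 - a \<xi>| = |\<xi>| * |b \<xi>|\<close>, and the extra factor \<open>|\<xi>|\<close>
  accounts for the exponent \<open>m + 1\<close>, where \<open>m\<close> rounds \<open>l\<close>
  up.\<close>

lemma polybdd_inverse_b:
  assumes wd: "weakly_diophantine \<rho>"
  shows "polybdd_fun (\<lambda>\<xi>. inverse (b \<xi>))"
proof -
  have cb: "continuous_on UNIV b" using smooth_in_imp[OF smooth_b] by (simp add: bdd_fun_def)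
  have ci: "continuous_on UNIV (\<lambda>\<xi>. inverse (b \<xi>))"
    using b_nonzero[OF wd] by (intro continuous_intros cb) auto
  obtain l where l: "l \<ge> 0" "l_weakly_diophantine l \<rho>"
    using wd unfolding weakly_diophantine_def by blast
  then obtain \<epsilon> R where R: "\<epsilon> > 0" "R > 0" "\<And>\<xi>. \<bar>\<xi>\<bar> \<ge> R \<Longrightarrow> \<epsilon> < \<bar>\<xi>\<bar> powr l * norm (1 - a \<xi>)"
    using l_weakly_diophantineE by metis
  have "bounded ((\<lambda>\<xi>. inverse (b \<xi>)) ` {-R..R})"
    by (intro compact_imp_bounded compact_continuous_image continuous_on_subset[OF ci]) auto
  then obtain D where D: "\<And>\<xi>. \<xi> \<in> {-R..R} \<Longrightarrow> norm (inverse (b \<xi>)) \<le> D"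
    unfolding bounded_iff by blast
  define m where "m = nat \<lceil>l\<rceil>"
  have m: "l \<le> real m" unfolding m_def by linarith
  have D0: "0 \<le> D" using order_trans[OF norm_ge_zero D[of 0]] R(2) by simp
  have "norm (inverse (b \<xi>)) \<le> (D + 1 / \<epsilon>) * (1 + \<bar>\<xi>\<bar>) ^ (m + 1)" for \<xi>
  proof (cases "\<bar>\<xi>\<bar> \<le> R")
    case True
    then have "\<xi> \<in> {-R..R}" by (simp add: abs_le_iff)
    then have "norm (inverse (b \<xi>)) \<le> D * 1" using D[of \<xi>] by simp
    also have "\<dots> \<le> (D + 1 / \<epsilon>) * (1 + \<bar>\<xi>\<bar>) ^ (m + 1)"
      using D0 R(1) by (intro mult_mono one_le_power) auto
    finally show ?thesis .
  next
    case False
    then have x: "\<bar>\<xi>\<bar> > 0" "R \<le> \<bar>\<xi>\<bar>" using R(2) by auto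
    have "1 - a \<xi> = - (of_real \<xi> * b \<xi>)" using a_eq[of \<xi>] by simp
    then have n: "norm (1 - a \<xi>) = \<bar>\<xi>\<bar> * norm (b \<xi>)" by (simp add: norm_mult)
    have "\<epsilon> < \<bar>\<xi>\<bar> powr l * (\<bar>\<xi>\<bar> * norm (b \<xi>))" using R(3)[OF x(2)] n by simp
    also have "\<dots> \<le> (1 + \<bar>\<xi>\<bar>) ^ m * ((1 + \<bar>\<xi>\<bar>) * norm (b \<xi>))"
    proof (intro mult_mono mult_right_mono)
      have "\<bar>\<xi>\<bar> powr l \<le> (1 + \<bar>\<xi>\<bar>) powr l" using x l(1) by (intro powr_mono2) auto
      also have "\<dots> \<le> (1 + \<bar>\<xi>\<bar>) powr real m" using m by (intro powr_mono) auto
      also have "\<dots> = (1 + \<bar>\<xi>\<bar>) ^ m" by (rule powr_realpow) auto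
      finally show "\<bar>\<xi>\<bar> powr l \<le> (1 + \<bar>\<xi>\<bar>) ^ m" .
    qed auto
    also have "\<dots> = (1 + \<bar>\<xi>\<bar>) ^ (m + 1) * norm (b \<xi>)" by simp
    finally have "1 \<le> (1 + \<bar>\<xi>\<bar>) ^ (m + 1) * norm (b \<xi>) / \<epsilon>"
      by (simp only: pos_le_divide_eq[OF R(1)] mult_1_left less_imp_le)
    then have "1 \<le> (1 / \<epsilon> * (1 + \<bar>\<xi>\<bar>) ^ (m + 1)) * norm (b \<xi>)"
      by (simp only: times_divide_eq_left mult_1_left)
    moreover have "norm (b \<xi>) > 0" using b_nonzero[OF wd] by simp
    ultimately have "norm (inverse (b \<xi>)) \<le> 1 / \<epsilon> * (1 + \<bar>\<xi>\<bar>) ^ (m + 1)"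
      by (subst norm_inverse) (simp only: inverse_eq_divide pos_divide_le_eq)
    also have "\<dots> \<le> (D + 1 / \<epsilon>) * (1 + \<bar>\<xi>\<bar>) ^ (m + 1)"
      using D0 by (intro mult_right_mono) auto
    finally show ?thesis .
  qed
  with ci show ?thesis by (rule polybdd_funI)
qed

lemma smooth_h:
  assumes "weakly_diophantine \<rho>"
  shows "smooth_in polybdd_fun h"
proof -
  have "smooth_in polybdd_fun (\<lambda>\<xi>. c \<xi> * (1 / (\<i> * of_real lam) * inverse (b \<xi>)))"
    by (intro smooth_polybdd_mult smooth_polybdd_const smooth_polybdd_inverse smooth_bdd_imp_polybdd
        smooth_c smooth_b polybdd_inverse_b b_nonzero assms)
  then show ?thesis by (simp add: h_def[abs_def])
qed

lemma h_eq:
  assumes "weakly_diophantine \<rho>" "\<xi> \<noteq> 0"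
  shows "h \<xi> = 1 / (1 - a \<xi>) + 1 / of_real lam * (1 / (\<i> * of_real \<xi>))"
proof -
  define x L B where "x = complex_of_real \<xi>" and "L = complex_of_real lam" and "B = b \<xi>"
  have nz: "x \<noteq> 0" "L \<noteq> 0" "B \<noteq> 0"
    using assms b_nonzero lam_pos by (auto simp: x_def L_def B_def)
  have u: "1 - a \<xi> = - (x * B)" using a_eq[of \<xi>] by (simp add: x_def B_def)
  have "c \<xi> = (B - \<i> * L) / x"
    using b_eq[of \<xi>] nz by (simp add: x_def L_def B_def field_simps)
  then have "h \<xi> = (B - \<i> * L) / x * (1 / (\<i> * L) * inverse B)"
    by (simp add: h_def L_def B_def)
  also have "\<dots> = 1 / (- (x * B)) + 1 / L * (1 / (\<i> * x))"
    using nz by (simp add: field_simps)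
  finally show ?thesis by (simp only: u x_def L_def)
qed

text \<open>This form has no exceptional point at the origin. The defect
  \<open>b \<xi> / (i * lam)\<close> is exactly the symbol that the primitive contributes to the
  renewal equation.\<close>

lemma h_mult_u:
  assumes "weakly_diophantine \<rho>"
  shows "h \<xi> * (1 - a \<xi>) = 1 - b \<xi> / (\<i> * of_real lam)"
proof -
  have nz: "b \<xi> \<noteq> 0" "of_real lam \<noteq> (0::complex)"
    using assms b_nonzero lam_pos by auto
  have "h \<xi> * (1 - a \<xi>) = - (of_real \<xi> * c \<xi>) * (b \<xi> * inverse (b \<xi>)) / (\<i> * of_real lam)"
    using a_eq[of \<xi>] by (simp add: h_def)
  also have "of_real \<xi> * c \<xi> = b \<xi> - \<i> * of_real lam" using b_eq[of \<xi>] by simp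
  finally show ?thesis using nz by (simp add: diff_divide_distrib)
qed

section \<open>Solving the renewal equation\<close>

text \<open>The integral of \<open>cis (\<xi> * t)\<close> over \<open>t\<close> from 0 to
  \<open>y\<close>, with the removable singularity at \<open>\<xi> = 0\<close> filled in.\<close>

definition ker :: "real \<Rightarrow> real \<Rightarrow> complex" where
  "ker \<xi> y = (if \<xi> = 0 then of_real y else (cis (\<xi> * y) - 1) / (\<i> * of_real \<xi>))"

lemma ker_measurable [measurable]: "case_prod ker \<in> borel_measurable (borel \<Otimes>\<^sub>M borel)"
  unfolding ker_def[abs_def] by measurable

lemma has_vector_derivative_ker: "(ker \<xi> has_vector_derivative cis (\<xi> * y)) (at y)"
proof (cases "\<xi> = 0")
  case True
  have "((\<lambda>y. complex_of_real y) has_vector_derivative 1) (at y)"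
    by (auto intro!: derivative_eq_intros)
  with True show ?thesis by (simp add: ker_def[abs_def])
next
  case False
  have "((\<lambda>y. cis (\<xi> * y)) has_vector_derivative (\<i> * of_real \<xi>) * cis (\<xi> * y)) (at y)"
    unfolding has_vector_derivative_def by (auto intro!: derivative_eq_intros ext simp: scaleR_conv_of_real)
  then have "((\<lambda>y. (1 / (\<i> * of_real \<xi>)) * (cis (\<xi> * y) - 1)) has_vector_derivative
      (1 / (\<i> * of_real \<xi>)) * ((\<i> * of_real \<xi>) * cis (\<xi> * y) - 0)) (at y)"
    by (intro has_vector_derivative_mult_right has_vector_derivative_diff has_vector_derivative_const)
  with False show ?thesis by (simp add: ker_def[abs_def])
qed

lemma ker_0: "ker \<xi> 0 = 0" by (simp add: ker_def)

text \<open>The derivative in \<open>y\<close> has modulus 1. Uniformity in \<open>\<xi>\<close> is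
  the point: the joint integral over frequency and step then converges by integrability of
  \<open>g\<close> and the first moment of \<open>\<rho>\<close>.\<close>

lemma norm_ker_le: "norm (ker \<xi> y) \<le> \<bar>y\<bar>"
proof -
  have "norm (ker \<xi> y - ker \<xi> 0) \<le> 1 * norm (y - 0)"
  proof (rule differentiable_bound[of UNIV "ker \<xi>" "\<lambda>x t. t *\<^sub>R cis (\<xi> * x)"])
    show "(ker \<xi> has_derivative (\<lambda>t. t *\<^sub>R cis (\<xi> * x))) (at x within UNIV)" for x
      using has_vector_derivative_ker by (simp add: has_vector_derivative_def)
    show "onorm (\<lambda>t. t *\<^sub>R cis (\<xi> * x)) \<le> 1" for x
      by (rule onorm_bound) auto
  qed auto
  then show ?thesis by (simp add: ker_0)
qed

text \<open>Translating the interval of integration by \<open>x\<close> multiplies by a phase; hence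
  increments of the primitive are again governed by \<open>ker\<close>.\<close>

lemma ker_add: "ker \<xi> (x + y) - ker \<xi> x = cis (\<xi> * x) * ker \<xi> y"
  by (simp add: ker_def distrib_left right_diff_distrib diff_divide_distrib flip: cis_mult)

lemma integral_ker: "(\<integral>y. ker \<xi> y \<partial>\<rho>) = b \<xi> / \<i>"
proof (cases "\<xi> = 0")
  case True
  then show ?thesis using integrable_ident b_eq[of 0] by (simp add: ker_def lam_eq)
next
  case False
  have "(\<integral>y. ker \<xi> y \<partial>\<rho>) = (\<integral>y. (cis (\<xi> * y) - 1) / (\<i> * of_real \<xi>) \<partial>\<rho>)"
    using False by (simp add: ker_def)
  also have "\<dots> = (a \<xi> - 1) / (\<i> * of_real \<xi>)"
    using integrable_cis[of \<xi>] prob_space by (simp add: a_def)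
  finally show ?thesis using False a_eq[of \<xi>] by simp
qed

text \<open>The primitive of \<open>inv_fourier g\<close> that vanishes at 0, formed under the
  frequency integral.\<close>

definition prim :: "(real \<Rightarrow> complex) \<Rightarrow> real \<Rightarrow> complex" where
  "prim g x = 1 / (2 * of_real pi) * (\<integral>\<xi>. g \<xi> * ker \<xi> x \<partial>lborel)"

lemma prim_integrable:
  assumes g: "integrable lborel g"
  shows "integrable lborel (\<lambda>\<xi>. g \<xi> * ker \<xi> x)"
proof -
  have [measurable]: "g \<in> borel_measurable borel" using borel_measurable_integrable[OF g] by simp
  show ?thesis
    by (rule Bochner_Integration.integrable_bound[OF integrable_mult_left[OF integrable_norm[OF g], of "\<bar>x\<bar>"]])
      (auto simp: norm_mult intro!: mult_left_mono norm_ker_le)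
qed

lemma has_vector_derivative_prim:
  assumes g: "integrable lborel g"
  shows "(prim g has_vector_derivative inv_fourier g x) (at x)"
proof -
  have [measurable]: "g \<in> borel_measurable borel" using borel_measurable_integrable[OF g] by simp
  have "((\<lambda>x. \<integral>\<xi>. g \<xi> * ker \<xi> x \<partial>lborel) has_vector_derivative (\<integral>\<xi>. g \<xi> * cis (\<xi> * x) \<partial>lborel)) (at x)"
    by (rule has_vector_derivative_integral[where B = "\<lambda>\<xi>. norm (g \<xi>)"])
      (auto intro!: prim_integrable g has_vector_derivative_mult_right has_vector_derivative_ker simp: norm_mult)
  from has_vector_derivative_mult_right[OF this, of "1 / (2 * of_real pi)"]
  show ?thesis by (simp add: prim_def[abs_def] inv_fourier_def mult_ac)
qed

lemma prim_diff:
  assumes g: "integrable lborel g"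
  shows "prim g (x + y) - prim g x = 1 / (2 * of_real pi) * (\<integral>\<xi>. g \<xi> * cis (\<xi> * x) * ker \<xi> y \<partial>lborel)"
proof -
  have "(\<integral>\<xi>. g \<xi> * ker \<xi> (x + y) \<partial>lborel) - (\<integral>\<xi>. g \<xi> * ker \<xi> x \<partial>lborel) =
      (\<integral>\<xi>. g \<xi> * (ker \<xi> (x + y) - ker \<xi> x) \<partial>lborel)"
    unfolding right_diff_distrib
    by (rule Bochner_Integration.integral_diff[symmetric]) (intro prim_integrable g)+
  then show ?thesis
    unfolding prim_def by (simp add: ker_add mult.assoc flip: right_diff_distrib diff_divide_distrib)
qed

text \<open>With \<open>\<beta> = b / (i * lam)\<close>, the function \<open>F - P F\<close> has
  frequency density \<open>g * h * (1 - a) = g * (1 - \<beta>)\<close> and \<open>K - P K\<close>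
  has density \<open>g * \<beta>\<close>; they add up to \<open>g\<close>. \<open>K\<close> itself
  need not be integrable, so it enters through increments and the constant \<open>k\<close> cancels.
  It stays abstract because it is used both with \<open>T_conv f\<close> and with a multiple of
  \<open>arctan\<close>.\<close>

lemma renewal_equation:
  assumes wd: "weakly_diophantine \<rho>"
    and g: "integrable lborel g" and gh: "integrable lborel (\<lambda>\<xi>. g \<xi> * h \<xi>)"
    and K [measurable]: "K \<in> borel_measurable borel" and C: "\<And>x. norm (K x) \<le> C"
    and K_eq: "\<And>x. K x = k - prim g x / of_real lam"
  defines "H \<equiv> \<lambda>x. inv_fourier (\<lambda>\<xi>. g \<xi> * h \<xi>) x + K x"
  shows "inv_fourier g x = H x - P H x"
proof -
  let ?c = "1 / (2 * complex_of_real pi)"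
  define \<beta> where "\<beta> \<xi> = b \<xi> / (\<i> * of_real lam)" for \<xi>
  let ?F = "inv_fourier (\<lambda>\<xi>. g \<xi> * h \<xi>)"
  have sl: "sigma_finite_measure (lborel :: real measure)" by (rule lborel.sigma_finite_measure_axioms)
  have sr: "sigma_finite_measure \<rho>" by (rule sigma_finite_measure)
  have [measurable]: "g \<in> borel_measurable borel" "(\<lambda>\<xi>. g \<xi> * h \<xi>) \<in> borel_measurable borel"
    using borel_measurable_integrable[OF g] borel_measurable_integrable[OF gh] by simp_all
  have one: "integrable \<rho> (\<lambda>y. 1 :: real)" by simp
  have PF: "(\<integral>y. ?F (x + y) \<partial>\<rho>) = ?c * (\<integral>\<xi>. cis (\<xi> * x) * (g \<xi> * h \<xi>) * a \<xi> \<partial>lborel)"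
    and iF: "integrable \<rho> (\<lambda>y. ?F (x + y))"
  proof -
    let ?f = "\<lambda>y \<xi>. cis (\<xi> * (x + y)) * (g \<xi> * h \<xi>)"
    note F = Fubini_dominated[of \<rho> lborel ?f, OF sr sl _ one integrable_norm[OF gh]]
    have m: "case_prod ?f \<in> borel_measurable (\<rho> \<Otimes>\<^sub>M lborel)" by measurable
    show "integrable \<rho> (\<lambda>y. ?F (x + y))"
      unfolding inv_fourier_def by (intro integrable_mult_right F(2) m) (simp add: norm_mult)
    have "(\<integral>y. ?F (x + y) \<partial>\<rho>) = ?c * (\<integral>y. \<integral>\<xi>. ?f y \<xi> \<partial>lborel \<partial>\<rho>)"
      unfolding inv_fourier_def by simp
    also have "(\<integral>y. \<integral>\<xi>. ?f y \<xi> \<partial>lborel \<partial>\<rho>) = (\<integral>\<xi>. \<integral>y. ?f y \<xi> \<partial>\<rho> \<partial>lborel)"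
      by (intro F(1) m) (simp add: norm_mult)
    also have "\<dots> = (\<integral>\<xi>. cis (\<xi> * x) * (g \<xi> * h \<xi>) * a \<xi> \<partial>lborel)"
    proof (intro Bochner_Integration.integral_cong refl)
      fix \<xi>
      have "(\<integral>y. ?f y \<xi> \<partial>\<rho>) = (\<integral>y. cis (\<xi> * x) * (g \<xi> * h \<xi>) * cis (\<xi> * y) \<partial>\<rho>)"
        by (simp add: distrib_left mult_ac flip: cis_mult)
      then show "(\<integral>y. ?f y \<xi> \<partial>\<rho>) = cis (\<xi> * x) * (g \<xi> * h \<xi>) * a \<xi>"
        by (simp add: a_def)
    qed
    finally show "(\<integral>y. ?F (x + y) \<partial>\<rho>) = ?c * (\<integral>\<xi>. cis (\<xi> * x) * (g \<xi> * h \<xi>) * a \<xi> \<partial>lborel)" .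
  qed
  \<comment> \<open>Up to the factor \<open>- 1 / lam\<close>, increments of \<open>K\<close> are
    those of \<open>prim g\<close>, with integrand \<open>g * cis * ker\<close>; averaging
    \<open>ker\<close> over a step gives \<open>b / i\<close>.\<close>
  have PK: "(\<integral>y. K x - K (x + y) \<partial>\<rho>) = ?c * (\<integral>\<xi>. cis (\<xi> * x) * g \<xi> * \<beta> \<xi> \<partial>lborel)"
  proof -
    let ?f = "\<lambda>y \<xi>. g \<xi> * cis (\<xi> * x) * ker \<xi> y"
    have m: "case_prod ?f \<in> borel_measurable (\<rho> \<Otimes>\<^sub>M lborel)" by measurable
    have "K x - K (x + y) = (prim g (x + y) - prim g x) / of_real lam" for y
      unfolding K_eq by (simp add: diff_divide_distrib)
    then have "(\<integral>y. K x - K (x + y) \<partial>\<rho>) = ?c / of_real lam * (\<integral>y. \<integral>\<xi>. ?f y \<xi> \<partial>lborel \<partial>\<rho>)"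
      by (simp add: prim_diff[OF g])
    also have "(\<integral>y. \<integral>\<xi>. ?f y \<xi> \<partial>lborel \<partial>\<rho>) = (\<integral>\<xi>. \<integral>y. ?f y \<xi> \<partial>\<rho> \<partial>lborel)"
    proof (rule Fubini_dominated(1)[OF sr sl m integrable_norm[OF integrable_ident] integrable_norm[OF g]])
      show "norm (?f y \<xi>) \<le> norm y * norm (g \<xi>)" for y \<xi>
        using mult_right_mono[OF norm_ker_le[of \<xi> y], of "norm (g \<xi>)"] by (simp add: norm_mult mult.commute)
    qed
    also have "\<dots> = (\<integral>\<xi>. g \<xi> * cis (\<xi> * x) * (b \<xi> / \<i>) \<partial>lborel)"
      by (simp add: integral_ker)
    also have "?c / of_real lam * \<dots> = ?c * (\<integral>\<xi>. (1 / of_real lam) * (g \<xi> * cis (\<xi> * x) * (b \<xi> / \<i>)) \<partial>lborel)"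
      by simp
    also have "(\<lambda>\<xi>. (1 / of_real lam) * (g \<xi> * cis (\<xi> * x) * (b \<xi> / \<i>))) =
        (\<lambda>\<xi>. cis (\<xi> * x) * g \<xi> * \<beta> \<xi>)"
      using lam_pos by (intro ext) (simp add: \<beta>_def field_simps)
    finally show ?thesis .
  qed
  \<comment> \<open>Splitting and joining the integrals below requires integrability of each piece;
    the factors \<open>a\<close>, \<open>\<beta>\<close> and \<open>1 - \<beta>\<close> are all
    bounded.\<close>
  have cg: "integrable lborel (\<lambda>\<xi>. cis (\<xi> * x) * u \<xi> * v \<xi>)"
    if u: "integrable lborel u" and v: "bdd_fun v" for u v
  proof -
    obtain B where B: "\<And>\<xi>. norm (v \<xi>) \<le> B" using v unfolding bdd_fun_def by blast
    have [measurable]: "u \<in> borel_measurable borel" "v \<in> borel_measurable borel"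
      using borel_measurable_integrable[OF u] v borel_measurable_continuous_onI by (auto simp: bdd_fun_def)
    have B0: "B \<ge> 0" using order_trans[OF norm_ge_zero B[of 0]] .
    show ?thesis
    proof (rule Bochner_Integration.integrable_bound[OF integrable_mult_left[OF integrable_norm[OF u], of B]])
      show "AE \<xi> in lborel. norm (cis (\<xi> * x) * u \<xi> * v \<xi>) \<le> norm (norm (u \<xi>) * B)"
        using mult_left_mono[OF B norm_ge_zero] B0 by (intro AE_I2) (simp add: norm_mult)
    qed measurable
  qed
  have one': "bdd_fun (\<lambda>_. 1)" by (rule bdd_funI[of _ 1]) auto
  have iK: "integrable \<rho> (\<lambda>y. K (x + y))"
    by (rule integrable_const_bound[of _ C]) (use C in auto)
  have b1: "bdd_fun \<beta>"
  proof -
    have "\<beta> = (\<lambda>\<xi>. (1 / (\<i> * of_real lam)) * b \<xi>)"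
      by (rule ext) (simp only: \<beta>_def times_divide_eq_left mult_1_left)
    then show ?thesis
      by (simp only: bdd_fun_cmult[OF smooth_in_imp[OF smooth_b]])
  qed
  have b2: "bdd_fun (\<lambda>\<xi>. 1 - \<beta> \<xi>)"
    using bdd_fun_add[OF one' bdd_fun_cmult[OF b1, of "- 1"]] by simp
  have FPF: "?F x - (\<integral>y. ?F (x + y) \<partial>\<rho>) =
      ?c * (\<integral>\<xi>. cis (\<xi> * x) * g \<xi> * (1 - \<beta> \<xi>) \<partial>lborel)"
  proof -
    have "?F x - (\<integral>y. ?F (x + y) \<partial>\<rho>) = ?c * ((\<integral>\<xi>. cis (\<xi> * x) * (g \<xi> * h \<xi>) * 1 \<partial>lborel) -
        (\<integral>\<xi>. cis (\<xi> * x) * (g \<xi> * h \<xi>) * a \<xi> \<partial>lborel))"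
      unfolding PF by (simp only: inv_fourier_def right_diff_distrib mult_1_right)
    also have "(\<integral>\<xi>. cis (\<xi> * x) * (g \<xi> * h \<xi>) * 1 \<partial>lborel) -
        (\<integral>\<xi>. cis (\<xi> * x) * (g \<xi> * h \<xi>) * a \<xi> \<partial>lborel) =
        (\<integral>\<xi>. cis (\<xi> * x) * (g \<xi> * h \<xi>) * 1 - cis (\<xi> * x) * (g \<xi> * h \<xi>) * a \<xi> \<partial>lborel)"
      by (rule Bochner_Integration.integral_diff[symmetric, OF cg[OF gh one'] cg[OF gh smooth_in_imp[OF smooth_a]]])
    also have "(\<lambda>\<xi>. cis (\<xi> * x) * (g \<xi> * h \<xi>) * 1 - cis (\<xi> * x) * (g \<xi> * h \<xi>) * a \<xi>) =
        (\<lambda>\<xi>. cis (\<xi> * x) * g \<xi> * (h \<xi> * (1 - a \<xi>)))"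
      by (rule ext) (simp add: algebra_simps)
    finally show ?thesis unfolding h_mult_u[OF wd] \<beta>_def .
  qed
  have "H x - P H x = (?F x - (\<integral>y. ?F (x + y) \<partial>\<rho>)) + (K x - (\<integral>y. K (x + y) \<partial>\<rho>))"
    unfolding H_def P_def by (subst Bochner_Integration.integral_add[OF iF iK]) simp
  also have "K x - (\<integral>y. K (x + y) \<partial>\<rho>) = (\<integral>y. K x - K (x + y) \<partial>\<rho>)"
    using iK prob_space by simp
  also have "\<dots> = ?c * (\<integral>\<xi>. cis (\<xi> * x) * g \<xi> * \<beta> \<xi> \<partial>lborel)"
    by (rule PK)
  also have "?F x - (\<integral>y. ?F (x + y) \<partial>\<rho>) + \<dots> =
      ?c * ((\<integral>\<xi>. cis (\<xi> * x) * g \<xi> * (1 - \<beta> \<xi>) \<partial>lborel) +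
        (\<integral>\<xi>. cis (\<xi> * x) * g \<xi> * \<beta> \<xi> \<partial>lborel))"
    unfolding FPF by (simp only: distrib_left)
  also have "(\<integral>\<xi>. cis (\<xi> * x) * g \<xi> * (1 - \<beta> \<xi>) \<partial>lborel) +
        (\<integral>\<xi>. cis (\<xi> * x) * g \<xi> * \<beta> \<xi> \<partial>lborel) =
      (\<integral>\<xi>. cis (\<xi> * x) * g \<xi> * (1 - \<beta> \<xi>) +
        cis (\<xi> * x) * g \<xi> * \<beta> \<xi> \<partial>lborel)"
    by (rule Bochner_Integration.integral_add[symmetric, OF cg[OF g b2] cg[OF g b1]])
  also have "(\<lambda>\<xi>. cis (\<xi> * x) * g \<xi> * (1 - \<beta> \<xi>) +
        cis (\<xi> * x) * g \<xi> * \<beta> \<xi>) = (\<lambda>\<xi>. cis (\<xi> * x) * g \<xi>)"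
    by (rule ext) (simp add: algebra_simps)
  finally show ?thesis by (simp add: inv_fourier_def)
qed

end

section \<open>Weakly diophantine walks\<close>

text \<open>The Fourier transform of \<open>1 / (1 + x\<^sup>2)\<close>. Its kink at 0 keeps it out
  of the Schwartz space, but it decays rapidly, so its product with the polynomially bounded
  \<open>h\<close> is integrable.\<close>

definition expabs :: "real \<Rightarrow> complex" where
  "expabs \<xi> = of_real (pi * exp (- \<bar>\<xi>\<bar>))"

lemma rapid_fun_expabs: "rapid_fun expabs"
proof (rule rapid_funI)
  show "continuous_on UNIV expabs" unfolding expabs_def by (intro continuous_intros)
  fix k
  have "(1 + \<bar>\<xi>\<bar>) ^ k * norm (expabs \<xi>) \<le> fact k * exp 1 * pi" for \<xi> :: real
  proof -
    have "(1 + \<bar>\<xi>\<bar>) ^ k * norm (expabs \<xi>) \<le> (fact k * exp (1 + \<bar>\<xi>\<bar>)) * (pi * exp (- \<bar>\<xi>\<bar>))"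
      unfolding expabs_def norm_of_real by (intro mult_mono power_le_fact_exp) (auto simp: abs_mult)
    also have "\<dots> = fact k * (exp (1 + \<bar>\<xi>\<bar>) * exp (- \<bar>\<xi>\<bar>)) * pi" by (simp only: mult_ac)
    also have "exp (1 + \<bar>\<xi>\<bar>) * exp (- \<bar>\<xi>\<bar>) = exp 1" by (simp add: mult_exp_exp)
    finally show ?thesis .
  qed
  then show "\<exists>C. \<forall>x. (1 + \<bar>x\<bar>) ^ k * norm (expabs x) \<le> C" by blast
qed

lemma integral_exp_halfline:
  assumes z: "Re z > 0"
  shows "(\<lambda>n. \<integral>t. indicator {0..real n} t *\<^sub>R exp (- z * of_real t) \<partial>lborel) \<longlonglongrightarrow> 1 / z"
proof -
  have nz: "z \<noteq> 0" using z by auto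
  have "(\<integral>t. indicator {0..real n} t *\<^sub>R exp (- z * of_real t) \<partial>lborel) =
      - exp (- z * of_real (real n)) / z - (- exp (- z * of_real 0) / z)" for n
  proof (rule integral_FTC_Icc)
    fix t :: real
    have "((\<lambda>w. - exp (- z * w) / z) has_field_derivative exp (- z * of_real t)) (at (of_real t))"
      using nz by (auto intro!: derivative_eq_intros)
    then have "((\<lambda>t. - exp (- z * of_real t) / z) has_vector_derivative exp (- z * of_real t)) (at t)"
      by (rule has_vector_derivative_real_field)
    then show "((\<lambda>t. - exp (- z * of_real t) / z) has_vector_derivative exp (- z * of_real t)) (at t within {0..real n})"
      by (rule has_vector_derivative_at_within)
  qed (auto intro!: continuous_intros)
  moreover have "(\<lambda>n. - exp (- z * of_real (real n)) / z - (- exp (- z * of_real 0) / z)) \<longlonglongrightarrow> 0 - (- 1 / z)"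
  proof (intro tendsto_diff)
    show "(\<lambda>n. - exp (- z * of_real (real n)) / z) \<longlonglongrightarrow> 0"
    proof (rule Lim_null_comparison)
      show "\<forall>\<^sub>F n in sequentially. norm (- exp (- z * of_real (real n)) / z) \<le> exp (- Re z * real n) / norm z"
        by (intro always_eventually allI) (simp add: norm_divide)
      show "(\<lambda>n. exp (- Re z * real n) / norm z) \<longlonglongrightarrow> 0"
        using z nz by real_asymp
    qed
  qed auto
  ultimately show ?thesis by simp
qed

text \<open>Folding at 0 gives two half-line exponentials with rates \<open>z = 1 - i * x\<close>
  and \<open>w = 1 + i * x\<close>, and \<open>1 / z + 1 / w = 2 / (1 + x\<^sup>2)\<close>.\<close>

lemma inv_fourier_expabs: "inv_fourier expabs x = of_real (1 / (1 + x\<^sup>2))"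
proof -
  let ?f = "\<lambda>\<xi>. cis (\<xi> * x) * of_real (exp (- \<bar>\<xi>\<bar>))"
  define z where "z = Complex 1 (- x)"
  define w where "w = Complex 1 x"
  have int: "integrable lborel ?f"
  proof -
    have "integrable lborel (\<lambda>\<xi>. (1 / of_real pi) * expabs \<xi>)"
      by (intro integrable_mult_right rapid_fun_integrable rapid_fun_expabs)
    then show ?thesis
      by (rule Bochner_Integration.integrable_bound) (auto simp: norm_mult expabs_def abs_mult)
  qed
  note LIMSEQ_integral_symmetric[OF int]
  moreover have "(\<integral>\<xi>. indicator {- real n..real n} \<xi> *\<^sub>R ?f \<xi> \<partial>lborel) =
     (\<integral>t. indicator {0..real n} t *\<^sub>R exp (- z * of_real t) \<partial>lborel) +
     (\<integral>t. indicator {0..real n} t *\<^sub>R exp (- w * of_real t) \<partial>lborel)" for n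
  proof -
    have e1: "exp (- z * of_real t) = cis (t * x) * of_real (exp (- t))" for t
      by (simp add: exp_eq_polar z_def mult.commute)
    have e2: "exp (- w * of_real t) = cis (- t * x) * of_real (exp (- t))" for t
      by (simp add: exp_eq_polar w_def mult.commute)
    have i: "integrable lborel (\<lambda>t. indicator A t *\<^sub>R ?f t)" if "A \<in> sets borel" for A
      by (rule Bochner_Integration.integrable_bound[OF int]) (use that in \<open>auto simp: indicator_def\<close>)
    have "(\<integral>\<xi>. indicator {- real n..real n} \<xi> *\<^sub>R ?f \<xi> \<partial>lborel) =
       (\<integral>\<xi>. indicator {0..real n} \<xi> *\<^sub>R ?f \<xi> + indicator {- real n..0} \<xi> *\<^sub>R ?f \<xi> \<partial>lborel)"
    \<comment> \<open>The two closed intervals overlap in the null set \<open>{0}\<close>, so the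
      splitting holds almost everywhere.\<close>
    proof (rule integral_cong_AE)
      show "AE \<xi> in lborel. indicator {- real n..real n} \<xi> *\<^sub>R ?f \<xi> =
          indicator {0..real n} \<xi> *\<^sub>R ?f \<xi> + indicator {- real n..0} \<xi> *\<^sub>R ?f \<xi>"
        using AE_lborel_singleton[of 0] by eventually_elim (auto simp: indicator_def)
    qed measurable
    also have "\<dots> = (\<integral>\<xi>. indicator {0..real n} \<xi> *\<^sub>R ?f \<xi> \<partial>lborel) + (\<integral>\<xi>. indicator {- real n..0} \<xi> *\<^sub>R ?f \<xi> \<partial>lborel)"
      by (rule Bochner_Integration.integral_add) (intro i; simp)+
    also have "(\<integral>\<xi>. indicator {0..real n} \<xi> *\<^sub>R ?f \<xi> \<partial>lborel) =
        (\<integral>t. indicator {0..real n} t *\<^sub>R exp (- z * of_real t) \<partial>lborel)"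
      unfolding e1 by (intro Bochner_Integration.integral_cong) (auto simp: indicator_def)
    also have "(\<integral>\<xi>. indicator {- real n..0} \<xi> *\<^sub>R ?f \<xi> \<partial>lborel) =
        (\<integral>t. indicator {- real n..0} (0 + (- 1) * t) *\<^sub>R ?f (0 + (- 1) * t) \<partial>lborel)"
      by (subst lborel_integral_real_affine[where c = "- 1" and t = 0]) auto
    also have "\<dots> = (\<integral>t. indicator {0..real n} t *\<^sub>R exp (- w * of_real t) \<partial>lborel)"
      unfolding e2 by (intro Bochner_Integration.integral_cong) (auto simp: indicator_def)
    finally show ?thesis .
  qed
  moreover have "(\<lambda>n. (\<integral>t. indicator {0..real n} t *\<^sub>R exp (- z * of_real t) \<partial>lborel) +
     (\<integral>t. indicator {0..real n} t *\<^sub>R exp (- w * of_real t) \<partial>lborel)) \<longlonglongrightarrow> 1 / z + 1 / w"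
    by (intro tendsto_add integral_exp_halfline) (auto simp: z_def w_def)
  ultimately have "(\<integral>\<xi>. ?f \<xi> \<partial>lborel) = 1 / z + 1 / w"
    using LIMSEQ_unique by simp
  also have "1 / z + 1 / w = (1 * w + 1 * z) / (z * w)"
    by (rule add_frac_eq) (auto simp: z_def w_def complex_eq_iff)
  also have "z * w = of_real (1 + x\<^sup>2)"
    by (simp add: complex_eq_iff z_def w_def power2_eq_square)
  also have "1 * w + 1 * z = of_real 2"
    by (simp add: complex_eq_iff z_def w_def)
  also have "of_real 2 / of_real (1 + x\<^sup>2) = (of_real (2 / (1 + x\<^sup>2)) :: complex)"
    by (rule of_real_divide[symmetric])
  finally have eq: "(\<integral>\<xi>. ?f \<xi> \<partial>lborel) = of_real (2 / (1 + x\<^sup>2))" .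
  have "inv_fourier expabs x = 1 / (2 * of_real pi) * (\<integral>\<xi>. of_real pi * ?f \<xi> \<partial>lborel)"
    unfolding inv_fourier_def expabs_def of_real_mult by (simp only: mult.left_commute)
  also have "\<dots> = 1 / (2 * of_real pi) * (of_real pi * of_real (2 / (1 + x\<^sup>2)))"
    unfolding integral_mult_right_zero eq ..
  finally show ?thesis by simp
qed

lemma inv_fourier_measurable [measurable]:
  assumes [measurable]: "g \<in> borel_measurable borel"
  shows "inv_fourier g \<in> borel_measurable borel"
  unfolding inv_fourier_def[abs_def] by measurable

lemma norm_inv_fourier_le: "norm (inv_fourier g x) \<le> (\<integral>\<xi>. norm (g \<xi>) \<partial>lborel) / (2 * pi)"
proof -
  have "norm (\<integral>\<xi>. cis (\<xi> * x) * g \<xi> \<partial>lborel) \<le> (\<integral>\<xi>. norm (g \<xi>) \<partial>lborel)"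
    by (rule order_trans[OF integral_norm_bound]) (simp add: norm_mult)
  then show ?thesis
    unfolding inv_fourier_def by (simp add: norm_mult norm_divide divide_right_mono)
qed

text \<open>Multiplication by \<open>1 + x\<^sup>2\<close> leaves one term for each seminorm. Any
  measure that integrates \<open>1 / (1 + x\<^sup>2)\<close> therefore acts continuously on Schwartz
  functions.\<close>

lemma norm_le_schwartz_seminorms:
  assumes "schwartz f"
  shows "norm (f x) \<le> (schwartz_seminorm 0 0 f + schwartz_seminorm 2 0 f) * (1 / (1 + x\<^sup>2))"
proof -
  have le: "norm (x ^ k *\<^sub>R f x) \<le> schwartz_seminorm k 0 f" for k
  proof -
    have "bounded (range (\<lambda>x. x ^ k *\<^sub>R higher_vderiv 0 f x))"
      using assms unfolding schwartz_def by blast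
    then obtain B where B: "\<And>x. norm (x ^ k *\<^sub>R higher_vderiv 0 f x) \<le> B"
      unfolding bounded_iff by blast
    have "norm (x ^ k *\<^sub>R higher_vderiv 0 f x) \<le> schwartz_seminorm k 0 f"
      unfolding schwartz_seminorm_def by (rule cSUP_upper[OF UNIV_I bdd_aboveI2[OF B]])
    then show ?thesis by (simp add: higher_vderiv_def)
  qed
  have pos: "1 + x\<^sup>2 > 0" by (simp add: add_pos_nonneg)
  have "(1 + x\<^sup>2) * norm (f x) = norm (x ^ 0 *\<^sub>R f x) + norm (x ^ 2 *\<^sub>R f x)"
    by (simp add: algebra_simps)
  also have "\<dots> \<le> schwartz_seminorm 0 0 f + schwartz_seminorm 2 0 f"
    by (intro add_mono le)
  finally show ?thesis using pos by (simp add: pos_le_divide_eq mult.commute)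
qed

lemma schwartz_integrable_measure:
  assumes M: "integrable M (\<lambda>x::real. 1 / (1 + x\<^sup>2))" "sets M = sets borel" and f: "schwartz f"
  shows "integrable M f"
    and "norm (\<integral>x. f x \<partial>M) \<le> (schwartz_seminorm 0 0 f + schwartz_seminorm 2 0 f) * (\<integral>x. 1 / (1 + x\<^sup>2) \<partial>M)"
proof -
  let ?C = "schwartz_seminorm 0 0 f + schwartz_seminorm 2 0 f"
  have m: "f \<in> borel_measurable M" using schwartz_borel[OF f] M(2) by (simp cong: measurable_cong_sets)
  show "integrable M f"
  proof (rule Bochner_Integration.integrable_bound[OF integrable_mult_right[OF M(1), of ?C] m])
    show "AE x in M. norm (f x) \<le> norm (?C * (1 / (1 + x\<^sup>2)))"
      by (intro AE_I2 order_trans[OF norm_le_schwartz_seminorms[OF f]]) (simp only: real_norm_def abs_ge_self)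
  qed
  then have "norm (\<integral>x. f x \<partial>M) \<le> (\<integral>x. ?C * (1 / (1 + x\<^sup>2)) \<partial>M)"
    by (rule Bochner_Integration.integral_norm_bound_integral)
      (intro integrable_mult_right M norm_le_schwartz_seminorms f)+
  then show "norm (\<integral>x. f x \<partial>M) \<le> ?C * (\<integral>x. 1 / (1 + x\<^sup>2) \<partial>M)"
    by (simp only: integral_mult_right_zero)
qed

lemma tempered_measure_diff:
  assumes M: "integrable M (\<lambda>x::real. 1 / (1 + x\<^sup>2))" "sets M = sets borel"
    and N: "integrable N (\<lambda>x::real. 1 / (1 + x\<^sup>2))" "sets N = sets borel"
  shows "tempered_distribution (measure_diff M N)"
proof -
  note iM = schwartz_integrable_measure[OF M] and iN = schwartz_integrable_measure[OF N]
  define cc where "cc = (\<integral>x. 1 / (1 + x\<^sup>2) \<partial>M) + (\<integral>x. 1 / (1 + x\<^sup>2) \<partial>N)"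
  have c0: "cc \<ge> 0" unfolding cc_def by (intro add_nonneg_nonneg integral_nonneg_AE) (auto intro!: AE_I2 divide_nonneg_nonneg)
  have bound: "norm (measure_diff M N f) \<le> (schwartz_seminorm 0 0 f + schwartz_seminorm 2 0 f) * cc"
    if "schwartz f" for f
    using iM(2)[OF that] iN(2)[OF that] norm_triangle_ineq4[of "\<integral>x. f x \<partial>M" "\<integral>x. f x \<partial>N"]
    unfolding measure_diff_def cc_def distrib_left by linarith
  have "\<exists>K. \<exists>d>0. \<forall>g. schwartz g \<longrightarrow>
          (\<forall>k\<le>K. \<forall>n\<le>K. schwartz_seminorm k n (\<lambda>x. g x - f x) < d) \<longrightarrow>
          norm (measure_diff M N g - measure_diff M N f) < e" if f: "schwartz f" and e: "e > 0" for f e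
  \<comment> \<open>Order 2 covers the seminorms with \<open>k = 0\<close> and \<open>k = 2\<close>
    that occur in \<open>bound\<close>. Together they contribute less than
    \<open>e * cc / (cc + 1)\<close>; the added 1 keeps this below \<open>e\<close> and the quotient
    defined for \<open>cc = 0\<close>.\<close>
  proof (intro exI[of _ "2::nat"] exI[of _ "e / (2 * (cc + 1))"] conjI allI impI)
    let ?d = "e / (2 * (cc + 1))"
    show "?d > 0" using e c0 by simp
    fix g assume g: "schwartz g" and s: "\<forall>k\<le>2. \<forall>n\<le>2. schwartz_seminorm k n (\<lambda>x. g x - f x) < ?d"
    have gf: "schwartz (\<lambda>x. g x - f x)" by (rule schwartz_diff[OF g f])
    have "measure_diff M N g - measure_diff M N f = measure_diff M N (\<lambda>x. g x - f x)"
      unfolding measure_diff_def using iM(1) iN(1) f g by simp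
    also have "norm \<dots> \<le> (schwartz_seminorm 0 0 (\<lambda>x. g x - f x) + schwartz_seminorm 2 0 (\<lambda>x. g x - f x)) * cc"
      by (rule bound[OF gf])
    also have "\<dots> \<le> (?d + ?d) * cc"
      by (intro mult_right_mono add_mono) (use s c0 in \<open>auto intro: less_imp_le\<close>)
    also have "?d + ?d = e / (cc + 1)" using c0 by (simp add: divide_simps)
    also have "e / (cc + 1) * cc = e * (cc / (cc + 1))" by simp
    also have "\<dots> < e * 1"
      using c0 by (intro mult_strict_left_mono e) (simp add: divide_less_eq)
    finally show "norm (measure_diff M N g - measure_diff M N f) < e" by simp
  qed
  moreover have "measure_diff M N (\<lambda>x. f x + g x) = measure_diff M N f + measure_diff M N g"
    if "schwartz f" "schwartz g" for f g
    unfolding measure_diff_def using iM(1) iN(1) that by simp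
  moreover have "measure_diff M N (\<lambda>x. k * f x) = k * measure_diff M N f" for k f
    unfolding measure_diff_def by (simp add: right_diff_distrib)
  ultimately show ?thesis
    unfolding tempered_distribution_def by blast
qed

lemma sets_T_kernel [simp]: "sets (T_kernel l) = sets borel"
  by (simp add: T_kernel_def)

lemma integrable_T_kernel:
  fixes f :: "real \<Rightarrow> 'b::{banach,second_countable_topology}"
  assumes l: "l > 0" and f: "integrable lborel f"
  shows "integrable (T_kernel l) f"
    and "(\<integral>x. f x \<partial>T_kernel l) = (1 / l) *\<^sub>R (\<integral>x. indicator {..0} x *\<^sub>R f x \<partial>lborel)"
proof -
  have [measurable]: "f \<in> borel_measurable borel" using borel_measurable_integrable[OF f] by simp
  have "integrable lborel (\<lambda>x. indicator {..0} x *\<^sub>R f x)"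
    by (rule integrable_mult_indicator[OF _ f]) simp
  then have "integrable lborel (\<lambda>x. (1 / l) *\<^sub>R (indicator {..0} x *\<^sub>R f x))"
    by (rule integrable_scaleR_right)
  then show "integrable (T_kernel l) f"
    unfolding T_kernel_def using l by (subst integrable_density) auto
  show "(\<integral>x. f x \<partial>T_kernel l) = (1 / l) *\<^sub>R (\<integral>x. indicator {..0} x *\<^sub>R f x \<partial>lborel)"
    unfolding T_kernel_def using l by (subst integral_density) (auto simp flip: integral_scaleR_right)
qed

section \<open>Uniqueness of the Fourier transform of a distribution\<close>

lemma has_dist_fourier_iff:
  "has_dist_fourier T h \<longleftrightarrow> continuous_on UNIV h \<and>
     (\<forall>f. schwartz f \<longrightarrow> (\<forall>x. integrable lborel (\<lambda>\<xi>. cis (\<xi> * x) * (fourier f \<xi> * h \<xi>)) \<and>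
        dist_convolution T f x = inv_fourier (\<lambda>\<xi>. fourier f \<xi> * h \<xi>) x))"
proof -
  have "exp (\<i> * of_real \<xi> * of_real x) = cis (\<xi> * x)" for \<xi> x
    by (simp add: cis_conv_exp mult_ac)
  then show ?thesis
    unfolding has_dist_fourier_def inv_fourier_def by (simp only: mult.assoc)
qed

text \<open>The Gaussian is the test function, because its transform vanishes nowhere. Its products
  with \<open>h1\<close> and \<open>h2\<close> have the same inverse transform at every point, so
  they agree by injectivity and continuity, and the Gaussian factor cancels.\<close>

lemma has_dist_fourier_unique:
  assumes h1: "has_dist_fourier T h1" and h2: "has_dist_fourier T h2"
  shows "h1 = h2"
proof (rule ext)
  fix x
  let ?g = "\<lambda>\<xi>. fourier gauss \<xi> * h1 \<xi> - fourier gauss \<xi> * h2 \<xi>"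
  have c: "continuous_on UNIV ?g"
    using h1 h2 schwartz_continuous[OF schwartz_fourier[OF schwartz_gauss]]
    unfolding has_dist_fourier_iff by (intro continuous_intros) auto
  have i: "integrable lborel (\<lambda>\<xi>. cis (\<xi> * x) * (fourier gauss \<xi> * h1 \<xi>))"
      "integrable lborel (\<lambda>\<xi>. cis (\<xi> * x) * (fourier gauss \<xi> * h2 \<xi>))" for x
    using h1 h2 schwartz_gauss unfolding has_dist_fourier_iff by blast+
  have "inv_fourier (\<lambda>\<xi>. fourier gauss \<xi> * h1 \<xi>) x = inv_fourier (\<lambda>\<xi>. fourier gauss \<xi> * h2 \<xi>) x" for x
    using h1 h2 schwartz_gauss unfolding has_dist_fourier_iff by metis
  then have eq: "(\<integral>\<xi>. cis (\<xi> * x) * (fourier gauss \<xi> * h1 \<xi>) \<partial>lborel) =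
      (\<integral>\<xi>. cis (\<xi> * x) * (fourier gauss \<xi> * h2 \<xi>) \<partial>lborel)" for x
    unfolding inv_fourier_def by simp
  have ig: "integrable lborel ?g"
    using Bochner_Integration.integrable_diff[OF i[of 0]] by simp
  have "fourier ?g \<xi> = 0" for \<xi>
  proof -
    have "fourier ?g \<xi> = (\<integral>t. cis (t * - \<xi>) * (fourier gauss t * h1 t) - cis (t * - \<xi>) * (fourier gauss t * h2 t) \<partial>lborel)"
      unfolding fourier_eq[of ?g] by (intro Bochner_Integration.integral_cong refl) (simp add: algebra_simps)
    also have "\<dots> = 0"
      unfolding Bochner_Integration.integral_diff[OF i] eq by simp
    finally show ?thesis .
  qed
  from fourier_eq_0_imp[OF ig c this, of x]
  show "h1 x = h2 x" by (simp add: fourier_gauss gauss_def)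
qed

context drifted_walk
begin

text \<open>The terms are nonnegative, so a bound on the partial sums that is uniform in
  \<open>N\<close> is enough; telescoping bounds them by \<open>2 * B\<close>. Here
  \<open>- arctan x / lam\<close> plays the part of \<open>K\<close>: it does not tend to 0 at plus
  infinity, but boundedness is all that the telescoping estimate asks for.\<close>

lemma integrable_green_kernel:
  assumes wd: "weakly_diophantine \<rho>"
  shows "integrable (green_kernel \<rho>) (\<lambda>x. 1 / (1 + x\<^sup>2))"
proof -
  let ?q = "\<lambda>x. complex_of_real (1 / (1 + x\<^sup>2))"
  define K where "K x = complex_of_real (- arctan x / lam)" for x
  have ie: "integrable lborel expabs" by (rule rapid_fun_integrable[OF rapid_fun_expabs])
  have ieh: "integrable lborel (\<lambda>\<xi>. expabs \<xi> * h \<xi>)"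
    by (rule rapid_fun_integrable[OF rapid_fun_mult[OF rapid_fun_expabs smooth_in_imp[OF smooth_h[OF wd]]]])
  have [measurable]: "(\<lambda>\<xi>. expabs \<xi> * h \<xi>) \<in> borel_measurable borel"
    using borel_measurable_integrable[OF ieh] by simp
  have Km [measurable]: "K \<in> borel_measurable borel"
    unfolding K_def by (intro borel_measurable_continuous_onI continuous_intros) (use lam_pos in auto)
  have Kb: "norm (K x) \<le> (pi / 2) / lam" for x
  proof -
    have "\<bar>arctan x\<bar> \<le> pi / 2" using arctan_bounded[of x] by linarith
    then have "\<bar>arctan x\<bar> / lam \<le> (pi / 2) / lam" by (rule divide_right_mono) (use lam_pos in simp)
    then show ?thesis
      unfolding K_def norm_of_real using lam_pos by (simp add: abs_divide)
  qed
  \<comment> \<open>Both sides have derivative \<open>1 / (1 + x\<^sup>2)\<close> and vanish at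
    0.\<close>
  have prim: "prim expabs x = of_real (arctan x)" for x
  proof -
    have "((\<lambda>x. prim expabs x - of_real (arctan x)) has_vector_derivative 0) (at x within UNIV)" for x
    proof -
      have "((\<lambda>x. complex_of_real (arctan x)) has_vector_derivative of_real (1 / (1 + x\<^sup>2))) (at x)"
        by (rule has_vector_derivative_of_real)
          (use DERIV_arctan[of x] in \<open>simp add: inverse_eq_divide has_real_derivative_iff_has_vector_derivative\<close>)
      from has_vector_derivative_diff[OF has_vector_derivative_prim[OF ie, of x] this]
      show ?thesis by (simp add: inv_fourier_expabs)
    qed
    then obtain k where "\<And>x. x \<in> UNIV \<Longrightarrow> prim expabs x - of_real (arctan x) = k"
      using has_vector_derivative_zero_constant[OF convex_UNIV] by metis
    from this[of x] this[of 0] show ?thesis by (simp add: prim_def ker_0)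
  qed
  have Ke: "K x = 0 - prim expabs x / of_real lam" for x
    by (simp add: K_def prim)
  let ?H = "\<lambda>x. inv_fourier (\<lambda>\<xi>. expabs \<xi> * h \<xi>) x + K x"
  define B where "B = (\<integral>\<xi>. norm (expabs \<xi> * h \<xi>) \<partial>lborel) / (2 * pi) + (pi / 2) / lam"
  have Hb: "norm (?H x) \<le> B" for x
    unfolding B_def by (rule norm_triangle_le) (intro add_mono norm_inv_fourier_le Kb)
  have Hm: "?H \<in> borel_measurable borel" by measurable
  have eq: "?q x = ?H x - P ?H x" for x
    using renewal_equation[OF wd ie ieh Km Kb Ke, of x] by (simp only: inv_fourier_expabs)
  have sum: "(\<Sum>n<N. Pn n ?q 0) = ?H 0 - Pn N ?H 0" for N
    by (rule sum_Pn_telescope[OF Hm Hb eq])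
  have int: "integrable (step_power n) (\<lambda>x. 1 / (1 + x\<^sup>2))" for n
  proof (rule integrable_step_power)
    show "norm (1 / (1 + x\<^sup>2)) \<le> 1" for x :: real
    proof -
      have "1 + x\<^sup>2 > 0" by (simp add: add_pos_nonneg)
      then show ?thesis by (simp add: pos_divide_le_eq)
    qed
  qed measurable
  let ?r = "\<lambda>n. \<integral>x. 1 / (1 + x\<^sup>2) \<partial>step_power n"
  \<comment> \<open>At the point 0 the sign in \<open>Pn\<close> is invisible, because the function
    is even.\<close>
  have Pnq: "Pn n ?q 0 = of_real (?r n)" for n
    by (simp only: Pn_def diff_0 power2_minus integral_complex_of_real)
  have r0: "?r n \<ge> 0" for n by (intro integral_nonneg_AE AE_I2) (simp add: add_nonneg_nonneg)
  have le: "(\<Sum>n<N. ?r n) \<le> 2 * B" for N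
  proof -
    have "(\<Sum>n<N. ?r n) = norm (\<Sum>n<N. Pn n ?q 0)"
      unfolding Pnq of_real_sum[symmetric] norm_of_real by (simp add: sum_nonneg r0)
    also have "\<dots> \<le> norm (?H 0) + norm (Pn N ?H 0)" unfolding sum by (rule norm_triangle_ineq4)
    also have "\<dots> \<le> B + B" by (intro add_mono Hb Pn_norm_le Hm)
    finally show ?thesis by simp
  qed
  have "(\<integral>\<^sup>+x. ennreal (1 / (1 + x\<^sup>2)) \<partial>green_kernel \<rho>) = (\<Sum>n. \<integral>\<^sup>+x. ennreal (1 / (1 + x\<^sup>2)) \<partial>step_power n)"
    by (rule nn_integral_green_kernel) measurable
  also have "\<dots> = (\<Sum>n. ennreal (?r n))"
    by (intro suminf_cong nn_integral_eq_integral int AE_I2) (simp add: add_nonneg_nonneg)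
  also have "\<dots> \<le> ennreal (2 * B)"
  proof (rule suminf_le_const)
    show "(\<Sum>n<N. ennreal (?r n)) \<le> ennreal (2 * B)" for N
      using le r0 by (subst sum_ennreal) (auto intro!: ennreal_leI)
  qed auto
  also have "\<dots> < \<infinity>" by simp
  finally show ?thesis
    by (intro integrableI_nonneg) (auto simp: add_nonneg_nonneg cong: measurable_cong_sets)
qed

end

text \<open>\<open>J\<close> is the antiderivative of \<open>- f\<close> normalised at plus
  infinity. The comparison with a primitive \<open>L\<close> comes from the fundamental theorem on
  \<open>{x..x'}\<close>, the limit from dominated convergence.\<close>

lemma tail_integral:
  fixes f L :: "real \<Rightarrow> complex"
  assumes f: "integrable lborel f" "continuous_on UNIV f"
    and L: "\<And>x. (L has_vector_derivative f x) (at x)"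
  defines "J \<equiv> \<lambda>x. (\<integral>t. indicator {x..} t *\<^sub>R f t \<partial>lborel)"
  shows "J x + L x = J 0 + L 0" and "norm (J x) \<le> (\<integral>t. norm (f t) \<partial>lborel)"
    and "(J \<longlongrightarrow> 0) at_top"
proof -
  have [measurable]: "f \<in> borel_measurable borel" using borel_measurable_integrable[OF f(1)] by simp
  have i: "integrable lborel (\<lambda>t. indicator {x..} t *\<^sub>R f t)" for x
    by (rule integrable_mult_indicator[OF _ f(1)]) simp
  have le: "J x + L x = J x' + L x'" if "x \<le> x'" for x x'
  proof -
    have "J x - J x' = (\<integral>t. indicator {x..} t *\<^sub>R f t - indicator {x'..} t *\<^sub>R f t \<partial>lborel)"
      unfolding J_def by (rule Bochner_Integration.integral_diff[symmetric, OF i i])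
    also have "\<dots> = (\<integral>t. indicator {x..x'} t *\<^sub>R f t \<partial>lborel)"
    proof (rule integral_cong_AE)
      show "AE t in lborel. indicator {x..} t *\<^sub>R f t - indicator {x'..} t *\<^sub>R f t = indicator {x..x'} t *\<^sub>R f t"
        using AE_lborel_singleton[of x'] by eventually_elim (use that in \<open>auto simp: indicator_def\<close>)
    qed measurable
    also have "\<dots> = L x' - L x"
      by (rule integral_FTC_Icc[OF that])
        (auto intro: has_vector_derivative_at_within L continuous_on_subset[OF f(2)])
    finally show ?thesis by (simp add: algebra_simps)
  qed
  show "J x + L x = J 0 + L 0"
    using le[of x 0] le[of 0 x] by (cases "x \<le> 0") auto
  show "norm (J x) \<le> (\<integral>t. norm (f t) \<partial>lborel)"
    unfolding J_def
    by (rule Bochner_Integration.integral_norm_bound_integral[OF i integrable_norm[OF f(1)]])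
      (simp add: indicator_def)
  have "(J \<longlongrightarrow> integral\<^sup>L lborel (\<lambda>t::real. 0)) at_top"
    unfolding J_def
  proof (rule integral_dominated_convergence_at_top[where w = "\<lambda>t. norm (f t)"])
    show "AE t in lborel. ((\<lambda>x. indicator {x..} t *\<^sub>R f t) \<longlongrightarrow> 0) at_top"
    proof (rule AE_I2, rule tendsto_eventually)
      fix t :: real
      show "\<forall>\<^sub>F x in at_top. indicator {x..} t *\<^sub>R f t = 0"
        using eventually_gt_at_top[of t] by eventually_elim simp
    qed
    show "\<forall>\<^sub>F x in at_top. AE t in lborel. norm (indicator {x..} t *\<^sub>R f t) \<le> norm (f t)"
      by (intro always_eventually allI AE_I2) (simp add: indicator_def)
  qed (use f in auto)
  then show "(J \<longlongrightarrow> 0) at_top" by simp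
qed

context drifted_walk
begin

section \<open>Convolution with the two kernels\<close>

definition T_conv :: "(real \<Rightarrow> complex) \<Rightarrow> real \<Rightarrow> complex" where
  "T_conv f x = (\<integral>y. f (x - y) \<partial>T_kernel lam)"

definition G_conv :: "(real \<Rightarrow> complex) \<Rightarrow> real \<Rightarrow> complex" where
  "G_conv f x = (\<integral>y. f (x - y) \<partial>green_kernel \<rho>)"

abbreviation "GmT \<equiv> measure_diff (green_kernel \<rho>) (T_kernel lam)"

lemma dist_convolution_GmT: "dist_convolution GmT f x = G_conv f x - T_conv f x"
  by (simp add: dist_convolution_def measure_diff_def G_conv_def T_conv_def)

lemma T_conv_eq:
  assumes f: "schwartz f"
  shows "T_conv f x = (1 / of_real lam) * (\<integral>t. indicator {x..} t *\<^sub>R f t \<partial>lborel)"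
proof -
  have "T_conv f x = (1 / lam) *\<^sub>R (\<integral>y. indicator {..0} y *\<^sub>R f (x - y) \<partial>lborel)"
    unfolding T_conv_def
    by (rule integrable_T_kernel(2)[OF lam_pos schwartz_integrable[OF schwartz_reflect[OF f]]])
  also have "(\<integral>y. indicator {..0} y *\<^sub>R f (x - y) \<partial>lborel) =
      (\<integral>y. indicator {x..} (x + (- 1) * y) *\<^sub>R f (x + (- 1) * y) \<partial>lborel)"
    by (intro Bochner_Integration.integral_cong refl) (auto simp: indicator_def)
  also have "\<dots> = (\<integral>t. indicator {x..} t *\<^sub>R f t \<partial>lborel)"
    using lborel_integral_real_affine[of "- 1" "\<lambda>t. indicator {x..} t *\<^sub>R f t" x] by simp
  finally show ?thesis by (simp add: scaleR_conv_of_real)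
qed

text \<open>\<open>L\<close> is kept arbitrary: it is \<open>prim (fourier f)\<close> when the
  renewal equation is solved, and a Schwartz function when \<open>f\<close> is given as a
  derivative.\<close>

lemma T_conv_prim:
  assumes f: "schwartz f" and L: "\<And>x. (L has_vector_derivative f x) (at x)"
  obtains k where "\<And>x. T_conv f x = k - L x / of_real lam"
proof
  let ?J = "\<lambda>x. (\<integral>t. indicator {x..} t *\<^sub>R f t \<partial>lborel)"
  fix x
  have "?J x = (?J 0 + L 0) - L x"
    using tail_integral(1)[OF schwartz_integrable[OF f] schwartz_continuous[OF f] L, of x]
    by (simp only: eq_diff_eq)
  then show "T_conv f x = (?J 0 + L 0) / of_real lam - L x / of_real lam"
    unfolding T_conv_eq[OF f] by (simp add: diff_divide_distrib add_divide_distrib)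
qed

lemma schwartz_prim:
  assumes f: "schwartz f"
  shows "(prim (fourier f) has_vector_derivative f x) (at x)"
  using has_vector_derivative_prim[OF schwartz_integrable[OF schwartz_fourier[OF f]]]
  by (simp add: inv_fourier_fourier[OF f])

lemma T_conv_tendsto_0:
  assumes f: "schwartz f"
  shows "(T_conv f \<longlongrightarrow> 0) at_top"
proof -
  have "((\<lambda>x. (1 / of_real lam) * (\<integral>t. indicator {x..} t *\<^sub>R f t \<partial>lborel)) \<longlongrightarrow> (1 / of_real lam) * 0) at_top"
    by (intro tendsto_mult tendsto_const
        tail_integral(3)[OF schwartz_integrable[OF f] schwartz_continuous[OF f] schwartz_prim[OF f]])
  then show ?thesis by (simp add: T_conv_eq[OF f, abs_def])
qed

lemma T_conv_bounded:
  assumes f: "schwartz f"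
  obtains C where "\<And>x. norm (T_conv f x) \<le> C"
proof
  show "norm (T_conv f x) \<le> (\<integral>t. norm (f t) \<partial>lborel) / lam" for x
  proof -
    have "norm (\<integral>t. indicator {x..} t *\<^sub>R f t \<partial>lborel) \<le> (\<integral>t. norm (f t) \<partial>lborel)"
      by (rule tail_integral(2)[OF schwartz_integrable[OF f] schwartz_continuous[OF f] schwartz_prim[OF f]])
    then show ?thesis
      unfolding T_conv_eq[OF f] using lam_pos by (simp add: norm_mult norm_divide divide_right_mono)
  qed
qed

lemma T_conv_measurable:
  assumes f: "schwartz f"
  shows "T_conv f \<in> borel_measurable borel"
proof -
  have c: "continuous_on UNIV (prim (fourier f))"
    using schwartz_prim[OF f] by (meson continuous_at_imp_continuous_on has_vector_derivative_continuous)
  obtain k where "\<And>x. T_conv f x = k - prim (fourier f) x / of_real lam"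
    using T_conv_prim[OF f schwartz_prim[OF f]] by metis
  then have "T_conv f = (\<lambda>x. k - prim (fourier f) x / of_real lam)" by (rule ext)
  moreover have "continuous_on UNIV (\<lambda>x. k - prim (fourier f) x / of_real lam)"
    using lam_pos by (intro continuous_intros c) auto
  ultimately show ?thesis by (metis borel_measurable_continuous_onI)
qed

lemma G_conv_sums:
  assumes "integrable (green_kernel \<rho>) (\<lambda>y. f (x - y))"
  shows "(\<lambda>n. Pn n f x) sums G_conv f x"
  unfolding Pn_def G_conv_def by (rule green_kernel_sums[OF assms])

lemma dist_convolution_GmT_eq:
  assumes wd: "weakly_diophantine \<rho>" and f: "schwartz f"
  shows "dist_convolution GmT f x = inv_fourier (\<lambda>\<xi>. fourier f \<xi> * h \<xi>) x"
proof -
  let ?F = "inv_fourier (\<lambda>\<xi>. fourier f \<xi> * h \<xi>)"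
  let ?H = "\<lambda>x. ?F x + T_conv f x"
  have sf: "schwartz (fourier f)" by (rule schwartz_fourier[OF f])
  have sfh: "schwartz (\<lambda>\<xi>. fourier f \<xi> * h \<xi>)" by (rule schwartz_mult[OF sf smooth_h[OF wd]])
  have sF: "schwartz ?F" by (rule schwartz_inv_fourier[OF sfh])
  note [measurable] = schwartz_borel[OF sF] T_conv_measurable[OF f]
  obtain k where k: "\<And>x. T_conv f x = k - prim (fourier f) x / of_real lam"
    using T_conv_prim[OF f schwartz_prim[OF f]] by metis
  obtain C where C: "\<And>x. norm (T_conv f x) \<le> C" using T_conv_bounded[OF f] by metis
  obtain D where D: "\<And>x. norm (?F x) \<le> D"
    using rapid_fun_imp_bdd[OF schwartz_rapid[OF sF]] unfolding bdd_fun_def by blast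
  have Hb: "norm (?H x) \<le> D + C" for x
    by (rule norm_triangle_le) (intro add_mono C D)
  have Hm: "?H \<in> borel_measurable borel" by measurable
  have eq: "f x = ?H x - P ?H x" for x
    using renewal_equation[OF wd schwartz_integrable[OF sf] schwartz_integrable[OF sfh]
        T_conv_measurable[OF f] C k, of x] by (simp only: inv_fourier_fourier[OF f])
  have Hlim: "(?H \<longlongrightarrow> 0) at_top"
    using tendsto_add[OF rapid_fun_tendsto_0(1)[OF schwartz_rapid[OF sF]] T_conv_tendsto_0[OF f]] by simp
  have "integrable (green_kernel \<rho>) (\<lambda>y. f (x - y))"
    by (rule schwartz_integrable_measure(1)[OF integrable_green_kernel[OF wd] sets_green_kernel schwartz_reflect[OF f]])
  from G_conv_sums[OF this] have "(\<lambda>N. \<Sum>n<N. Pn n f x) \<longlonglongrightarrow> G_conv f x"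
    by (simp add: sums_def)
  moreover have "(\<lambda>N. \<Sum>n<N. Pn n f x) \<longlonglongrightarrow> ?H x - 0"
    unfolding sum_Pn_telescope[OF Hm Hb eq]
    by (intro tendsto_diff tendsto_const Pn_tendsto_0[OF Hm Hb Hlim])
  ultimately have "G_conv f x = ?H x" using LIMSEQ_unique by fastforce
  then show ?thesis by (simp add: dist_convolution_GmT)
qed

lemma integrable_T_kernel_square: "integrable (T_kernel lam) (\<lambda>x. 1 / (1 + x\<^sup>2))"
  by (rule integrable_T_kernel(1)[OF lam_pos integrable_inverse_1_plus_square])

lemma fast_decrease_GmT:
  assumes wd: "weakly_diophantine \<rho>"
  shows "fast_decrease GmT"
proof -
  have "schwartz (dist_convolution GmT f)" if f: "schwartz f" for f
  proof -
    have "schwartz (inv_fourier (\<lambda>\<xi>. fourier f \<xi> * h \<xi>))"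
      by (rule schwartz_inv_fourier[OF schwartz_mult[OF schwartz_fourier[OF f] smooth_h[OF wd]]])
    moreover have "dist_convolution GmT f = inv_fourier (\<lambda>\<xi>. fourier f \<xi> * h \<xi>)"
      by (rule ext) (rule dist_convolution_GmT_eq[OF wd f])
    ultimately show ?thesis by simp
  qed
  moreover have "tempered_distribution GmT"
    by (rule tempered_measure_diff[OF integrable_green_kernel[OF wd] sets_green_kernel
        integrable_T_kernel_square sets_T_kernel])
  ultimately show ?thesis unfolding fast_decrease_def by blast
qed

lemma has_dist_fourier_GmT:
  assumes wd: "weakly_diophantine \<rho>"
  shows "has_dist_fourier GmT h"
  unfolding has_dist_fourier_iff
proof (intro conjI allI impI)
  show "continuous_on UNIV h" by (rule polybdd_fun_cont[OF smooth_in_imp[OF smooth_h[OF wd]]])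
  fix f x assume f: "schwartz f"
  have "schwartz (\<lambda>\<xi>. (fourier f \<xi> * h \<xi>) * cis (\<xi> * x))"
    by (intro schwartz_mult schwartz_fourier f smooth_h wd smooth_bdd_imp_polybdd smooth_cis)
  from schwartz_integrable[OF this]
  show "integrable lborel (\<lambda>\<xi>. cis (\<xi> * x) * (fourier f \<xi> * h \<xi>))" by (simp add: mult.commute)
  show "dist_convolution GmT f x = inv_fourier (\<lambda>\<xi>. fourier f \<xi> * h \<xi>) x"
    by (rule dist_convolution_GmT_eq[OF wd f])
qed

lemma dist_fourier_GmT:
  assumes "weakly_diophantine \<rho>"
  shows "dist_fourier GmT = h"
  unfolding dist_fourier_def
proof (rule the_equality)
  show "has_dist_fourier GmT h" by (rule has_dist_fourier_GmT[OF assms])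
  then show "h' = h" if "has_dist_fourier GmT h'" for h'
    using that by (rule has_dist_fourier_unique[rotated])
qed

section \<open>Walks that are not weakly diophantine\<close>

text \<open>Translation invariance makes the L1 norm of \<open>f (x + y)\<close> in \<open>x\<close>
  independent of \<open>y\<close>; as \<open>\<rho>\<close> is a probability, the double integral
  converges absolutely.\<close>

lemma fourier_P:
  assumes f: "integrable lborel f"
  shows "fourier (P f) \<xi> = a \<xi> * fourier f \<xi>" and "integrable lborel (P f)"
proof -
  have [measurable]: "f \<in> borel_measurable borel" using borel_measurable_integrable[OF f] by simp
  have i: "integrable lborel (\<lambda>x. f (x + y))" for y
    using lborel_integrable_real_affine[OF f, of 1 y] by (simp add: add.commute)
  have n: "(\<integral>x. norm (f (x + y) * cis (\<xi> * - x)) \<partial>lborel) = (\<integral>x. norm (f x) \<partial>lborel)" for y \<xi>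
    using lborel_integral_real_affine[of 1 "\<lambda>x. norm (f x)" y] by (simp add: norm_mult add.commute)
  have 1: "case_prod (\<lambda>y x. f (x + y) * cis (\<xi> * - x)) \<in> borel_measurable (\<rho> \<Otimes>\<^sub>M lborel)" for \<xi>
    by measurable
  have 2: "integrable lborel (\<lambda>x. f (x + y) * cis (\<xi> * - x))" for \<xi> y
    by (rule Bochner_Integration.integrable_bound[OF i[of y]]) (auto simp: norm_mult)
  have 3: "integrable \<rho> (\<lambda>y. \<integral>x. norm (f (x + y) * cis (\<xi> * - x)) \<partial>lborel)" for \<xi>
    unfolding n by simp
  note F = Fubini_iterated[OF sigma_finite_measure lborel.sigma_finite_measure_axioms 1 2 3]
  \<comment> \<open>At frequency 0 the phase is 1, so the integrability part of Fubini's theorem is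
    integrability of \<open>P f\<close>.\<close>
  show "integrable lborel (P f)"
    using F(3)[of 0] by (simp add: P_def[abs_def])
  have "fourier (P f) \<xi> = (\<integral>x. \<integral>y. f (x + y) * cis (\<xi> * - x) \<partial>\<rho> \<partial>lborel)"
    unfolding fourier_eq P_def by simp
  also have "\<dots> = (\<integral>y. \<integral>x. f (x + y) * cis (\<xi> * - x) \<partial>lborel \<partial>\<rho>)"
    by (rule F(1)[symmetric])
  also have "\<dots> = (\<integral>y. cis (\<xi> * y) * fourier f \<xi> \<partial>\<rho>)"
    using fourier_shift[of f _ \<xi>] by (simp add: fourier_eq add.commute)
  also have "\<dots> = a \<xi> * fourier f \<xi>" unfolding a_def by simp
  finally show "fourier (P f) \<xi> = a \<xi> * fourier f \<xi>" .
qed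

text \<open>The limit has to pass under \<open>P\<close>, which requires a bound on the partial sums
  uniform in \<open>N\<close> and in the starting point. The majorant \<open>w\<close> provides it:
  the absolute series is at most \<open>Re (G_conv w x)\<close>, and \<open>G_conv w\<close> is
  bounded as the sum of a Schwartz function and the bounded \<open>T_conv w\<close>.\<close>

lemma G_conv_P:
  assumes int: "\<And>f. schwartz f \<Longrightarrow> integrable (green_kernel \<rho>) f"
    and fd: "\<And>f. schwartz f \<Longrightarrow> schwartz (dist_convolution GmT f)"
    and f: "schwartz f" and w: "schwartz w" and le: "\<And>x. norm (f x) \<le> Re (w x)"
  shows "f x = G_conv f x - P (G_conv f) x"
proof -
  note [measurable] = schwartz_borel[OF f] schwartz_borel[OF w]
  have bdd: "\<exists>C. \<forall>x. norm (u x) \<le> C" if "schwartz u" for u :: "real \<Rightarrow> complex"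
    using rapid_fun_imp_bdd[OF schwartz_rapid[OF that]] unfolding bdd_fun_def by blast
  obtain Cf where Cf: "\<And>x. norm (f x) \<le> Cf" using bdd[OF f] by blast
  obtain Cw where Cw: "\<And>x. norm (w x) \<le> Cw" using bdd[OF w] by blast
  obtain B1 where B1: "\<And>x. norm (T_conv w x) \<le> B1" using T_conv_bounded[OF w] by metis
  obtain B2 where B2: "\<And>x. norm (dist_convolution GmT w x) \<le> B2" using bdd[OF fd[OF w]] by blast
  have B: "norm (G_conv w x) \<le> B2 + B1" for x
  proof -
    have "G_conv w x = dist_convolution GmT w x + T_conv w x" by (simp add: dist_convolution_GmT)
    then show ?thesis using norm_triangle_le[OF add_mono[OF B2[of x] B1[of x]]] by simp
  qed
  have sums: "(\<lambda>n. Pn n u x) sums G_conv u x" if "schwartz u" for u x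
    by (rule G_conv_sums[OF int[OF schwartz_reflect[OF that]]])
  define S where "S N x = (\<Sum>n<N. Pn n f x)" for N x
  have Sm [measurable]: "S N \<in> borel_measurable borel" for N
    unfolding S_def[abs_def] using Pn_measurable[of f] by measurable
  have Slim: "(\<lambda>N. S N x) \<longlonglongrightarrow> G_conv f x" for x
    using sums[OF f] unfolding S_def sums_def .
  have Sb: "norm (S N x) \<le> B2 + B1" for N x
  proof -
    have rw: "norm (Pn n f x) \<le> Re (Pn n w x)" for n x
    proof -
      note [measurable_cong] = sets_conv_power
      have iw: "integrable (step_power n) (\<lambda>y. w (x - y))"
        by (rule integrable_step_power[of _ Cw]) (use Cw in auto)
      have "norm (Pn n f x) \<le> (\<integral>y. Re (w (x - y)) \<partial>step_power n)"
        unfolding Pn_def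
        by (rule Bochner_Integration.integral_norm_bound_integral)
          (use le iw in \<open>auto intro: integrable_step_power[of _ Cf] Cf\<close>)
      also have "\<dots> = Re (Pn n w x)" unfolding Pn_def using iw by simp
      finally show ?thesis .
    qed
    have r0: "0 \<le> Re (Pn n w x)" for n using order_trans[OF norm_ge_zero rw] .
    have s: "(\<lambda>n. Re (Pn n w x)) sums Re (G_conv w x)" using sums[OF w, of x] by (rule sums_Re)
    have "norm (S N x) \<le> (\<Sum>n<N. norm (Pn n f x))" unfolding S_def by (rule norm_sum)
    also have "\<dots> \<le> (\<Sum>n<N. Re (Pn n w x))" by (intro sum_mono rw)
    also have "\<dots> \<le> (\<Sum>n. Re (Pn n w x))"
      using sums_summable[OF s] r0 by (intro sum_le_suminf) auto
    also have "\<dots> = Re (G_conv w x)" using sums_unique[OF s] by simp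
    also have "\<dots> \<le> B2 + B1" using complex_Re_le_cmod B order_trans by blast
    finally show ?thesis .
  qed
  have Gm: "G_conv f \<in> borel_measurable borel"
    by (rule borel_measurable_LIMSEQ_metric[OF Sm Slim])
  have "(\<lambda>N. P (S N) x) \<longlonglongrightarrow> P (G_conv f) x"
    unfolding P_def
  proof (rule integral_dominated_convergence[where w = "\<lambda>_. B2 + B1"])
    show "(\<lambda>y. G_conv f (x + y)) \<in> borel_measurable \<rho>" using Gm by measurable
  qed (use Sb Slim in auto)
  \<comment> \<open>Applying \<open>P\<close> shifts the sum by one index, so the initial term
    \<open>f x\<close> has to be removed.\<close>
  moreover have "P (S N) x = S (Suc N) x - f x" for N
  proof -
    have "P (S N) x = (\<Sum>n<N. P (Pn n f) x)"
      unfolding P_def S_def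
    proof (rule Bochner_Integration.integral_sum)
      fix n
      note [measurable] = Pn_measurable[of f n]
      show "integrable \<rho> (\<lambda>y. Pn n f (x + y))"
        by (rule integrable_const_bound[of _ Cf]) (use Pn_norm_le[of f Cf] Cf in auto)
    qed
    also have "\<dots> = (\<Sum>n<N. Pn (Suc n) f x)"
      using Pn_Suc(1)[of f Cf] Cf by simp
    also have "\<dots> = S (Suc N) x - f x"
      unfolding S_def sum.lessThan_Suc_shift by (simp add: Pn_0)
    finally show ?thesis .
  qed
  ultimately have "(\<lambda>N. S (Suc N) x - f x) \<longlonglongrightarrow> P (G_conv f) x" by simp
  moreover have "(\<lambda>N. S (Suc N) x - f x) \<longlonglongrightarrow> G_conv f x - f x"
    by (intro tendsto_diff tendsto_const LIMSEQ_Suc Slim)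
  ultimately have "P (G_conv f) x = G_conv f x - f x" by (rule LIMSEQ_unique)
  then show ?thesis by simp
qed

text \<open>Testing on derivatives keeps \<open>T_conv\<close> inside the Schwartz space.\<close>

lemma fourier_le_u:
  assumes int: "\<And>f. schwartz f \<Longrightarrow> integrable (green_kernel \<rho>) f"
    and fd: "\<And>f. schwartz f \<Longrightarrow> schwartz (dist_convolution GmT f)"
    and \<phi>: "schwartz \<phi>" and d: "\<And>x. (\<phi> has_vector_derivative \<phi>' x) (at x)"
    and w: "schwartz w" and le: "\<And>x. norm (\<phi>' x) \<le> Re (w x)"
  obtains C where "\<And>\<xi>. \<bar>\<xi>\<bar> * norm (fourier \<phi> \<xi>) \<le> C * norm (1 - a \<xi>)"
proof -
  have \<phi>': "schwartz \<phi>'"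
    using smooth_in_deriv'[of rapid_fun \<phi> \<phi>'] \<phi> d unfolding schwartz_iff by blast
  obtain k where k: "\<And>x. T_conv \<phi>' x = k - \<phi> x / of_real lam"
    using T_conv_prim[OF \<phi>' d] by metis
  \<comment> \<open>Both \<open>T_conv \<phi>'\<close> and \<open>\<phi>\<close> vanish at plus
    infinity, so no constant remains.\<close>
  have "k = 0"
  proof -
    have "((\<lambda>x. k - \<phi> x / of_real lam) \<longlongrightarrow> k - 0 / of_real lam) at_top"
      using lam_pos by (intro tendsto_diff tendsto_const tendsto_divide rapid_fun_tendsto_0 schwartz_rapid \<phi>) auto
    then have "(T_conv \<phi>' \<longlongrightarrow> k) at_top" by (simp add: k[abs_def])
    from tendsto_unique[OF _ this T_conv_tendsto_0[OF \<phi>']] show ?thesis by simp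
  qed
  then have T: "T_conv \<phi>' x = - 1 / of_real lam * \<phi> x" for x using k by simp
  have "G_conv \<phi>' = (\<lambda>x. dist_convolution GmT \<phi>' x + (- 1 / of_real lam) * \<phi> x)"
    by (rule ext) (simp add: dist_convolution_GmT T)
  then have G: "schwartz (G_conv \<phi>')"
    by (simp only:) (intro schwartz_add fd \<phi>' schwartz_cmult \<phi>)
  note i = schwartz_integrable[OF G]
  have eq: "\<phi>' = (\<lambda>x. G_conv \<phi>' x - P (G_conv \<phi>') x)"
    by (rule ext) (rule G_conv_P[OF int fd \<phi>' w le])
  \<comment> \<open>Transform of the renewal equation for \<open>\<phi>'\<close>. The constant
    \<open>C\<close> of the conclusion will be the L1 norm of \<open>G_conv \<phi>'\<close>.\<close>
  have F: "\<i> * of_real \<xi> * fourier \<phi> \<xi> = (1 - a \<xi>) * fourier (G_conv \<phi>') \<xi>" for \<xi>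
  proof -
    have ic: "integrable lborel (\<lambda>x. u x * cis (\<xi> * - x))" if u: "integrable lborel u" for u
    proof -
      have [measurable]: "u \<in> borel_measurable borel" using borel_measurable_integrable[OF u] by simp
      show ?thesis by (rule Bochner_Integration.integrable_bound[OF u]) (auto simp: norm_mult)
    qed
    have "\<i> * of_real \<xi> * fourier \<phi> \<xi> = fourier (\<lambda>x. G_conv \<phi>' x - P (G_conv \<phi>') x) \<xi>"
      unfolding fourier_deriv[OF \<phi> d, symmetric] by (subst eq) (rule refl)
    also have "\<dots> = fourier (G_conv \<phi>') \<xi> - fourier (P (G_conv \<phi>')) \<xi>"
      unfolding fourier_eq left_diff_distrib
      by (rule Bochner_Integration.integral_diff[OF ic[OF i] ic[OF fourier_P(2)[OF i]]])
    finally show ?thesis by (simp add: fourier_P(1)[OF i] algebra_simps)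
  qed
  show thesis
  proof (rule that)
    fix \<xi>
    have "\<bar>\<xi>\<bar> * norm (fourier \<phi> \<xi>) = norm (fourier (G_conv \<phi>') \<xi>) * norm (1 - a \<xi>)"
      using arg_cong[OF F[of \<xi>], of norm] by (simp add: norm_mult mult.commute)
    also have "\<dots> \<le> (\<integral>x. norm (G_conv \<phi>' x) \<partial>lborel) * norm (1 - a \<xi>)"
      by (intro mult_right_mono norm_fourier_le) auto
    finally show "\<bar>\<xi>\<bar> * norm (fourier \<phi> \<xi>) \<le> (\<integral>x. norm (G_conv \<phi>' x) \<partial>lborel) * norm (1 - a \<xi>)" .
  qed
qed

text \<open>Failure at every exponent is used at \<open>l = 2 * j\<close>: if no such frequency
  existed, the lower limit would be at least 1. The bound \<open>j + 2\<close> makes the frequencies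
  at least 2 and lets them outgrow any constant.\<close>

lemma not_weakly_diophantine_sequence:
  assumes "\<not> weakly_diophantine \<rho>"
  obtains \<xi> :: "nat \<Rightarrow> real" where "\<And>j. \<bar>\<xi> j\<bar> \<ge> real j + 2" "\<And>j. \<bar>\<xi> j\<bar> ^ (2 * j) * norm (1 - a (\<xi> j)) < 1"
proof -
  have "\<exists>\<xi>. \<bar>\<xi>\<bar> \<ge> real j + 2 \<and> \<bar>\<xi>\<bar> ^ (2 * j) * norm (1 - a \<xi>) < 1" for j :: nat
  proof (rule ccontr)
    assume "\<nexists>\<xi>. \<bar>\<xi>\<bar> \<ge> real j + 2 \<and> \<bar>\<xi>\<bar> ^ (2 * j) * norm (1 - a \<xi>) < 1"
    then have N: "\<bar>\<xi>\<bar> ^ (2 * j) * norm (1 - a \<xi>) \<ge> 1" if "\<bar>\<xi>\<bar> \<ge> real j + 2" for \<xi>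
      using that by (meson not_less)
    let ?f = "\<lambda>b. ereal (\<bar>b\<bar> powr real (2 * j) * norm (1 - laplace \<rho> (\<i> * of_real b)))"
    have "\<forall>\<^sub>F b in at_infinity. 1 \<le> ?f b"
      unfolding eventually_at_infinity
    proof (intro exI[of _ "real j + 2"] allI impI)
      fix b :: real assume b: "norm b \<ge> real j + 2"
      then have "\<bar>b\<bar> powr real (2 * j) = \<bar>b\<bar> ^ (2 * j)" by (intro powr_realpow) auto
      moreover have "laplace \<rho> (\<i> * of_real b) = a (- b)" using laplace_eq_a[of "- b"] by simp
      ultimately show "1 \<le> ?f b"
        using N[of "- b"] b by simp
    qed
    then have "1 \<le> Liminf at_infinity ?f"
      by (rule Liminf_bounded)
    then have "l_weakly_diophantine (real (2 * j)) \<rho>"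
      unfolding l_weakly_diophantine_def by (rule less_le_trans[rotated]) simp
    with assms show False unfolding weakly_diophantine_def by (meson of_nat_0_le_iff)
  qed
  then show thesis using that by metis
qed

text \<open>The frequencies \<open>\<xi> j\<close> carry weights \<open>\<bar>\<xi> j\<bar>\<^sup>-\<^sup>j\<close>: light enough for the superposition to be
  smooth, too heavy for \<open>1 / (1 - a (\<xi> j)) \<ge> \<bar>\<xi> j\<bar>\<^sup>2\<^sup>j\<close>.\<close>

lemma weakly_diophantine_if_fast_decrease:
  assumes int: "\<And>f. schwartz f \<Longrightarrow> integrable (green_kernel \<rho>) f"
    and fd: "\<And>f. schwartz f \<Longrightarrow> schwartz (dist_convolution GmT f)"
  shows "weakly_diophantine \<rho>"
proof (rule ccontr)
  assume "\<not> weakly_diophantine \<rho>"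
  then obtain \<xi> :: "nat \<Rightarrow> real" where \<xi>: "\<And>j. \<bar>\<xi> j\<bar> \<ge> real j + 2"
    "\<And>j. \<bar>\<xi> j\<bar> ^ (2 * j) * norm (1 - a (\<xi> j)) < 1"
    using not_weakly_diophantine_sequence by metis
  let ?N = "count_space (UNIV :: nat set)"
  define v where "v j = 1 / \<bar>\<xi> j\<bar> ^ j" for j
  have x2: "2 \<le> \<bar>\<xi> j\<bar>" for j using \<xi>(1)[of j] by linarith
  have v0: "v j > 0" for j using x2[of j] unfolding v_def by (intro divide_pos_pos zero_less_power) auto
  \<comment> \<open>For \<open>j \<ge> n\<close> the term is \<open>1 / |\<xi> j| ^ (j - n)\<close>,
    and \<open>|\<xi> j| \<ge> 2\<close> gives a geometric majorant. All moments of the weights are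
    thus finite, which makes \<open>m\<close> smooth.\<close>
  have summ: "summable (\<lambda>j. v j * \<bar>\<xi> j\<bar> ^ n)" for n
  proof (rule summable_comparison_test'[where g = "\<lambda>j. 2 ^ n * (1 / 2) ^ j" and N = n])
    show "summable (\<lambda>j. 2 ^ n * (1 / 2 :: real) ^ j)"
      by (intro summable_mult summable_geometric) auto
    fix j assume j: "n \<le> j"
    have p: "\<bar>\<xi> j\<bar> ^ j = \<bar>\<xi> j\<bar> ^ n * \<bar>\<xi> j\<bar> ^ (j - n)" using j by (simp flip: power_add)
    have "v j * \<bar>\<xi> j\<bar> ^ n = 1 / \<bar>\<xi> j\<bar> ^ (j - n)"
      unfolding v_def p using x2[of j] by simp
    also have "\<dots> \<le> 1 / 2 ^ (j - n)"
      using x2[of j] by (intro divide_left_mono power_mono mult_pos_pos zero_less_power) auto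
    also have "\<dots> = 2 ^ n * (1 / 2) ^ j"
      using j by (simp add: power_diff power_one_over)
    finally show "norm (v j * \<bar>\<xi> j\<bar> ^ n) \<le> 2 ^ n * (1 / 2) ^ j"
      using v0[of j] by simp
  qed
  have ints: "integrable ?N (\<lambda>j. norm (complex_of_real (v j)) * \<bar>\<xi> j\<bar> ^ n)" for n
    using summ[of n] v0 by (simp add: integrable_count_space_nat_iff abs_mult less_imp_le)
  \<comment> \<open>The superposition of the bad frequencies, written as a weighted characteristic
    function over counting measure.\<close>
  define m where "m x = (\<integral>j. of_real (v j) * cis (x * \<xi> j) \<partial>?N)" for x
  have sm: "smooth_in bdd_fun m"
    unfolding m_def[abs_def] by (rule smooth_weighted_char(2)) (use ints in auto)
  obtain m' where m': "\<And>x. (m has_vector_derivative m' x) (at x)" "smooth_in bdd_fun m'"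
    using smooth_in_deriv[OF sm] by blast
  obtain M0 where M0: "\<And>x. norm (m x) \<le> M0" using smooth_in_imp[OF sm] unfolding bdd_fun_def by blast
  obtain M1 where M1: "\<And>x. norm (m' x) \<le> M1" using smooth_in_imp[OF m'(2)] unfolding bdd_fun_def by blast
  have M0': "M0 \<ge> 0" and M1': "M1 \<ge> 0"
    using order_trans[OF norm_ge_zero M0[of 0]] order_trans[OF norm_ge_zero M1[of 0]] by auto
  define \<phi> where "\<phi> x = gauss x * m x" for x
  define \<phi>' where "\<phi>' x = gauss x * m' x + gauss x * (- 1 * of_real x) * m x" for x
  \<comment> \<open>A nonnegative Schwartz majorant of \<open>\<phi>'\<close>, from
    \<open>|\<phi>' x| \<le> gauss x * (M1 + |x| * M0)\<close> and
    \<open>|x| \<le> 1 + x\<^sup>2\<close>.\<close>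
  define w where "w x = of_real (M0 + M1) * (gauss x * (1 + of_real x * of_real x))" for x
  have s\<phi>: "schwartz \<phi>"
    unfolding \<phi>_def[abs_def] by (intro schwartz_mult schwartz_gauss smooth_bdd_imp_polybdd sm)
  have d\<phi>: "(\<phi> has_vector_derivative \<phi>' x) (at x)" for x
    unfolding \<phi>_def[abs_def] \<phi>'_def by (intro has_vector_derivative_mult m' has_vector_derivative_gauss)
  have sw: "schwartz w"
  proof -
    have "schwartz (\<lambda>x. of_real (M0 + M1) * (gauss x + (gauss x * of_real x) * of_real x))"
      by (intro schwartz_cmult schwartz_add schwartz_mult schwartz_gauss smooth_polybdd_ident)
    then show ?thesis unfolding w_def[abs_def] by (simp add: distrib_left mult.assoc)
  qed
  have le: "norm (\<phi>' x) \<le> Re (w x)" for x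
  proof -
    have "0 \<le> (\<bar>x\<bar> - 1)\<^sup>2" "0 \<le> x\<^sup>2" by simp_all
    then have x1: "\<bar>x\<bar> \<le> 1 + x * x" by (simp add: power2_eq_square algebra_simps)
    have "norm (\<phi>' x) \<le> norm (gauss x) * M1 + norm (gauss x) * \<bar>x\<bar> * M0"
      unfolding \<phi>'_def
      by (rule norm_triangle_le) (auto simp: norm_mult intro!: add_mono mult_left_mono M0 M1)
    also have "\<dots> \<le> norm (gauss x) * M1 * (1 + x * x) + norm (gauss x) * (1 + x * x) * M0"
    proof (intro add_mono mult_right_mono mult_left_mono x1 norm_ge_zero M0')
      have "norm (gauss x) * M1 * 1 \<le> norm (gauss x) * M1 * (1 + x * x)"
        by (rule mult_left_mono) (use M1' in auto)
      then show "norm (gauss x) * M1 \<le> norm (gauss x) * M1 * (1 + x * x)" by (simp only: mult_1_right)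
    qed
    also have "\<dots> = Re (w x)"
      unfolding w_def gauss_def by (simp add: algebra_simps)
    finally show ?thesis .
  qed
  obtain C where C: "\<And>\<xi>. \<bar>\<xi>\<bar> * norm (fourier \<phi> \<xi>) \<le> C * norm (1 - a \<xi>)"
    using fourier_le_u[OF int fd s\<phi> d\<phi> sw le] by metis
  \<comment> \<open>The transform at \<open>\<xi> j\<close> is a sum of Gaussian bumps with positive
    weights, so nothing cancels and the term \<open>k = j\<close> alone bounds it from below; its
    factor \<open>sqrt (2 * pi)\<close> is at least 1.\<close>
  have F: "v j \<le> norm (fourier \<phi> (\<xi> j))" for j
  proof -
    define r where "r k = v k * (sqrt (2 * pi) * exp (- ((\<xi> k - \<xi> j)\<^sup>2 / 2)))" for k
    have "fourier \<phi> (\<xi> j) = (\<integral>x. \<integral>k. gauss x * (of_real (v k) * cis (x * \<xi> k)) * cis (\<xi> j * - x) \<partial>?N \<partial>lborel)"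
      unfolding fourier_eq \<phi>_def m_def by simp
    also have "\<dots> = (\<integral>k. \<integral>x. gauss x * (of_real (v k) * cis (x * \<xi> k)) * cis (\<xi> j * - x) \<partial>lborel \<partial>?N)"
    proof (rule Fubini_dominated(1)[where p = "\<lambda>x. norm (gauss x)" and q = v])
      show "sigma_finite_measure (lborel :: real measure)" by (rule lborel.sigma_finite_measure_axioms)
      show "sigma_finite_measure ?N" by (rule sigma_finite_measure_count_space)
      show "integrable lborel (\<lambda>x. norm (gauss x))" by (intro integrable_norm schwartz_integrable schwartz_gauss)
      show "integrable ?N v" using ints[of 0] v0 by (simp add: less_imp_le)
      have [measurable]: "gauss \<in> borel_measurable borel" by (rule schwartz_borel[OF schwartz_gauss])
      show "(\<lambda>(x, k). gauss x * (of_real (v k) * cis (x * \<xi> k)) * cis (\<xi> j * - x)) \<in> borel_measurable (lborel \<Otimes>\<^sub>M ?N)"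
        by measurable
    qed (use v0 in \<open>auto simp: norm_mult less_imp_le\<close>)
    also have "\<dots> = (\<integral>k. of_real (r k) \<partial>?N)"
    proof (intro Bochner_Integration.integral_cong refl)
      fix k
      have "(\<integral>x. gauss x * (of_real (v k) * cis (x * \<xi> k)) * cis (\<xi> j * - x) \<partial>lborel) =
          (\<integral>x. of_real (v k) * (gauss x * cis ((\<xi> k - \<xi> j) * x)) \<partial>lborel)"
      proof (intro Bochner_Integration.integral_cong refl)
        fix x
        have "cis ((\<xi> k - \<xi> j) * x) = cis (x * \<xi> k) * cis (\<xi> j * - x)"
          unfolding cis_mult by (simp add: algebra_simps)
        then show "gauss x * (of_real (v k) * cis (x * \<xi> k)) * cis (\<xi> j * - x) =
            of_real (v k) * (gauss x * cis ((\<xi> k - \<xi> j) * x))" by simp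
      qed
      also have "\<dots> = of_real (v k) * (of_real (sqrt (2 * pi)) * gauss (\<xi> k - \<xi> j))"
        by (simp only: integral_mult_right_zero integral_gauss_cis)
      finally show "(\<integral>x. gauss x * (of_real (v k) * cis (x * \<xi> k)) * cis (\<xi> j * - x) \<partial>lborel) = of_real (r k)"
        by (simp only: r_def gauss_def of_real_mult)
    qed
    also have "\<dots> = of_real (\<integral>k. r k \<partial>?N)" by simp
    finally have n: "norm (fourier \<phi> (\<xi> j)) = \<bar>\<integral>k. r k \<partial>?N\<bar>" by simp
    have r0: "0 \<le> r k" for k using v0[of k] by (simp add: r_def)
    have ir: "integrable ?N r"
    proof (rule Bochner_Integration.integrable_bound)
      show "integrable ?N (\<lambda>k. sqrt (2 * pi) * v k)"
        using ints[of 0] v0 by (intro integrable_mult_right) (simp add: less_imp_le)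
      have "r k \<le> v k * (sqrt (2 * pi) * 1)" for k
        unfolding r_def using v0[of k] by (intro mult_left_mono) auto
      then show "AE k in ?N. norm (r k) \<le> norm (sqrt (2 * pi) * v k)"
        using r0 v0 by (intro AE_I2) (simp add: abs_mult mult.commute less_imp_le)
    qed simp
    have "v j * 1 \<le> v j * sqrt (2 * pi)"
      using v0[of j] pi_gt3 by (intro mult_left_mono) (auto simp: real_le_rsqrt)
    also have "\<dots> = (\<Sum>k\<in>{j}. r k)" by (simp add: r_def)
    also have "\<dots> \<le> (\<Sum>k. r k)"
      using ir r0 by (intro sum_le_suminf) (auto simp: integrable_count_space_nat_iff)
    also have "\<dots> = (\<integral>k. r k \<partial>?N)" by (rule integral_count_space_nat[OF ir, symmetric])
    finally show ?thesis unfolding n by simp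
  qed
  \<comment> \<open>At this index the estimates give \<open>|\<xi> j| ^ (j + 1) \<le> |C|\<close>,
    while \<open>|\<xi> j| \<ge> j + 2 > |C|\<close>.\<close>
  obtain j where j: "\<bar>C\<bar> \<le> real j" using real_arch_simple by blast
  let ?x = "\<bar>\<xi> j\<bar>"
  have xp: "?x ^ j \<ge> 1" using x2[of j] by (intro one_le_power) auto
  have "?x * v j \<le> ?x * norm (fourier \<phi> (\<xi> j))" by (intro mult_left_mono F) auto
  also have "\<dots> \<le> C * norm (1 - a (\<xi> j))" by (rule C)
  also have "\<dots> \<le> \<bar>C\<bar> * norm (1 - a (\<xi> j))" by (intro mult_right_mono) auto
  finally have "?x * v j * ?x ^ (2 * j) \<le> \<bar>C\<bar> * norm (1 - a (\<xi> j)) * ?x ^ (2 * j)"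
    by (intro mult_right_mono) auto
  also have "\<dots> = \<bar>C\<bar> * (?x ^ (2 * j) * norm (1 - a (\<xi> j)))" by (simp only: mult_ac)
  also have "\<dots> \<le> \<bar>C\<bar> * 1" using \<xi>(2)[of j] by (intro mult_left_mono) auto
  also have "?x * v j * ?x ^ (2 * j) = ?x * ?x ^ j"
    using x2[of j] by (simp add: v_def mult_2 power_add)
  finally have "?x * ?x ^ j \<le> \<bar>C\<bar>" by simp
  moreover have "?x * 1 \<le> ?x * ?x ^ j" using xp by (intro mult_left_mono) auto
  ultimately show False using \<xi>(1)[of j] j by linarith
qed

end

text \<open>Integrability accompanies fast decrease because \<open>measure_diff\<close> subtracts
  Bochner integrals, which return 0 on functions that are not integrable; with it, the functional
  really is the difference of the two measures. The clause \<open>has_dist_fourier\<close> certifies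
  that the definite description behind \<open>dist_fourier\<close> denotes.\<close>

theorem proposition4p3:
  fixes \<rho> :: "real measure" and lam :: real
  assumes "real_distribution \<rho>"
    and "exponential_moment \<rho>"
    and "lam = (\<integral>y. y \<partial>\<rho>)"
    and "lam > 0"
  shows "((\<forall>f. schwartz f \<longrightarrow> integrable (green_kernel \<rho>) f \<and> integrable (T_kernel lam) f) \<and>
          fast_decrease (measure_diff (green_kernel \<rho>) (T_kernel lam))
            \<longleftrightarrow> weakly_diophantine \<rho>) \<and>
         (weakly_diophantine \<rho> \<longrightarrow>
           has_dist_fourier (measure_diff (green_kernel \<rho>) (T_kernel lam))
             (dist_fourier (measure_diff (green_kernel \<rho>) (T_kernel lam))) \<and>
           (\<forall>\<xi>::real. \<xi> \<noteq> 0 \<longrightarrow>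
             dist_fourier (measure_diff (green_kernel \<rho>) (T_kernel lam)) \<xi> =
               1 / (1 - laplace \<rho> (- \<i> * of_real \<xi>)) + 1 / of_real lam * (1 / (\<i> * of_real \<xi>))))"
proof -
  interpret drifted_walk \<rho> lam
    using assms by (intro drifted_walk.intro drifted_walk_axioms.intro)
  have if_wd: "integrable (green_kernel \<rho>) f \<and> integrable (T_kernel lam) f"
    if wd: "weakly_diophantine \<rho>" and f: "schwartz f" for f
    using schwartz_integrable_measure(1)[OF integrable_green_kernel[OF wd] sets_green_kernel f]
      schwartz_integrable_measure(1)[OF integrable_T_kernel_square sets_T_kernel f] by blast
  show ?thesis
  proof (intro conjI iffI impI allI)
    assume "(\<forall>f. schwartz f \<longrightarrow> integrable (green_kernel \<rho>) f \<and> integrable (T_kernel lam) f) \<and> fast_decrease GmT"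
    then show "weakly_diophantine \<rho>"
      by (intro weakly_diophantine_if_fast_decrease) (auto simp: fast_decrease_def)
  next
    fix f :: "real \<Rightarrow> complex" assume "weakly_diophantine \<rho>" "schwartz f"
    with if_wd show "integrable (green_kernel \<rho>) f" "integrable (T_kernel lam) f" by blast+
  next
    assume "weakly_diophantine \<rho>"
    then show "fast_decrease GmT" by (rule fast_decrease_GmT)
  next
    assume "weakly_diophantine \<rho>"
    then show "has_dist_fourier GmT (dist_fourier GmT)"
      by (simp only: dist_fourier_GmT has_dist_fourier_GmT)
  next
    fix \<xi> :: real assume "weakly_diophantine \<rho>" "\<xi> \<noteq> 0"
    then show "dist_fourier GmT \<xi> = 1 / (1 - laplace \<rho> (- \<i> * of_real \<xi>)) + 1 / of_real lam * (1 / (\<i> * of_real \<xi>))"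
      unfolding laplace_eq_a by (simp only: dist_fourier_GmT) (rule h_eq)
  qed
qed

end
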